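(* Let $a,b,c>0$ and let $\Omega=(0,a)\times(0,b)\times(0,c)\subset\mathbb{R}^3$ be a rectangular parallelepiped with edge lengths $(a,b,c)$. Then, as $t\to0^+$, $$Z_\Omega(t)=\frac{abc}{(4\pi t)^{3/2}}-\frac{2(ab+bc+ac)}{16\pi t}+\frac{4(a+b+c)}{32\sqrt{\pi t}}-\frac18+o(1).$$
   Context: $Z_\Omega(t)=\mathrm{Tr}(e^{t\Delta_D})=\int_\Omega p_t(x,x)\,dx$ is the Dirichlet partition function, where $\Delta_D$ is the Dirichlet Laplacian on $\Omega$ and $p_t(x,y)$ is the Dirichlet heat kernel of $\partial_t u=\Delta u$ on $\Omega$. *)

theory Defs
  imports "HOL-Analysis.Analysis" "HOL-Library.Landau_Symbols"
begin

text \<open>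
  The space $L^2(\Omega)$, with Borel representatives instead of classes modulo null sets; it is
  used both for scalar functions and for vector fields. All conditions below depend only on the
  restriction of the functions to $\Omega$.
\<close>

definition L2_on :: "'a::euclidean_space set \<Rightarrow> ('a \<Rightarrow> 'b::euclidean_space) set" where
  "L2_on \<Omega> = {f. set_borel_measurable lborel \<Omega> f \<and> set_integrable lborel \<Omega> (\<lambda>x. (norm (f x))\<^sup>2)}"

definition L2_norm_on :: "'a::euclidean_space set \<Rightarrow> ('a \<Rightarrow> 'b::euclidean_space) \<Rightarrow> real" where
  "L2_norm_on \<Omega> f = sqrt (LINT x:\<Omega>|lborel. (norm (f x))\<^sup>2)"

text \<open>\<open>g\<close> is the gradient of the test function \<open>\<phi>\<close> of class $C^1_c(\Omega)$.\<close>

definition C1c_with_gradient ::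
    "'a::euclidean_space set \<Rightarrow> ('a \<Rightarrow> real) \<Rightarrow> ('a \<Rightarrow> 'a) \<Rightarrow> bool" where
  "C1c_with_gradient \<Omega> \<phi> g \<longleftrightarrow>
     (\<forall>x. GDERIV \<phi> x :> g x) \<and> continuous_on UNIV g \<and>
     (\<exists>K. compact K \<and> K \<subseteq> \<Omega> \<and> (\<forall>x. x \<notin> K \<longrightarrow> \<phi> x = 0))"

text \<open>
  \<open>u\<close> belongs to the Sobolev space $H^1_0(\Omega)$ and has weak gradient \<open>G\<close>: here $H^1_0(\Omega)$ is
  the closure of $C^1_c(\Omega)$ in the $H^1$ norm.
\<close>

definition H10_with_gradient ::
    "'a::euclidean_space set \<Rightarrow> ('a \<Rightarrow> real) \<Rightarrow> ('a \<Rightarrow> 'a) \<Rightarrow> bool" where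
  "H10_with_gradient \<Omega> u G \<longleftrightarrow>
     u \<in> L2_on \<Omega> \<and> G \<in> L2_on \<Omega> \<and>
     (\<exists>\<phi> g. (\<forall>n. C1c_with_gradient \<Omega> (\<phi> n) (g n)) \<and>
        (\<lambda>n::nat. L2_norm_on \<Omega> (\<lambda>x. \<phi> n x - u x)) \<longlonglongrightarrow> 0 \<and>
        (\<lambda>n::nat. L2_norm_on \<Omega> (\<lambda>x. g n x - G x)) \<longlonglongrightarrow> 0)"

text \<open>
  The graph of the Dirichlet Laplacian, the operator on $L^2(\Omega)$ associated with the Dirichlet
  form on $H^1_0(\Omega)$: \<open>u\<close> is in its domain and $\Delta_D u = v$.
\<close>

definition dirichlet_laplacian ::
    "'a::euclidean_space set \<Rightarrow> ('a \<Rightarrow> real) \<Rightarrow> ('a \<Rightarrow> real) \<Rightarrow> bool" where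
  "dirichlet_laplacian \<Omega> u v \<longleftrightarrow>
     v \<in> L2_on \<Omega> \<and>
     (\<exists>G. H10_with_gradient \<Omega> u G \<and>
        (\<forall>w H. H10_with_gradient \<Omega> w H \<longrightarrow>
           (LINT x:\<Omega>|lborel. G x \<bullet> H x) = - (LINT x:\<Omega>|lborel. v x * w x)))"

text \<open>
  \<open>u t\<close> is $e^{t\Delta_D} f$ for all \<open>t > 0\<close>: it solves the abstract Cauchy problem
  $u' = \Delta_D u$, $u(0) = f$ in $L^2(\Omega)$, with the derivative and the initial value taken in
  the $L^2$ norm.
\<close>

definition dirichlet_heat_flow ::
    "'a::euclidean_space set \<Rightarrow> ('a \<Rightarrow> real) \<Rightarrow> (real \<Rightarrow> 'a \<Rightarrow> real) \<Rightarrow> bool" where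
  "dirichlet_heat_flow \<Omega> f u \<longleftrightarrow>
     f \<in> L2_on \<Omega> \<and>
     (\<forall>t>0. \<exists>v. dirichlet_laplacian \<Omega> (u t) v \<and>
        ((\<lambda>h. L2_norm_on \<Omega> (\<lambda>x. (u (t + h) x - u t x) / h - v x)) \<longlongrightarrow> 0) (at 0)) \<and>
     ((\<lambda>t. L2_norm_on \<Omega> (\<lambda>x. u t x - f x)) \<longlongrightarrow> 0) (at_right 0)"

text \<open>
  The Dirichlet heat kernel is the integral kernel of $e^{t\Delta_D}$. Continuity selects the
  representative for which the values on the diagonal, a null set, are meaningful; it makes
  \<open>p t x y\<close> unique for \<open>t > 0\<close> and \<open>x, y \<in> \<Omega>\<close>, and the values elsewhere are irrelevant.
\<close>

definition is_dirichlet_heat_kernel ::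
    "'a::euclidean_space set \<Rightarrow> (real \<Rightarrow> 'a \<Rightarrow> 'a \<Rightarrow> real) \<Rightarrow> bool" where
  "is_dirichlet_heat_kernel \<Omega> p \<longleftrightarrow>
     (\<forall>t>0. continuous_on (\<Omega> \<times> \<Omega>) (\<lambda>(x, y). p t x y)) \<and>
     (\<forall>t>0. \<forall>x\<in>\<Omega>. p t x \<in> L2_on \<Omega>) \<and>
     (\<forall>f\<in>L2_on \<Omega>. dirichlet_heat_flow \<Omega> f (\<lambda>t x. LINT y:\<Omega>|lborel. p t x y * f y))"

definition dirichlet_heat_kernel ::
    "'a::euclidean_space set \<Rightarrow> real \<Rightarrow> 'a \<Rightarrow> 'a \<Rightarrow> real" where
  "dirichlet_heat_kernel \<Omega> = (SOME p. is_dirichlet_heat_kernel \<Omega> p)"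

definition dirichlet_partition_function :: "'a::euclidean_space set \<Rightarrow> real \<Rightarrow> real" where
  "dirichlet_partition_function \<Omega> t = (LINT x:\<Omega>|lborel. dirichlet_heat_kernel \<Omega> t x x)"

end

(*
  The Dirichlet eigenfunctions of the box are products of sines; by Stone-Weierstrass they span a
  dense subspace of L^2. Hence the eigenfunction series of the heat kernel solves the abstract Cauchy
  problem. Any other heat kernel agrees with it: the coefficients of a heat flow against the
  eigenfunctions satisfy a' = - lambda a, so flows are unique up to null sets, and continuity gives
  equality of the kernels at every point. Integrating the series over the diagonal, the partition
  function is the product over the edges of sum_k exp (- t (pi k / L)^2), and the Euler-Maclaurin formula of
  order 4 shows that this sum is L / (2 sqrt (pi t)) - 1/2 + O(t^(3/2)). Multiplying out yields the
  four terms: errors of order t^(3/2) are needed because the other two factors are of order 1/t.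
*)

theory Submission
  imports Defs "HOL-Probability.Probability"
begin

section \<open>The space $L^2$\<close>

text \<open>The kernel is chosen by \<open>SOME\<close>, so existence alone does not determine the
  partition function: uniqueness is needed at every point of the diagonal, a null set.

  The analysis is isolated in the locale \<open>dirichlet_eigenbasis\<close>, where uniformly
  bounded eigenfunctions and a finite heat trace make all series for t > 0 converge uniformly, so no
  spectral theory of unbounded operators enters. Only at t = 0 does uniform convergence fail; there
  contraction and density replace it.

  For the box three points need a device. The sines are smooth but not compactly supported, so a C^1
  truncation of their small values is what places them in H^1_0. They vanish on the boundary and
  their span is not closed under products, so Stone-Weierstrass is applied to the functions that
  multiply this span into itself. Finally, the k-th derivative of exp (- s x^2) has L^1 norm of
  order s^((k - 1) / 2), which is o(s) only for k > 3; hence order 4 in the summation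
  formula.\<close>

definition L2_inner :: "'a::euclidean_space set \<Rightarrow> ('a \<Rightarrow> 'b::euclidean_space) \<Rightarrow> ('a \<Rightarrow> 'b) \<Rightarrow> real" where
  "L2_inner W f g = (LINT x:W|lborel. f x \<bullet> g x)"

text \<open>Extending by zero turns conditions relative to \<open>W\<close> into global
  measurability and integrability, to which the unrestricted integration results apply.\<close>

lemma L2_on_iff:
  "f \<in> L2_on W \<longleftrightarrow> (\<lambda>x. indicator W x *\<^sub>R f x) \<in> borel_measurable lborel \<and>
     integrable lborel (\<lambda>x. (norm (indicator W x *\<^sub>R f x))\<^sup>2)"
proof -
  have "(\<lambda>x. indicator W x *\<^sub>R (norm (f x))\<^sup>2) = (\<lambda>x. (norm (indicator W x *\<^sub>R f x))\<^sup>2)"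
    by (auto simp: indicator_def fun_eq_iff)
  then show ?thesis
    by (simp add: L2_on_def set_borel_measurable_def set_integrable_def)
qed

lemma L2_on_inner_integrable:
  assumes "f \<in> L2_on W" "g \<in> L2_on W"
  shows "set_integrable lborel W (\<lambda>x. f x \<bullet> g x)"
proof -
  let ?f = "\<lambda>x. indicator W x *\<^sub>R f x" and ?g = "\<lambda>x. indicator W x *\<^sub>R g x"
  have [measurable]: "?f \<in> borel_measurable lborel" "?g \<in> borel_measurable lborel"
    using assms by (auto simp: L2_on_iff)
  have "integrable lborel (\<lambda>x. (norm (?f x))\<^sup>2 + (norm (?g x))\<^sup>2)"
    using assms by (auto simp: L2_on_iff)
  then have "integrable lborel (\<lambda>x. ?f x \<bullet> ?g x)"
  proof (rule Bochner_Integration.integrable_bound)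
    show "AE x in lborel. norm (?f x \<bullet> ?g x) \<le> norm ((norm (?f x))\<^sup>2 + (norm (?g x))\<^sup>2)"
    proof (rule AE_I2)
      fix x
      have "\<bar>?f x \<bullet> ?g x\<bar> \<le> norm (?f x) * norm (?g x)" by (rule Cauchy_Schwarz_ineq2)
      also have "\<dots> \<le> (norm (?f x))\<^sup>2 + (norm (?g x))\<^sup>2"
        using sum_squares_bound[of "norm (?f x)" "norm (?g x)"]
          mult_nonneg_nonneg[OF norm_ge_zero[of "?f x"] norm_ge_zero[of "?g x"]] by linarith
      finally show "norm (?f x \<bullet> ?g x) \<le> norm ((norm (?f x))\<^sup>2 + (norm (?g x))\<^sup>2)" by simp
    qed
  qed measurable
  moreover have "(\<lambda>x. ?f x \<bullet> ?g x) = (\<lambda>x. indicator W x *\<^sub>R (f x \<bullet> g x))"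
    by (auto simp: indicator_def fun_eq_iff)
  ultimately show ?thesis by (simp add: set_integrable_def)
qed

lemma L2_on_scaleR: "f \<in> L2_on W \<Longrightarrow> (\<lambda>x. c *\<^sub>R f x) \<in> L2_on W"
proof -
  assume f: "f \<in> L2_on W"
  have eq: "indicator W x *\<^sub>R c *\<^sub>R f x = c *\<^sub>R (indicator W x *\<^sub>R f x)"
    "(norm (c *\<^sub>R (indicator W x *\<^sub>R f x)))\<^sup>2 = c\<^sup>2 * (norm (indicator W x *\<^sub>R f x))\<^sup>2" for x
    by (simp_all add: power_mult_distrib mult.commute)
  show ?thesis
    using f unfolding L2_on_iff eq
    by (elim conjE, intro conjI borel_measurable_const_scaleR integrable_mult_right)
qed

lemma L2_on_add:
  assumes "f \<in> L2_on W" "g \<in> L2_on W"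
  shows "(\<lambda>x. f x + g x) \<in> L2_on W"
proof -
  have [simp]: "set_integrable lborel W (\<lambda>x. (norm (f x))\<^sup>2)" "set_integrable lborel W (\<lambda>x. (norm (g x))\<^sup>2)"
    using assms by (auto simp: L2_on_def)
  have "set_integrable lborel W (\<lambda>x. (norm (f x))\<^sup>2 + 2 * (f x \<bullet> g x) + (norm (g x))\<^sup>2)"
    using L2_on_inner_integrable[OF assms] by (intro set_integral_add) auto
  moreover have "(norm (f x + g x))\<^sup>2 = (norm (f x))\<^sup>2 + 2 * (f x \<bullet> g x) + (norm (g x))\<^sup>2" for x
    by (simp add: power2_norm_eq_inner inner_commute algebra_simps)
  moreover have "set_borel_measurable lborel W (\<lambda>x. f x + g x)"
    using assms by (auto simp: L2_on_def set_borel_measurable_def scaleR_add_right)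
  ultimately show ?thesis by (simp add: L2_on_def)
qed

lemma L2_on_mult: "f \<in> L2_on W \<Longrightarrow> (\<lambda>x. c * f x :: real) \<in> L2_on W"
  using L2_on_scaleR[of f W c] by simp

lemma L2_on_zero: "(\<lambda>x. 0) \<in> L2_on W"
  by (simp add: L2_on_iff)

lemma L2_on_diff:
  assumes "f \<in> L2_on W" "g \<in> L2_on W"
  shows "(\<lambda>x. f x - g x) \<in> L2_on W"
  using L2_on_add[OF assms(1) L2_on_scaleR[OF assms(2), of "-1"]] by simp

lemma L2_on_sum:
  assumes "\<And>i. i \<in> I \<Longrightarrow> f i \<in> L2_on W"
  shows "(\<lambda>x. \<Sum>i\<in>I. f i x) \<in> L2_on W"
  using assms by (induction I rule: infinite_finite_induct) (auto intro: L2_on_zero L2_on_add)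

lemma L2_inner_commute: "L2_inner W f g = L2_inner W g f"
  by (simp add: L2_inner_def inner_commute)

lemma L2_inner_add:
  assumes "f \<in> L2_on W" "g \<in> L2_on W" "h \<in> L2_on W"
  shows "L2_inner W (\<lambda>x. f x + g x) h = L2_inner W f h + L2_inner W g h"
  using assms by (simp add: L2_inner_def inner_add_left set_integral_add L2_on_inner_integrable)

lemma L2_inner_scaleR:
  "L2_inner W (\<lambda>x. c *\<^sub>R f x) h = c * L2_inner W f h"
  by (simp add: L2_inner_def)

lemma L2_inner_mult:
  "L2_inner W (\<lambda>x. c * f x :: real) h = c * L2_inner W f h"
  using L2_inner_scaleR[of W c f h] by simp

lemma L2_inner_zero: "L2_inner W (\<lambda>x. 0) h = 0"
  by (simp add: L2_inner_def)

lemma L2_inner_diff: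
  assumes "f \<in> L2_on W" "g \<in> L2_on W" "h \<in> L2_on W"
  shows "L2_inner W (\<lambda>x. f x - g x) h = L2_inner W f h - L2_inner W g h"
  using assms by (simp add: L2_inner_def inner_diff_left set_integral_diff L2_on_inner_integrable)

lemma L2_inner_sum:
  assumes "\<And>i. i \<in> I \<Longrightarrow> f i \<in> L2_on W" "h \<in> L2_on W"
  shows "L2_inner W (\<lambda>x. \<Sum>i\<in>I. f i x) h = (\<Sum>i\<in>I. L2_inner W (f i) h)"
  using assms
  by (induction I rule: infinite_finite_induct) (auto simp: L2_inner_zero L2_inner_add L2_on_sum)

lemma L2_inner_add_right:
  assumes "f \<in> L2_on W" "g \<in> L2_on W" "h \<in> L2_on W"
  shows "L2_inner W h (\<lambda>x. f x + g x) = L2_inner W h f + L2_inner W h g"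
  using L2_inner_add[OF assms] by (simp only: L2_inner_commute[of _ h])

lemma L2_inner_diff_right:
  assumes "f \<in> L2_on W" "g \<in> L2_on W" "h \<in> L2_on W"
  shows "L2_inner W h (\<lambda>x. f x - g x) = L2_inner W h f - L2_inner W h g"
  using L2_inner_diff[OF assms] by (simp only: L2_inner_commute[of _ h])

lemma L2_inner_scaleR_right: "L2_inner W h (\<lambda>x. c *\<^sub>R f x) = c * L2_inner W h f"
  by (simp add: L2_inner_def)

lemma L2_inner_mult_right: "L2_inner W h (\<lambda>x. c * f x :: real) = c * L2_inner W h f"
  using L2_inner_scaleR_right[of W h c f] by simp

lemma L2_inner_sum_right:
  assumes "\<And>i. i \<in> I \<Longrightarrow> f i \<in> L2_on W" "h \<in> L2_on W"
  shows "L2_inner W h (\<lambda>x. \<Sum>i\<in>I. f i x) = (\<Sum>i\<in>I. L2_inner W h (f i))"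
  using L2_inner_sum[OF assms] by (simp only: L2_inner_commute[of _ h])

lemma L2_inner_self_nonneg: "0 \<le> L2_inner W f f"
  unfolding L2_inner_def set_lebesgue_integral_def by (auto intro!: integral_nonneg_AE)

lemma L2_norm_on_eq: "L2_norm_on W f = sqrt (L2_inner W f f)"
  by (simp add: L2_norm_on_def L2_inner_def power2_norm_eq_inner)

lemma L2_norm_on_nonneg: "0 \<le> L2_norm_on W f"
  by (simp add: L2_norm_on_eq L2_inner_self_nonneg)

lemma L2_norm_on_power2: "(L2_norm_on W f)\<^sup>2 = L2_inner W f f"
  by (simp add: L2_norm_on_eq L2_inner_self_nonneg)

lemma L2_norm_on_cong: "(\<And>x. x \<in> W \<Longrightarrow> f x = g x) \<Longrightarrow> L2_norm_on W f = L2_norm_on W g"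
  unfolding L2_norm_on_def set_lebesgue_integral_def
  by (intro arg_cong[where f = sqrt] Bochner_Integration.integral_cong) (auto simp: indicator_def)

lemma L2_on_cong: "(\<And>x. x \<in> W \<Longrightarrow> f x = g x) \<Longrightarrow> f \<in> L2_on W \<Longrightarrow> g \<in> L2_on W"
proof -
  assume eq: "\<And>x. x \<in> W \<Longrightarrow> f x = g x" and f: "f \<in> L2_on W"
  have "(\<lambda>x. indicator W x *\<^sub>R g x) = (\<lambda>x. indicator W x *\<^sub>R f x)"
    using eq by (auto simp: indicator_def fun_eq_iff)
  with f show ?thesis unfolding L2_on_iff by metis
qed

lemma L2_norm_on_scaleR: "L2_norm_on W (\<lambda>x. c *\<^sub>R f x) = \<bar>c\<bar> * L2_norm_on W f"
  by (simp add: L2_norm_on_eq L2_inner_scaleR L2_inner_scaleR_right real_sqrt_mult flip: mult.assoc)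

lemma L2_norm_on_mult: "L2_norm_on W (\<lambda>x. c * f x :: real) = \<bar>c\<bar> * L2_norm_on W f"
  using L2_norm_on_scaleR[of W c f] by simp

lemma L2_norm_on_diff_commute: "L2_norm_on W (\<lambda>x. f x - g x) = L2_norm_on W (\<lambda>x. g x - f x)"
  by (simp add: L2_norm_on_def norm_minus_commute)

lemma L2_Cauchy_Schwarz:
  assumes f: "f \<in> L2_on W" and g: "g \<in> L2_on W"
  shows "\<bar>L2_inner W f g\<bar> \<le> L2_norm_on W f * L2_norm_on W g"
proof -
  let ?a = "L2_inner W f f" and ?b = "L2_inner W f g" and ?c = "L2_inner W g g"
  have q: "0 \<le> ?a - 2 * s * ?b + s\<^sup>2 * ?c" for s
  proof -
    have "0 \<le> L2_inner W (\<lambda>x. f x - s *\<^sub>R g x) (\<lambda>x. f x - s *\<^sub>R g x)"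
      by (rule L2_inner_self_nonneg)
    also have "\<dots> = ?a - 2 * s * ?b + s\<^sup>2 * ?c"
      using f g L2_on_scaleR[OF g, of s]
      by (simp add: L2_inner_diff L2_inner_diff_right L2_on_diff L2_inner_scaleR L2_inner_scaleR_right
          L2_inner_commute[of W g f] power2_eq_square algebra_simps)
    finally show ?thesis .
  qed
  have "?b\<^sup>2 \<le> ?a * ?c"
  \<comment> \<open>If \<open>g\<close> vanishes almost everywhere in \<open>W\<close>, the
    quadratic is affine in \<open>s\<close>; for \<open>?b\<close> nonzero the \<open>s\<close>
    chosen below would give it the value -1.\<close>
  proof (cases "?c = 0")
    case True
    have "?b = 0"
    proof (rule ccontr)
      assume "?b \<noteq> 0"
      with q[of "(?a + 1) / (2 * ?b)"] True show False by simp
    qed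
    with True show ?thesis by simp
  next
    case False
    then have "?c > 0" using L2_inner_self_nonneg[of W g] by simp
    with q[of "?b / ?c"] show ?thesis
      by (simp add: field_simps power2_eq_square)
  qed
  then have "\<bar>?b\<bar> \<le> sqrt (?a * ?c)"
    by (metis real_sqrt_abs real_sqrt_le_mono)
  then show ?thesis
    by (simp add: L2_norm_on_eq real_sqrt_mult)
qed

lemma L2_norm_on_triangle:
  assumes f: "f \<in> L2_on W" and g: "g \<in> L2_on W"
  shows "L2_norm_on W (\<lambda>x. f x + g x) \<le> L2_norm_on W f + L2_norm_on W g"
proof (rule power2_le_imp_le)
  have "(L2_norm_on W (\<lambda>x. f x + g x))\<^sup>2 =
      (L2_norm_on W f)\<^sup>2 + 2 * L2_inner W f g + (L2_norm_on W g)\<^sup>2"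
    using f g by (simp add: L2_norm_on_power2 L2_inner_add L2_on_add L2_inner_add_right
        L2_inner_commute[of W g f])
  also have "\<dots> \<le> (L2_norm_on W f + L2_norm_on W g)\<^sup>2"
    using L2_Cauchy_Schwarz[OF f g] by (simp add: power2_sum abs_le_iff)
  finally show "(L2_norm_on W (\<lambda>x. f x + g x))\<^sup>2 \<le> (L2_norm_on W f + L2_norm_on W g)\<^sup>2" .
qed (simp add: L2_norm_on_nonneg)

lemma L2_norm_on_triangle_diff:
  assumes f: "f \<in> L2_on W" and g: "g \<in> L2_on W" and h: "h \<in> L2_on W"
  shows "L2_norm_on W (\<lambda>x. f x - h x) \<le> L2_norm_on W (\<lambda>x. f x - g x) + L2_norm_on W (\<lambda>x. g x - h x)"
  using L2_norm_on_triangle[OF L2_on_diff[OF f g] L2_on_diff[OF g h]] by simp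

text \<open>The budget \<open>r / (1 + \<bar>c\<bar>)\<close> lets two errors of that size, one of
  them scaled by \<open>c\<close>, add up to less than \<open>r\<close>. Linearity of H^1_0 and of
  approximability by compactly supported functions both rest on it.\<close>

lemma L2_norm_on_linear_diff_less:
  assumes L: "f \<in> L2_on W" "f' \<in> L2_on W" "h \<in> L2_on W" "h' \<in> L2_on W"
    and f: "L2_norm_on W (\<lambda>x. f x - f' x) < r / (1 + \<bar>c\<bar>)"
    and h: "L2_norm_on W (\<lambda>x. h x - h' x) < r / (1 + \<bar>c\<bar>)"
  shows "L2_norm_on W (\<lambda>x. (f x + c *\<^sub>R h x) - (f' x + c *\<^sub>R h' x)) < r"
proof -
  have eq: "x + y * x = x * (1 + y)" for x y :: real by (simp add: distrib_left mult.commute)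
  have "L2_norm_on W (\<lambda>x. (f x + c *\<^sub>R h x) - (f' x + c *\<^sub>R h' x)) =
      L2_norm_on W (\<lambda>x. (f x - f' x) + c *\<^sub>R (h x - h' x))"
    by (intro L2_norm_on_cong) (simp add: algebra_simps)
  also have "\<dots> \<le> L2_norm_on W (\<lambda>x. f x - f' x) + \<bar>c\<bar> * L2_norm_on W (\<lambda>x. h x - h' x)"
    unfolding L2_norm_on_scaleR[symmetric] by (intro L2_norm_on_triangle L2_on_scaleR L2_on_diff L)
  also have "\<dots> < r / (1 + \<bar>c\<bar>) + \<bar>c\<bar> * (r / (1 + \<bar>c\<bar>))"
    using f h by (intro add_less_le_mono mult_left_mono) auto
  also have "\<dots> = r / (1 + \<bar>c\<bar>) * (1 + \<bar>c\<bar>)" by (rule eq)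
  also have "\<dots> = r" by (simp add: add_nonneg_eq_0_iff)
  finally show ?thesis .
qed

lemma tendsto_L2_inner:
  assumes fn: "\<And>n. f n \<in> L2_on W" and f: "f' \<in> L2_on W" and g: "g \<in> L2_on W"
    and lim: "((\<lambda>n. L2_norm_on W (\<lambda>x. f n x - f' x)) \<longlongrightarrow> 0) F"
  shows "((\<lambda>n. L2_inner W (f n) g) \<longlongrightarrow> L2_inner W f' g) F"
proof -
  have "((\<lambda>n. L2_inner W (f n) g - L2_inner W f' g) \<longlongrightarrow> 0) F"
  proof (rule Lim_null_comparison)
    show "\<forall>\<^sub>F n in F. norm (L2_inner W (f n) g - L2_inner W f' g)
        \<le> L2_norm_on W (\<lambda>x. f n x - f' x) * L2_norm_on W g"
      using L2_Cauchy_Schwarz[OF L2_on_diff[OF fn f] g] by (simp add: L2_inner_diff fn f g)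
    show "((\<lambda>n. L2_norm_on W (\<lambda>x. f n x - f' x) * L2_norm_on W g) \<longlongrightarrow> 0) F"
      using tendsto_mult_right[OF lim, of "L2_norm_on W g"] by simp
  qed
  then show ?thesis by (simp add: Lim_null[symmetric])
qed

lemma L2_on_bounded:
  assumes [measurable]: "W \<in> sets borel" and fin: "emeasure lborel W < \<infinity>"
    and meas: "set_borel_measurable lborel W f" and bd: "\<And>x. x \<in> W \<Longrightarrow> norm (f x) \<le> B"
  shows "f \<in> L2_on W"
    and "0 \<le> B \<Longrightarrow> L2_norm_on W f \<le> B * sqrt (measure lborel W)"
proof -
  have [measurable]: "(\<lambda>x. indicator W x *\<^sub>R f x) \<in> borel_measurable lborel"
    using meas by (simp add: set_borel_measurable_def)
  have iB: "integrable lborel (\<lambda>x. B\<^sup>2 * indicator W x)"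
    using fin by (intro integrable_mult_right integrable_real_indicator) auto
  have le: "(norm (indicator W x *\<^sub>R f x))\<^sup>2 \<le> B\<^sup>2 * indicator W x" for x
    using bd[of x] by (auto simp: indicator_def intro!: power_mono)
  have i: "integrable lborel (\<lambda>x. (norm (indicator W x *\<^sub>R f x))\<^sup>2)"
  proof (rule Bochner_Integration.integrable_bound[OF iB])
    show "AE x in lborel. norm ((norm (indicator W x *\<^sub>R f x))\<^sup>2) \<le> norm (B\<^sup>2 * indicator W x)"
      using le by (intro AE_I2) (metis abs_of_nonneg order_trans real_norm_def zero_le_power2)
  qed measurable
  then show "f \<in> L2_on W" by (simp add: L2_on_iff)
  assume B: "0 \<le> B"
  have "(LINT x|lborel. (norm (indicator W x *\<^sub>R f x))\<^sup>2) \<le> (LINT x|lborel. B\<^sup>2 * indicator W x)"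
    by (rule integral_mono[OF i iB le])
  also have "\<dots> = B\<^sup>2 * measure lborel W" by simp
  finally have "(LINT x:W|lborel. (norm (f x))\<^sup>2) \<le> B\<^sup>2 * measure lborel W"
    unfolding set_lebesgue_integral_def
    by (rule order_trans[rotated]) (auto intro!: eq_refl Bochner_Integration.integral_cong simp: indicator_def)
  then show "L2_norm_on W f \<le> B * sqrt (measure lborel W)"
    using B real_sqrt_le_mono[of _ "B\<^sup>2 * measure lborel W"]
    by (force simp: L2_norm_on_def real_sqrt_mult)
qed

lemma L2_norm_on_eq_0_AE:
  assumes f: "f \<in> L2_on W" and 0: "L2_norm_on W f = 0"
  shows "AE x in lborel. x \<in> W \<longrightarrow> f x = 0"
proof -
  have "(LINT x:W|lborel. (norm (f x))\<^sup>2) = 0"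
    using 0 by (simp add: L2_norm_on_def)
  moreover have "set_integrable lborel W (\<lambda>x. (norm (f x))\<^sup>2)"
    using f by (simp add: L2_on_def)
  ultimately have "AE x in lborel. indicator W x *\<^sub>R (norm (f x))\<^sup>2 = 0"
    unfolding set_lebesgue_integral_def set_integrable_def
    by (subst (asm) integral_nonneg_eq_0_iff_AE) auto
  then show ?thesis by (rule AE_mp) (auto simp: indicator_def)
qed

text \<open>On a set of finite measure uniform convergence is stronger than L^2 convergence. This is
  the bridge from the Weierstrass M-test to all L^2 statements about eigenfunction series.\<close>

lemma uniform_limit_imp_L2_tendsto:
  fixes f :: "nat \<Rightarrow> 'a::euclidean_space \<Rightarrow> 'b::euclidean_space"
  assumes W: "W \<in> sets borel" "emeasure lborel W < \<infinity>"
    and f: "\<And>n. set_borel_measurable lborel W (\<lambda>x. f n x - g x)"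
    and lim: "uniform_limit W f g sequentially"
  shows "(\<lambda>n. L2_norm_on W (\<lambda>x. f n x - g x)) \<longlonglongrightarrow> 0"
proof (rule tendstoI)
  fix r :: real assume r: "r > 0"
  \<comment> \<open>The added 1 keeps \<open>m\<close> positive even if \<open>W\<close> is null,
    and makes the final estimate strict.\<close>
  define m where "m = sqrt (measure lborel W) + 1"
  have m: "m > 0" by (simp add: m_def add_nonneg_pos)
  have "\<forall>\<^sub>F n in sequentially. \<forall>x\<in>W. dist (f n x) (g x) < r / m"
    using lim r m by (intro uniform_limitD) auto
  then show "\<forall>\<^sub>F n in sequentially. dist (L2_norm_on W (\<lambda>x. f n x - g x)) 0 < r"
  proof eventually_elim
    case (elim n)
    have "L2_norm_on W (\<lambda>x. f n x - g x) \<le> r / m * sqrt (measure lborel W)"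
      using elim r m by (intro L2_on_bounded(2)[OF W f]) (auto simp: dist_norm intro: less_imp_le)
    also have "\<dots> < r / m * m" using r m by (intro mult_strict_left_mono) (auto simp: m_def)
    also have "\<dots> = r" using m by simp
    finally show ?case by (simp add: L2_norm_on_nonneg)
  qed
qed

text \<open>Combinations are built by adjoining one term at a time, so that facts about the span
  follow by rule induction without finite index sets.\<close>

inductive_set lin_span :: "('a \<Rightarrow> real) set \<Rightarrow> ('a \<Rightarrow> real) set" for E where
  zero: "(\<lambda>x. 0) \<in> lin_span E"
| step: "w \<in> lin_span E \<Longrightarrow> e \<in> E \<Longrightarrow> (\<lambda>x. w x + c * e x) \<in> lin_span E"

lemma lin_span_incl: "e \<in> E \<Longrightarrow> e \<in> lin_span E"
  using lin_span.step[OF lin_span.zero, of e E 1] by simp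

lemma lin_span_add:
  assumes "v \<in> lin_span E" "w \<in> lin_span E"
  shows "(\<lambda>x. w x + v x) \<in> lin_span E"
  using assms(1)
proof (induction rule: lin_span.induct)
  case zero
  then show ?case using assms(2) by simp
next
  case (step v e c)
  from lin_span.step[OF step.IH step.hyps(2), of c] show ?case by (simp add: add.assoc)
qed

lemma lin_span_mult:
  assumes "w \<in> lin_span E"
  shows "(\<lambda>x. c * w x) \<in> lin_span E"
  using assms
proof (induction rule: lin_span.induct)
  case zero
  then show ?case by (simp add: lin_span.zero)
next
  case (step v e d)
  from lin_span.step[OF step.IH step.hyps(2), of "c * d"] show ?case by (simp add: algebra_simps)
qed

section \<open>The Sobolev space $H^1_0$\<close>

lemma set_borel_continuous:
  fixes f :: "'a::euclidean_space \<Rightarrow> 'b::euclidean_space"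
  assumes "W \<in> sets borel" "continuous_on UNIV f"
  shows "set_borel_measurable lborel W f"
proof -
  have [measurable]: "f \<in> borel_measurable borel"
    using assms by (intro borel_measurable_continuous_onI)
  show ?thesis
    using assms(1) unfolding set_borel_measurable_def by simp
qed

lemma C1c_continuous:
  assumes "C1c_with_gradient W \<phi> g"
  shows "continuous_on UNIV \<phi>"
proof -
  have "isCont \<phi> x" for x
    using assms unfolding C1c_with_gradient_def gderiv_def by (blast intro: has_derivative_continuous)
  then show ?thesis by (auto intro: continuous_at_imp_continuous_on)
qed

text \<open>The definition only makes the function vanish off \<open>K\<close>. Since the complement
  of \<open>K\<close> is open, the function is locally zero there, and uniqueness of the derivative
  kills the gradient as well.\<close>

lemma C1c_support:
  assumes "C1c_with_gradient W \<phi> g"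
  obtains K where "compact K" "K \<subseteq> W" "\<And>x. x \<notin> K \<Longrightarrow> \<phi> x = 0" "\<And>x. x \<notin> K \<Longrightarrow> g x = 0"
proof -
  obtain K where K: "compact K" "K \<subseteq> W" "\<And>x. x \<notin> K \<Longrightarrow> \<phi> x = 0"
    using assms by (auto simp: C1c_with_gradient_def)
  have "g x = 0" if "x \<notin> K" for x
  proof -
    have "eventually (\<lambda>y. y \<in> - K) (nhds x)"
      using that K(1) by (intro eventually_nhds_in_open) (auto simp: compact_imp_closed open_Compl)
    then have "eventually (\<lambda>y. \<phi> y = 0) (nhds x)"
      by eventually_elim (auto simp: K(3))
    moreover have "(\<phi> has_derivative (\<lambda>h. h \<bullet> g x)) (at x)"
      using assms by (auto simp: C1c_with_gradient_def gderiv_def)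
    ultimately have "((\<lambda>_. 0) has_derivative (\<lambda>h. h \<bullet> g x)) (at x)"
      by (intro has_derivative_transform_eventually[of \<phi> _ x UNIV "\<lambda>_. 0"])
        (use K(3)[OF that] in \<open>auto simp: eventually_at_filter elim: eventually_mono\<close>)
    then have "(\<lambda>h. h \<bullet> g x) = (\<lambda>h. 0)"
      by (rule has_derivative_unique[OF _ has_derivative_const])
    then show ?thesis by (metis inner_eq_zero_iff)
  qed
  with K that show thesis by blast
qed

text \<open>Boundedness and finite measure both come from the compact support \<open>K\<close>;
  extension by zero then passes from \<open>K\<close> to \<open>W\<close>.\<close>

lemma C1c_L2:
  assumes W: "open W" and \<phi>: "C1c_with_gradient W \<phi> g"
  shows "\<phi> \<in> L2_on W" "g \<in> L2_on W"
proof -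
  obtain K where K: "compact K" "K \<subseteq> W" "\<And>x. x \<notin> K \<Longrightarrow> \<phi> x = 0"
    and g0: "\<And>x. x \<notin> K \<Longrightarrow> g x = 0"
    using C1c_support[OF \<phi>] by blast
  have g: "continuous_on UNIV g" and \<phi>': "continuous_on UNIV \<phi>"
    using \<phi> C1c_continuous by (auto simp: C1c_with_gradient_def)
  have L2: "f \<in> L2_on W" if f: "continuous_on UNIV f" and f0: "\<And>x. x \<notin> K \<Longrightarrow> f x = 0"
    for f :: "'a \<Rightarrow> 'c::euclidean_space"
  proof -
    have "bounded (f ` K)"
      using f K(1) by (intro compact_imp_bounded compact_continuous_image) (auto intro: continuous_on_subset)
    then obtain B where B: "\<And>x. x \<in> K \<Longrightarrow> norm (f x) \<le> B"
      by (auto simp: bounded_iff)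
    have "f \<in> L2_on K"
      using K(1) f B
      by (intro L2_on_bounded(1)[where B = B] set_borel_continuous)
        (use emeasure_compact_finite[OF K(1)] in \<open>auto simp: borel_compact\<close>)
    moreover have "(\<lambda>x. indicator K x *\<^sub>R f x) = (\<lambda>x. indicator W x *\<^sub>R f x)"
      using f0 K(2) by (auto simp: indicator_def fun_eq_iff)
    ultimately show ?thesis unfolding L2_on_iff by metis
  qed
  show "\<phi> \<in> L2_on W" by (rule L2[OF \<phi>' K(3)])
  show "g \<in> L2_on W" by (rule L2[OF g g0])
qed

lemma H10_D:
  "H10_with_gradient W u G \<Longrightarrow> u \<in> L2_on W" "H10_with_gradient W u G \<Longrightarrow> G \<in> L2_on W"
  by (auto simp: H10_with_gradient_def)

lemma H10_approx:
  assumes "H10_with_gradient W u G" "r > 0"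
  obtains \<phi> g where "C1c_with_gradient W \<phi> g"
    "L2_norm_on W (\<lambda>x. \<phi> x - u x) < r" "L2_norm_on W (\<lambda>x. g x - G x) < r"
proof -
  obtain \<phi> g where c: "\<And>n::nat. C1c_with_gradient W (\<phi> n) (g n)"
    and l: "(\<lambda>n. L2_norm_on W (\<lambda>x. \<phi> n x - u x)) \<longlonglongrightarrow> 0"
      "(\<lambda>n. L2_norm_on W (\<lambda>x. g n x - G x)) \<longlonglongrightarrow> 0"
    using assms(1) unfolding H10_with_gradient_def by blast
  have "\<forall>\<^sub>F n in sequentially. L2_norm_on W (\<lambda>x. \<phi> n x - u x) < r \<and> L2_norm_on W (\<lambda>x. g n x - G x) < r"
    using order_tendstoD(2)[OF l(1) assms(2)] order_tendstoD(2)[OF l(2) assms(2)] by (rule eventually_conj)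
  then obtain n where "L2_norm_on W (\<lambda>x. \<phi> n x - u x) < r" "L2_norm_on W (\<lambda>x. g n x - G x) < r"
    by (metis (mono_tags, lifting) eventually_sequentially order_refl)
  with c that show thesis by blast
qed

text \<open>Together with \<open>H10_approx\<close> this trades the sequences of the definition for
  an epsilon condition, under which closedness and linearity become triangle inequalities.\<close>

lemma H10_I:
  assumes "u \<in> L2_on W" "G \<in> L2_on W"
    and "\<And>r. r > 0 \<Longrightarrow> \<exists>\<phi> g. C1c_with_gradient W \<phi> g \<and>
       L2_norm_on W (\<lambda>x. \<phi> x - u x) < r \<and> L2_norm_on W (\<lambda>x. g x - G x) < r"
  shows "H10_with_gradient W u G"
proof -
  have "\<forall>n. \<exists>\<phi> g. C1c_with_gradient W \<phi> g \<and>
       L2_norm_on W (\<lambda>x. \<phi> x - u x) < 1 / real (Suc n) \<and> L2_norm_on W (\<lambda>x. g x - G x) < 1 / real (Suc n)"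
    using assms(3) by simp
  then obtain \<phi> g where c: "\<And>n. C1c_with_gradient W (\<phi> n) (g n)"
    and l: "\<And>n. L2_norm_on W (\<lambda>x. \<phi> n x - u x) < 1 / real (Suc n)"
      "\<And>n. L2_norm_on W (\<lambda>x. g n x - G x) < 1 / real (Suc n)"
    by metis
  have z: "f \<longlonglongrightarrow> 0" if "\<And>n. 0 \<le> f n" "\<And>n. f n < 1 / real (Suc n)" for f :: "nat \<Rightarrow> real"
  proof (rule Lim_null_comparison)
    show "\<forall>\<^sub>F n in sequentially. norm (f n) \<le> 1 / real (Suc n)"
      using that by (intro always_eventually allI) (metis abs_of_nonneg less_imp_le real_norm_def)
    show "(\<lambda>n. 1 / real (Suc n)) \<longlonglongrightarrow> 0"
      using LIMSEQ_inverse_real_of_nat by (simp add: inverse_eq_divide)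
  qed
  show ?thesis
    unfolding H10_with_gradient_def
    by (intro conjI assms exI[of _ \<phi>] exI[of _ g]) (auto intro!: z c l L2_norm_on_nonneg)
qed

text \<open>A closure is closed. This is needed because an eigenfunction series is a limit of finite
  sums that are themselves only limits of test functions.\<close>

lemma H10_closed:
  assumes W: "open W" and n: "\<And>n::nat. H10_with_gradient W (u n) (G n)"
    and u: "u' \<in> L2_on W" and G: "G' \<in> L2_on W"
    and l: "(\<lambda>n. L2_norm_on W (\<lambda>x. u n x - u' x)) \<longlonglongrightarrow> 0"
      "(\<lambda>n. L2_norm_on W (\<lambda>x. G n x - G' x)) \<longlonglongrightarrow> 0"
  shows "H10_with_gradient W u' G'"
proof (rule H10_I[OF u G])
  fix r :: real assume r: "r > 0"
  then have r2: "r / 2 > 0" by simp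
  have "\<forall>\<^sub>F n in sequentially. L2_norm_on W (\<lambda>x. u n x - u' x) < r / 2 \<and> L2_norm_on W (\<lambda>x. G n x - G' x) < r / 2"
    using order_tendstoD(2)[OF l(1) r2] order_tendstoD(2)[OF l(2) r2] by (rule eventually_conj)
  then obtain n where A: "L2_norm_on W (\<lambda>x. u n x - u' x) < r / 2" "L2_norm_on W (\<lambda>x. G n x - G' x) < r / 2"
    by (metis (mono_tags, lifting) eventually_sequentially order_refl)
  obtain \<phi> g where c: "C1c_with_gradient W \<phi> g"
    and B: "L2_norm_on W (\<lambda>x. \<phi> x - u n x) < r / 2" "L2_norm_on W (\<lambda>x. g x - G n x) < r / 2"
    using H10_approx[OF assms(2) r2] by blast
  note L = C1c_L2[OF W c] H10_D[OF n]
  show "\<exists>\<phi> g. C1c_with_gradient W \<phi> g \<and>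
       L2_norm_on W (\<lambda>x. \<phi> x - u' x) < r \<and> L2_norm_on W (\<lambda>x. g x - G' x) < r"
    using A B c L2_norm_on_triangle_diff[OF L(1) L(3)[of n] u] L2_norm_on_triangle_diff[OF L(2) L(4)[of n] G]
    by (intro exI[of _ \<phi>] exI[of _ g]) auto
qed

lemma C1c_linear:
  assumes "C1c_with_gradient W \<phi> g" "C1c_with_gradient W \<psi> h"
  shows "C1c_with_gradient W (\<lambda>x. \<phi> x + c * \<psi> x) (\<lambda>x. g x + c *\<^sub>R h x)"
proof -
  obtain K L where K: "compact K" "K \<subseteq> W" "\<And>x. x \<notin> K \<Longrightarrow> \<phi> x = 0"
    and L: "compact L" "L \<subseteq> W" "\<And>x. x \<notin> L \<Longrightarrow> \<psi> x = 0"
    using assms by (auto simp: C1c_with_gradient_def)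
  have "((\<lambda>x. \<phi> x + c * \<psi> x) has_derivative (\<lambda>y. y \<bullet> g x + c * (y \<bullet> h x))) (at x)" for x
    using assms unfolding C1c_with_gradient_def gderiv_def
    by (intro has_derivative_add has_derivative_mult_right) auto
  moreover have "continuous_on UNIV (\<lambda>x. g x + c *\<^sub>R h x)"
    using assms unfolding C1c_with_gradient_def by (intro continuous_intros) auto
  moreover have "\<exists>K. compact K \<and> K \<subseteq> W \<and> (\<forall>x. x \<notin> K \<longrightarrow> \<phi> x + c * \<psi> x = 0)"
    using K L by (intro exI[of _ "K \<union> L"]) auto
  ultimately show ?thesis
    by (auto simp: C1c_with_gradient_def gderiv_def inner_add_right)
qed

lemma H10_linear:
  assumes W: "open W" and u: "H10_with_gradient W u G" and v: "H10_with_gradient W v H"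
  shows "H10_with_gradient W (\<lambda>x. u x + c * v x) (\<lambda>x. G x + c *\<^sub>R H x)"
proof (rule H10_I)
  note [simp] = H10_D[OF u] H10_D[OF v]
  show "(\<lambda>x. u x + c * v x) \<in> L2_on W" "(\<lambda>x. G x + c *\<^sub>R H x) \<in> L2_on W"
    by (auto intro!: L2_on_add L2_on_mult L2_on_scaleR)
  fix r :: real assume r: "r > 0"
  then have s: "r / (1 + \<bar>c\<bar>) > 0" by (simp add: add_pos_nonneg)
  obtain \<phi> g where A: "C1c_with_gradient W \<phi> g"
    "L2_norm_on W (\<lambda>x. \<phi> x - u x) < r / (1 + \<bar>c\<bar>)" "L2_norm_on W (\<lambda>x. g x - G x) < r / (1 + \<bar>c\<bar>)"
    using H10_approx[OF u s] by blast
  obtain \<psi> h where B: "C1c_with_gradient W \<psi> h"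
    "L2_norm_on W (\<lambda>x. \<psi> x - v x) < r / (1 + \<bar>c\<bar>)" "L2_norm_on W (\<lambda>x. h x - H x) < r / (1 + \<bar>c\<bar>)"
    using H10_approx[OF v s] by blast
  note [simp] = C1c_L2[OF W A(1)] C1c_L2[OF W B(1)]
  show "\<exists>\<phi> g. C1c_with_gradient W \<phi> g \<and> L2_norm_on W (\<lambda>x. \<phi> x - (u x + c * v x)) < r \<and>
      L2_norm_on W (\<lambda>x. g x - (G x + c *\<^sub>R H x)) < r"
    using C1c_linear[OF A(1) B(1), of c] L2_norm_on_linear_diff_less[OF _ _ _ _ A(2) B(2)]
      L2_norm_on_linear_diff_less[OF _ _ _ _ A(3) B(3)]
    by (intro exI conjI) auto
qed

lemma H10_zero: "H10_with_gradient W (\<lambda>x. 0) (\<lambda>x. 0)"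
  by (rule H10_I)
    (auto intro!: exI[of _ "\<lambda>x. 0"] exI[of _ "{}"] L2_on_zero
      simp: C1c_with_gradient_def gderiv_def L2_norm_on_def)

text \<open>Everything follows from 1 + x <= exp x: applied at - z it gives
  \<open>exp z - 1 \<le> z * exp z\<close>, so the remainder is at most
  \<open>z * (exp z - 1)\<close>. The bound controls the difference quotients of
  \<open>exp (- t * lam n)\<close> for all \<open>n\<close> at once.\<close>

lemma abs_exp_minus_1_minus_le:
  fixes z :: real
  shows "\<bar>exp z - 1 - z\<bar> \<le> z\<^sup>2 * exp \<bar>z\<bar>"
proof -
  have 0: "exp z - 1 - z \<ge> 0" using exp_ge_add_one_self[of z] by linarith
  have "(1 - z) * exp z \<le> exp (- z) * exp z"
    using exp_ge_add_one_self[of "- z"] by (intro mult_right_mono) auto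
  then have 1: "exp z - 1 \<le> z * exp z" by (simp add: algebra_simps flip: exp_add)
  have "\<bar>exp z - 1\<bar> \<le> \<bar>z\<bar> * exp \<bar>z\<bar>"
  proof (cases "z \<ge> 0")
    case True
    with 1 show ?thesis by simp
  next
    case False
    have "\<bar>exp z - 1\<bar> \<le> \<bar>z\<bar> * 1" using 0 False exp_le_one_iff[of z] by (simp add: algebra_simps)
    also have "\<dots> \<le> \<bar>z\<bar> * exp \<bar>z\<bar>" by (intro mult_left_mono) auto
    finally show ?thesis .
  qed
  then have "\<bar>z\<bar> * \<bar>exp z - 1\<bar> \<le> \<bar>z\<bar> * (\<bar>z\<bar> * exp \<bar>z\<bar>)"
    by (intro mult_left_mono) auto
  moreover have "exp z - 1 - z \<le> z * (exp z - 1)"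
    using 1 by (simp add: algebra_simps)
  moreover have "z * (exp z - 1) \<le> \<bar>z\<bar> * \<bar>exp z - 1\<bar>" by (simp flip: abs_mult)
  ultimately show ?thesis using 0 by (simp add: power2_eq_square mult.assoc)
qed

section \<open>Heat kernel from an eigenbasis\<close>

text \<open>The bound on \<open>e\<close> is uniform in \<open>n\<close> and that on
  \<open>g\<close> grows at most linearly in the eigenvalue; against \<open>summable_exp\<close>
  both are harmless. \<open>weak_e\<close> is the eigenvalue equation in the form tested against all
  of H^1_0, as the definition of the Laplacian demands.\<close>

locale dirichlet_eigenbasis =
  fixes W :: "'a::euclidean_space set" and e :: "nat \<Rightarrow> 'a \<Rightarrow> real" and g :: "nat \<Rightarrow> 'a \<Rightarrow> 'a"
    and lam :: "nat \<Rightarrow> real" and M :: real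
  assumes open_W: "open W" and finite_W: "emeasure lborel W < \<infinity>"
    and continuous_e: "continuous_on UNIV (e n)" and continuous_g: "continuous_on UNIV (g n)"
    and e_bound: "\<bar>e n x\<bar> \<le> M" and g_bound: "norm (g n x) \<le> M * (1 + lam n)"
    and H10_e: "H10_with_gradient W (e n) (g n)"
    and weak_e: "H10_with_gradient W w H \<Longrightarrow> L2_inner W (g n) H = lam n * L2_inner W (e n) w"
    and orthonormal: "L2_inner W (e n) (e m) = (if n = m then 1 else 0)"
    and lam_nonneg: "0 \<le> lam n"
    and summable_exp: "t > 0 \<Longrightarrow> summable (\<lambda>n. exp (- t * lam n))"
    and dense: "f \<in> L2_on W \<Longrightarrow> r > 0 \<Longrightarrow> \<exists>w\<in>lin_span (range e). L2_norm_on W (\<lambda>x. f x - w x) < r"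
begin

lemma W_borel [measurable, simp]: "W \<in> sets borel"
  using open_W by simp

lemma M_nonneg: "0 \<le> M"
  using e_bound[of 0 0] by linarith

lemma e_L2 [simp]: "e n \<in> L2_on W" and [simp]: "g n \<in> L2_on W"
  using H10_D[OF H10_e] by auto

lemma lin_span_L2: "w \<in> lin_span (range e) \<Longrightarrow> w \<in> L2_on W"
  by (induction rule: lin_span.induct) (auto intro!: L2_on_zero L2_on_add L2_on_mult)

lemma L2_norm_e: "L2_norm_on W (e n) = 1"
  by (simp add: L2_norm_on_eq orthonormal)

section \<open>Coefficients, completeness and summability\<close>

definition coeff :: "('a \<Rightarrow> real) \<Rightarrow> nat \<Rightarrow> real" where
  "coeff f n = L2_inner W f (e n)"

lemma coeff_bound: "f \<in> L2_on W \<Longrightarrow> \<bar>coeff f n\<bar> \<le> L2_norm_on W f"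
  using L2_Cauchy_Schwarz[of f W "e n"] by (simp add: coeff_def L2_norm_e)

text \<open>For \<open>f\<close> orthogonal to the span, the square of its norm equals <f, f - w>
  for every \<open>w\<close> in the span. A \<open>w\<close> closer to \<open>f\<close> than the
  norm of \<open>f\<close> then contradicts Cauchy-Schwarz.\<close>

lemma complete:
  assumes f: "f \<in> L2_on W" and orth: "\<And>n. coeff f n = 0"
  shows "L2_norm_on W f = 0"
proof (rule ccontr)
  assume neq: "L2_norm_on W f \<noteq> 0"
  then have pos: "L2_norm_on W f > 0" using L2_norm_on_nonneg[of W f] by simp
  then obtain w where w: "w \<in> lin_span (range e)" "L2_norm_on W (\<lambda>x. f x - w x) < L2_norm_on W f"
    using dense[OF f] by blast
  have "L2_inner W f w = 0"
    using w(1)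
  proof (induction rule: lin_span.induct)
    case zero
    then show ?case using L2_inner_zero[of W f] by (simp add: L2_inner_commute[of W f])
  next
    case (step w e' c)
    then show ?case
      using orth f by (auto simp: L2_inner_add_right lin_span_L2 L2_on_mult L2_inner_mult_right coeff_def)
  qed
  then have "(L2_norm_on W f)\<^sup>2 = L2_inner W f (\<lambda>x. f x - w x)"
    using f lin_span_L2[OF w(1)] by (simp add: L2_norm_on_power2 L2_inner_diff_right)
  also have "\<dots> \<le> L2_norm_on W f * L2_norm_on W (\<lambda>x. f x - w x)"
    using L2_Cauchy_Schwarz[OF f L2_on_diff[OF f lin_span_L2[OF w(1)]]] by simp
  also have "\<dots> < L2_norm_on W f * L2_norm_on W f"
    using w(2) pos by simp
  finally show False by (simp add: power2_eq_square)
qed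

text \<open>The polynomial factor is paid for with half of the decay: \<open>C = 1 + 4 / t\<close>
  gives \<open>1 + lam n \<le> C * exp (t * lam n / 4)\<close>, and squaring uses up
  \<open>exp (t * lam n / 2)\<close>.\<close>

lemma summable_one_plus_lam:
  assumes t: "t > 0"
  shows "summable (\<lambda>n. (1 + lam n)\<^sup>2 * exp (- t * lam n))"
proof -
  define C where "C = 1 + 4 / t"
  have C: "C \<ge> 1" using t by (simp add: C_def)
  have le: "1 + lam n \<le> C * exp (t * lam n / 4)" for n
  proof -
    have "1 + lam n \<le> C * (1 + t * lam n / 4)"
      using t lam_nonneg[of n] by (simp add: C_def field_simps)
    also have "\<dots> \<le> C * exp (t * lam n / 4)"
      using C by (intro mult_left_mono exp_ge_add_one_self) auto
    finally show ?thesis .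
  qed
  have le2: "(1 + lam n)\<^sup>2 * exp (- t * lam n) \<le> C\<^sup>2 * exp (- (t / 2) * lam n)" for n
  proof -
    have "(1 + lam n)\<^sup>2 \<le> (C * exp (t * lam n / 4))\<^sup>2"
      using le lam_nonneg[of n] by (intro power_mono) auto
    then have "(1 + lam n)\<^sup>2 * exp (- t * lam n) \<le> (C * exp (t * lam n / 4))\<^sup>2 * exp (- t * lam n)"
      by (intro mult_right_mono) auto
    also have "\<dots> = C\<^sup>2 * exp (- (t / 2) * lam n)"
      by (simp add: power2_eq_square algebra_simps flip: exp_add)
    finally show ?thesis .
  qed
  have "summable (\<lambda>n. C\<^sup>2 * exp (- (t / 2) * lam n))"
    using t by (intro summable_mult summable_exp) auto
  then show ?thesis
    by (rule summable_comparison_test'[where N = 0]) (use le2 in simp)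
qed

section \<open>Uniformly convergent eigenfunction expansions\<close>

definition expand :: "(nat \<Rightarrow> real) \<Rightarrow> 'a \<Rightarrow> real" where
  "expand a x = (\<Sum>n. a n * e n x)"

definition grad_expand :: "(nat \<Rightarrow> real) \<Rightarrow> 'a \<Rightarrow> 'a" where
  "grad_expand a x = (\<Sum>n. a n *\<^sub>R g n x)"

lemma summable_abs_expand: "summable (\<lambda>n. \<bar>a n\<bar>) \<Longrightarrow> summable (\<lambda>n. a n * e n x)"
proof (rule summable_comparison_test')
  assume "summable (\<lambda>n. \<bar>a n\<bar>)"
  then show "summable (\<lambda>n. \<bar>a n\<bar> * M)" by (rule summable_mult2)
  show "norm (a n * e n x) \<le> \<bar>a n\<bar> * M" if "n \<ge> 0" for n
    using e_bound[of n x] by (simp add: abs_mult mult_left_mono)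
qed

lemma uniform_limit_expand:
  assumes "summable (\<lambda>n. \<bar>a n\<bar>)"
  shows "uniform_limit UNIV (\<lambda>N x. \<Sum>n<N. a n * e n x) (expand a) sequentially"
  unfolding expand_def
proof (rule Weierstrass_m_test)
  show "summable (\<lambda>n. \<bar>a n\<bar> * M)" using assms by (rule summable_mult2)
  show "norm (a n * e n x) \<le> \<bar>a n\<bar> * M" for n x
    using e_bound[of n x] by (simp add: abs_mult mult_left_mono)
qed

lemma uniform_limit_grad_expand:
  assumes "summable (\<lambda>n. \<bar>a n\<bar> * (1 + lam n))"
  shows "uniform_limit UNIV (\<lambda>N x. \<Sum>n<N. a n *\<^sub>R g n x) (grad_expand a) sequentially"
  unfolding grad_expand_def
proof (rule Weierstrass_m_test)
  show "summable (\<lambda>n. \<bar>a n\<bar> * (1 + lam n) * M)" using assms by (rule summable_mult2)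
  show "norm (a n *\<^sub>R g n x) \<le> \<bar>a n\<bar> * (1 + lam n) * M" for n x
    using mult_left_mono[OF g_bound[of n x], of "\<bar>a n\<bar>"] by (simp add: algebra_simps)
qed

lemma continuous_expand:
  assumes "summable (\<lambda>n. \<bar>a n\<bar>)"
  shows "continuous_on UNIV (expand a)"
  by (rule uniform_limit_theorem[OF _ uniform_limit_expand[OF assms]])
    (auto intro!: always_eventually continuous_intros continuous_e)

lemma continuous_grad_expand:
  assumes "summable (\<lambda>n. \<bar>a n\<bar> * (1 + lam n))"
  shows "continuous_on UNIV (grad_expand a)"
  by (rule uniform_limit_theorem[OF _ uniform_limit_grad_expand[OF assms]])
    (auto intro!: always_eventually continuous_intros continuous_g)

lemma expand_bound:
  assumes "summable (\<lambda>n. \<bar>a n\<bar>)"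
  shows "\<bar>expand a x\<bar> \<le> M * (\<Sum>n. \<bar>a n\<bar>)"
proof -
  have le: "norm (a n * e n x) \<le> \<bar>a n\<bar> * M" for n
    using e_bound[of n x] by (simp add: abs_mult mult_left_mono)
  have s: "summable (\<lambda>n. \<bar>a n\<bar> * M)" using assms by (rule summable_mult2)
  have "norm (expand a x) \<le> (\<Sum>n. \<bar>a n\<bar> * M)"
    unfolding expand_def by (rule norm_suminf_le[OF le s])
  then show ?thesis using suminf_mult[OF assms, of M] by (simp add: mult.commute)
qed

lemma expand_L2 [simp]:
  assumes "summable (\<lambda>n. \<bar>a n\<bar>)"
  shows "expand a \<in> L2_on W"
    and "L2_norm_on W (expand a) \<le> M * (\<Sum>n. \<bar>a n\<bar>) * sqrt (measure lborel W)"
  using L2_on_bounded[OF W_borel finite_W set_borel_continuous[OF W_borel continuous_expand[OF assms]]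
      expand_bound[OF assms, folded real_norm_def]]
    M_nonneg suminf_nonneg[OF assms] by auto

lemma grad_expand_L2 [simp]:
  assumes "summable (\<lambda>n. \<bar>a n\<bar> * (1 + lam n))"
  shows "grad_expand a \<in> L2_on W"
proof -
  have le: "norm (a n *\<^sub>R g n x) \<le> \<bar>a n\<bar> * (1 + lam n) * M" for n x
    using mult_left_mono[OF g_bound[of n x], of "\<bar>a n\<bar>"] by (simp add: algebra_simps)
  have s: "summable (\<lambda>n. \<bar>a n\<bar> * (1 + lam n) * M)" using assms by (rule summable_mult2)
  have "norm (grad_expand a x) \<le> (\<Sum>n. \<bar>a n\<bar> * (1 + lam n) * M)" for x
    unfolding grad_expand_def by (rule norm_suminf_le[OF le s])
  then show ?thesis
    by (intro L2_on_bounded(1)[OF W_borel finite_W] set_borel_continuous continuous_grad_expand assms) auto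
qed

lemma tendsto_L2_expand:
  assumes "summable (\<lambda>n. \<bar>a n\<bar>)"
  shows "(\<lambda>N. L2_norm_on W (\<lambda>x. (\<Sum>n<N. a n * e n x) - expand a x)) \<longlonglongrightarrow> 0"
  using assms
  by (intro uniform_limit_imp_L2_tendsto finite_W set_borel_continuous W_borel
      continuous_intros continuous_e continuous_expand uniform_limit_on_subset[OF uniform_limit_expand]) auto

lemma tendsto_L2_grad_expand:
  assumes "summable (\<lambda>n. \<bar>a n\<bar> * (1 + lam n))"
  shows "(\<lambda>N. L2_norm_on W (\<lambda>x. (\<Sum>n<N. a n *\<^sub>R g n x) - grad_expand a x)) \<longlonglongrightarrow> 0"
  using assms
  by (intro uniform_limit_imp_L2_tendsto finite_W set_borel_continuous W_borel
      continuous_intros continuous_g continuous_grad_expand uniform_limit_on_subset[OF uniform_limit_grad_expand]) auto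

text \<open>A single weighted summability condition thus serves the function, its gradient and its
  Laplacian.\<close>

lemma summable_lam_imp:
  assumes "summable (\<lambda>n. \<bar>a n\<bar> * (1 + lam n))"
  shows "summable (\<lambda>n. \<bar>a n\<bar>)" "summable (\<lambda>n. \<bar>lam n * a n\<bar>)"
  using lam_nonneg by (auto intro!: summable_comparison_test'[OF assms] simp: algebra_simps abs_mult)

lemma expand_inner:
  assumes "summable (\<lambda>n. \<bar>a n\<bar>)" "f \<in> L2_on W"
  shows "(\<lambda>n. a n * L2_inner W (e n) f) sums L2_inner W (expand a) f"
proof -
  have "(\<lambda>N. L2_inner W (\<lambda>x. \<Sum>n<N. a n * e n x) f) \<longlonglongrightarrow> L2_inner W (expand a) f"
    using assms by (intro tendsto_L2_inner tendsto_L2_expand) (auto intro!: L2_on_sum L2_on_mult)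
  then show ?thesis
    using assms by (simp add: sums_def L2_inner_sum L2_on_mult L2_inner_mult)
qed

lemma grad_expand_inner:
  assumes "summable (\<lambda>n. \<bar>a n\<bar> * (1 + lam n))" "f \<in> L2_on W"
  shows "(\<lambda>n. a n * L2_inner W (g n) f) sums L2_inner W (grad_expand a) f"
proof -
  have "(\<lambda>N. L2_inner W (\<lambda>x. \<Sum>n<N. a n *\<^sub>R g n x) f) \<longlonglongrightarrow> L2_inner W (grad_expand a) f"
    using assms by (intro tendsto_L2_inner tendsto_L2_grad_expand) (auto intro!: L2_on_sum L2_on_scaleR)
  then show ?thesis
    using assms by (simp add: sums_def L2_inner_sum L2_on_scaleR L2_inner_scaleR)
qed

lemma H10_expand:
  assumes "summable (\<lambda>n. \<bar>a n\<bar> * (1 + lam n))"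
  shows "H10_with_gradient W (expand a) (grad_expand a)"
proof (rule H10_closed[OF open_W])
  show "H10_with_gradient W (\<lambda>x. \<Sum>n<N. a n * e n x) (\<lambda>x. \<Sum>n<N. a n *\<^sub>R g n x)" for N
    by (induction N) (simp_all add: H10_zero H10_linear open_W H10_e)
qed (use assms in \<open>auto intro!: tendsto_L2_expand tendsto_L2_grad_expand expand_L2 summable_lam_imp\<close>)

text \<open>After the inner products are taken inside the sums, \<open>weak_e\<close> matches the
  two sides of the weak equation term by term, so they are limits of the same numerical
  series.\<close>

lemma dirichlet_laplacian_expand:
  assumes "summable (\<lambda>n. \<bar>a n\<bar> * (1 + lam n))"
  shows "dirichlet_laplacian W (expand a) (expand (\<lambda>n. - (lam n * a n)))"
  unfolding dirichlet_laplacian_def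
proof (intro conjI exI[of _ "grad_expand a"] allI impI)
  have s: "summable (\<lambda>n. \<bar>- (lam n * a n)\<bar>)" using summable_lam_imp[OF assms] by simp
  then show "expand (\<lambda>n. - (lam n * a n)) \<in> L2_on W" by simp
  show "H10_with_gradient W (expand a) (grad_expand a)" by (rule H10_expand[OF assms])
  fix w H assume w: "H10_with_gradient W w H"
  have "(\<lambda>n. - (a n * L2_inner W (g n) H)) sums L2_inner W (expand (\<lambda>n. - (lam n * a n))) w"
    using expand_inner[OF s, of w] w by (simp add: H10_D weak_e mult_ac)
  moreover have "(\<lambda>n. - (a n * L2_inner W (g n) H)) sums - L2_inner W (grad_expand a) H"
    using w by (intro sums_minus grad_expand_inner assms) (auto simp: H10_D)
  ultimately have "L2_inner W (expand (\<lambda>n. - (lam n * a n))) w = - L2_inner W (grad_expand a) H"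
    by (rule sums_unique2)
  then show "(LINT x:W|lborel. grad_expand a x \<bullet> H x) =
      - (LINT x:W|lborel. expand (\<lambda>n. - (lam n * a n)) x * w x)"
    by (simp add: L2_inner_def)
qed

lemma expand_diff:
  assumes "summable (\<lambda>n. \<bar>a n\<bar>)" "summable (\<lambda>n. \<bar>b n\<bar>)"
  shows "expand a x - expand b x = expand (\<lambda>n. a n - b n) x"
  using suminf_diff[OF summable_abs_expand[OF assms(1), of x] summable_abs_expand[OF assms(2), of x]]
  by (simp add: expand_def algebra_simps)

lemma expand_add:
  assumes "summable (\<lambda>n. \<bar>a n\<bar>)" "summable (\<lambda>n. \<bar>b n\<bar>)"
  shows "expand a x + expand b x = expand (\<lambda>n. a n + b n) x"
  using suminf_add[OF summable_abs_expand[OF assms(1), of x] summable_abs_expand[OF assms(2), of x]]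
  by (simp add: expand_def algebra_simps)

lemma expand_mult:
  assumes "summable (\<lambda>n. \<bar>a n\<bar>)"
  shows "c * expand a x = expand (\<lambda>n. c * a n) x"
  using suminf_mult[OF summable_abs_expand[OF assms(1), of x], of c]
  by (simp add: expand_def algebra_simps)

section \<open>The heat semigroup and its kernel as series\<close>

abbreviation decay :: "real \<Rightarrow> nat \<Rightarrow> real" where
  "decay t n \<equiv> exp (- t * lam n)"

definition heat_coeff :: "('a \<Rightarrow> real) \<Rightarrow> real \<Rightarrow> nat \<Rightarrow> real" where
  "heat_coeff f t n = exp (- t * lam n) * coeff f n"

abbreviation heat :: "('a \<Rightarrow> real) \<Rightarrow> real \<Rightarrow> 'a \<Rightarrow> real" where
  "heat f t \<equiv> expand (heat_coeff f t)"

abbreviation heat_dt :: "('a \<Rightarrow> real) \<Rightarrow> real \<Rightarrow> 'a \<Rightarrow> real" where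
  "heat_dt f t \<equiv> expand (\<lambda>n. - (lam n * heat_coeff f t n))"

text \<open>The usual bilinear eigenfunction series, read as an expansion in the second variable
  with \<open>x\<close> frozen, so that the results on \<open>expand\<close> apply to it
  directly.\<close>

definition kernel :: "real \<Rightarrow> 'a \<Rightarrow> 'a \<Rightarrow> real" where
  "kernel t x = expand (\<lambda>n. decay t n * e n x)"

text \<open>Used with two bounded sequences: the coefficients of an L^2 function, and the values
  \<open>e n x\<close> at a fixed point.\<close>

lemma summable_one_plus_lam_exp:
  assumes t: "t > 0" and c: "\<And>n. \<bar>c n\<bar> \<le> K"
  shows "summable (\<lambda>n. \<bar>decay t n * c n\<bar> * (1 + lam n))"
    and "summable (\<lambda>n. \<bar>decay t n * c n\<bar>)"
proof -
  have K: "K \<ge> 0" using c[of 0] by linarith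
  have "summable (\<lambda>n. K * ((1 + lam n)\<^sup>2 * decay t n))"
    by (intro summable_mult summable_one_plus_lam t)
  then show *: "summable (\<lambda>n. \<bar>decay t n * c n\<bar> * (1 + lam n))"
  proof (rule summable_comparison_test'[where N = 0])
    fix n
    have "\<bar>c n\<bar> * (1 + lam n) \<le> K * (1 + lam n)\<^sup>2"
      using c[of n] K lam_nonneg[of n] by (intro mult_mono) (auto simp: power2_eq_square)
    from mult_right_mono[OF this, of "decay t n"]
    show "norm (\<bar>decay t n * c n\<bar> * (1 + lam n)) \<le> K * ((1 + lam n)\<^sup>2 * decay t n)"
      using lam_nonneg[of n] by (simp add: abs_mult mult_ac)
  qed
  show "summable (\<lambda>n. \<bar>decay t n * c n\<bar>)"
    using summable_lam_imp(1)[OF *] .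
qed

lemma summable_heat_coeff:
  assumes "t > 0" "f \<in> L2_on W"
  shows "summable (\<lambda>n. \<bar>heat_coeff f t n\<bar> * (1 + lam n))" "summable (\<lambda>n. \<bar>heat_coeff f t n\<bar>)"
  unfolding heat_coeff_def
  using summable_one_plus_lam_exp[OF assms(1) coeff_bound[OF assms(2)]] by auto

lemma summable_kernel_coeff:
  "t > 0 \<Longrightarrow> summable (\<lambda>n. \<bar>decay t n * e n x\<bar>)"
  using summable_one_plus_lam_exp(2)[OF _ e_bound] .

lemma kernel_L2: "t > 0 \<Longrightarrow> kernel t x \<in> L2_on W"
  unfolding kernel_def using summable_kernel_coeff by simp

lemma kernel_integral:
  assumes "t > 0" "f \<in> L2_on W"
  shows "(LINT y:W|lborel. kernel t x y * f y) = heat f t x"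
proof -
  have "(\<lambda>n. decay t n * e n x * L2_inner W (e n) f) sums L2_inner W (kernel t x) f"
    unfolding kernel_def using assms summable_kernel_coeff by (intro expand_inner) auto
  then have "(\<Sum>n. decay t n * e n x * L2_inner W (e n) f) = L2_inner W (kernel t x) f"
    by (rule sums_unique[symmetric])
  then show ?thesis
    by (simp add: L2_inner_def expand_def heat_coeff_def coeff_def mult_ac L2_inner_commute[of W f])
qed

text \<open>Continuity in each variable separately would not suffice, so the M-test is run on pairs
  of points.\<close>

lemma continuous_kernel:
  assumes t: "t > 0"
  shows "continuous_on UNIV (\<lambda>(x, y). kernel t x y)"
proof -
  have ul: "uniform_limit UNIV (\<lambda>N z. \<Sum>n<N. decay t n * e n (fst z) * e n (snd z))
     (\<lambda>z. \<Sum>n. decay t n * e n (fst z) * e n (snd z)) sequentially"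
  proof (rule Weierstrass_m_test)
    show "summable (\<lambda>n. decay t n * (M * M))"
      using t by (intro summable_mult2 summable_exp)
    show "norm (decay t n * e n (fst z) * e n (snd z)) \<le> decay t n * (M * M)" for n and z :: "'a \<times> 'a"
      using e_bound[of n] M_nonneg by (auto simp: abs_mult mult.assoc intro!: mult_left_mono mult_mono)
  qed
  have cont: "continuous_on UNIV (\<lambda>z :: 'a \<times> 'a. \<Sum>n<N. decay t n * e n (fst z) * e n (snd z))" for N
    by (intro continuous_intros continuous_on_compose2[OF continuous_e]) auto
  have "continuous_on UNIV (\<lambda>z :: 'a \<times> 'a. \<Sum>n. decay t n * e n (fst z) * e n (snd z))"
    by (rule uniform_limit_theorem[OF always_eventually[OF allI[OF cont]] ul]) simp
  then show ?thesis by (simp add: kernel_def expand_def case_prod_unfold)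
qed

lemma L2_norm_sum_e:
  "(L2_norm_on W (\<lambda>x. \<Sum>n<N. a n * e n x))\<^sup>2 = (\<Sum>n<N. (a n)\<^sup>2)"
proof -
  let ?s = "\<lambda>x. \<Sum>n<N. a n * e n x"
  have s: "?s \<in> L2_on W" by (intro L2_on_sum L2_on_mult) simp
  have es: "L2_inner W (e n) ?s = a n" if "n < N" for n
    using that by (simp add: L2_inner_sum_right L2_on_mult L2_inner_mult_right orthonormal sum.delta if_distrib cong: if_cong)
  have "L2_inner W ?s ?s = (\<Sum>n<N. (a n)\<^sup>2)"
    using s by (subst L2_inner_sum) (auto simp: L2_on_mult L2_inner_mult es power2_eq_square)
  then show ?thesis by (simp add: L2_norm_on_power2)
qed

lemma bessel:
  assumes f: "f \<in> L2_on W"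
  shows "(\<Sum>n<N. (coeff f n)\<^sup>2) \<le> (L2_norm_on W f)\<^sup>2"
proof -
  let ?s = "\<lambda>x. \<Sum>n<N. coeff f n * e n x"
  have s: "?s \<in> L2_on W" by (intro L2_on_sum L2_on_mult) simp
  have fs: "L2_inner W f ?s = (\<Sum>n<N. (coeff f n)\<^sup>2)"
    using f by (simp add: L2_inner_sum_right L2_on_mult L2_inner_mult_right coeff_def power2_eq_square)
  have ss: "L2_inner W ?s ?s = (\<Sum>n<N. (coeff f n)\<^sup>2)"
    using L2_norm_sum_e[of "coeff f" N] by (simp only: L2_norm_on_power2)
  have "0 \<le> L2_inner W (\<lambda>x. f x - ?s x) (\<lambda>x. f x - ?s x)"
    by (rule L2_inner_self_nonneg)
  also have "\<dots> = (L2_norm_on W f)\<^sup>2 - (\<Sum>n<N. (coeff f n)\<^sup>2)"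
    using f s fs ss by (simp add: L2_inner_diff L2_inner_diff_right L2_on_diff L2_norm_on_power2 L2_inner_commute[of W ?s f])
  finally show ?thesis by simp
qed

text \<open>Nonnegative eigenvalues shrink every coefficient, so Bessel's inequality bounds the
  partial sums, and the bound survives the L^2 limit. This uniformity in \<open>t\<close> is what
  carries the initial condition from the span to all of L^2.\<close>

lemma heat_contraction:
  assumes t: "t > 0" and f: "f \<in> L2_on W"
  shows "L2_norm_on W (heat f t) \<le> L2_norm_on W f"
proof -
  note s = summable_heat_coeff(2)[OF t f]
  let ?S = "\<lambda>N x. \<Sum>n<N. heat_coeff f t n * e n x"
  have SL: "?S N \<in> L2_on W" for N by (intro L2_on_sum L2_on_mult) simp
  have S: "L2_norm_on W (?S N) \<le> L2_norm_on W f" for N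
  proof (rule power2_le_imp_le)
    have "(\<Sum>n<N. (heat_coeff f t n)\<^sup>2) \<le> (\<Sum>n<N. (coeff f n)\<^sup>2)"
    proof (rule sum_mono)
      fix n
      have "\<bar>heat_coeff f t n\<bar> \<le> 1 * \<bar>coeff f n\<bar>"
        using t lam_nonneg[of n] unfolding heat_coeff_def abs_mult by (intro mult_right_mono) auto
      then show "(heat_coeff f t n)\<^sup>2 \<le> (coeff f n)\<^sup>2" by (simp add: abs_le_square_iff)
    qed
    then show "(L2_norm_on W (?S N))\<^sup>2 \<le> (L2_norm_on W f)\<^sup>2"
      using bessel[OF f, of N] by (simp add: L2_norm_sum_e)
  qed (rule L2_norm_on_nonneg)
  have "L2_norm_on W (heat f t) \<le>
      L2_norm_on W (\<lambda>x. ?S N x - heat f t x) + L2_norm_on W f" for N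
  proof -
    have "L2_norm_on W (\<lambda>x. heat f t x - 0) \<le>
        L2_norm_on W (\<lambda>x. heat f t x - ?S N x) + L2_norm_on W (\<lambda>x. ?S N x - 0)"
      by (intro L2_norm_on_triangle_diff SL L2_on_zero expand_L2 s)
    then show ?thesis
      using S[of N] by (simp add: L2_norm_on_diff_commute[of W "heat f t"])
  qed
  moreover have "(\<lambda>N. L2_norm_on W (\<lambda>x. ?S N x - heat f t x) + L2_norm_on W f)
      \<longlonglongrightarrow> 0 + L2_norm_on W f"
    by (intro tendsto_add tendsto_const tendsto_L2_expand s)
  ultimately show ?thesis
    by (intro LIMSEQ_le_const[of _ "L2_norm_on W f"]) auto
qed

lemma heat_diff:
  assumes t: "t > 0" and f: "f \<in> L2_on W" and h: "h \<in> L2_on W"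
  shows "heat (\<lambda>x. f x - h x) t x = heat f t x - heat h t x"
proof -
  have "heat_coeff (\<lambda>x. f x - h x) t = (\<lambda>n. heat_coeff f t n - heat_coeff h t n)"
    using f h by (simp add: heat_coeff_def coeff_def L2_inner_diff right_diff_distrib fun_eq_iff)
  then show ?thesis
    using expand_diff[OF summable_heat_coeff(2)[OF t f] summable_heat_coeff(2)[OF t h]] by simp
qed

text \<open>On a single eigenfunction the flow is multiplication by an exponential, which tends to
  1; each further term of the span adds one such error.\<close>

lemma heat_initial_span:
  assumes "w \<in> lin_span (range e)"
  shows "((\<lambda>t. L2_norm_on W (\<lambda>x. heat w t x - w x)) \<longlongrightarrow> 0) (at_right 0)"
  using assms
proof (induction rule: lin_span.induct)
  case zero
  then show ?case by (simp add: heat_coeff_def coeff_def L2_inner_zero expand_def L2_norm_on_def)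
next
  case (step w e' c)
  then obtain m where m: "e' = e m" by auto
  have w: "w \<in> L2_on W" using step lin_span_L2 by auto
  let ?B = "\<lambda>t. L2_norm_on W (\<lambda>x. heat w t x - w x) + \<bar>c * (decay t m - 1)\<bar>"
  show ?case
  proof (rule Lim_null_comparison)
    have "((\<lambda>t. ?B t)
        \<longlongrightarrow> 0 + \<bar>c * (exp (- 0 * lam m) - 1)\<bar>) (at_right 0)"
      by (intro tendsto_intros step.IH)
    then show "((\<lambda>t. ?B t)
        \<longlongrightarrow> 0) (at_right 0)" by simp
    have "L2_norm_on W (\<lambda>x. heat (\<lambda>x. w x + c * e' x) t x - (w x + c * e' x)) \<le>
        ?B t" if t: "t > 0" for t
    proof -
      note s = summable_heat_coeff(2)[OF t w]
      \<comment> \<open>By orthonormality, adding a multiple of \<open>e m\<close> changes only the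
        coefficient with index \<open>m\<close>.\<close>
      have eq: "heat_coeff (\<lambda>x. w x + c * e' x) t = (\<lambda>n. heat_coeff w t n + c * (if n = m then decay t m else 0))"
        by (auto simp: heat_coeff_def coeff_def m L2_inner_add w L2_on_mult L2_inner_mult orthonormal algebra_simps fun_eq_iff)
      have fin: "summable (\<lambda>n. \<bar>c * (if n = m then decay t m else 0)\<bar>)"
        by (rule summable_finite[of "{m}"]) auto
      have single: "expand (\<lambda>n. c * (if n = m then decay t m else 0)) x = c * decay t m * e m x" for x
        unfolding expand_def by (subst suminf_finite[of "{m}"]) auto
      have "heat (\<lambda>x. w x + c * e' x) t x = heat w t x + c * decay t m * e m x" for x
        unfolding eq using expand_add[OF s fin, of x] by (simp only: single)
      then have "L2_norm_on W (\<lambda>x. heat (\<lambda>x. w x + c * e' x) t x - (w x + c * e' x)) =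
          L2_norm_on W (\<lambda>x. (heat w t x - w x) + c * (decay t m - 1) * e m x)"
        by (intro L2_norm_on_cong) (simp add: m algebra_simps)
      also have "\<dots> \<le> L2_norm_on W (\<lambda>x. heat w t x - w x) +
          L2_norm_on W (\<lambda>x. c * (decay t m - 1) * e m x)"
        by (intro L2_norm_on_triangle L2_on_diff L2_on_mult expand_L2 s w e_L2)
      finally show ?thesis by (simp only: L2_norm_on_mult L2_norm_e mult_1_right)
    qed
    then show "\<forall>\<^sub>F t in at_right 0. norm (L2_norm_on W (\<lambda>x. heat (\<lambda>x. w x + c * e' x) t x - (w x + c * e' x))) \<le>
        ?B t"
      by (auto simp: eventually_at_right_field L2_norm_on_nonneg intro!: exI[of _ 1])
  qed
qed

text \<open>The coefficients of a general \<open>f\<close> need not be absolutely summable, so the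
  series gives no uniform control as \<open>t\<close> tends to 0. Instead \<open>f\<close> is
  compared with a nearby \<open>w\<close> in the span: contraction handles the flows, and the span
  case handles \<open>w\<close>.\<close>

lemma heat_initial:
  assumes f: "f \<in> L2_on W"
  shows "((\<lambda>t. L2_norm_on W (\<lambda>x. heat f t x - f x)) \<longlongrightarrow> 0) (at_right 0)"
proof (rule tendstoI)
  fix r :: real assume r: "r > 0"
  then obtain w where w: "w \<in> lin_span (range e)" "L2_norm_on W (\<lambda>x. f x - w x) < r / 3"
    using dense[OF f, of "r / 3"] by auto
  note wL = lin_span_L2[OF w(1)]
  have "\<forall>\<^sub>F t in at_right 0. L2_norm_on W (\<lambda>x. heat w t x - w x) < r / 3"
    using heat_initial_span[OF w(1)] r by (intro order_tendstoD) auto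
  moreover have "\<forall>\<^sub>F t in at_right 0. (0::real) < t"
    by (rule eventually_at_right_less)
  ultimately show "\<forall>\<^sub>F t in at_right 0. dist (L2_norm_on W (\<lambda>x. heat f t x - f x)) 0 < r"
  proof eventually_elim
    case (elim t)
    note L = expand_L2(1)[OF summable_heat_coeff(2)[OF elim(2) f]] expand_L2(1)[OF summable_heat_coeff(2)[OF elim(2) wL]]
    have "L2_norm_on W (\<lambda>x. heat f t x - heat w t x) \<le> L2_norm_on W (\<lambda>x. f x - w x)"
      using heat_contraction[OF elim(2) L2_on_diff[OF f wL]] by (simp add: heat_diff[OF elim(2) f wL, abs_def] cong: L2_norm_on_cong)
    moreover have "L2_norm_on W (\<lambda>x. heat f t x - f x) \<le>
        L2_norm_on W (\<lambda>x. heat f t x - heat w t x) + L2_norm_on W (\<lambda>x. heat w t x - f x)"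
      by (intro L2_norm_on_triangle_diff L f)
    moreover have "L2_norm_on W (\<lambda>x. heat w t x - f x) \<le>
        L2_norm_on W (\<lambda>x. heat w t x - w x) + L2_norm_on W (\<lambda>x. w x - f x)"
      by (intro L2_norm_on_triangle_diff L f wL)
    ultimately show ?case
      using elim w(2) by (simp add: L2_norm_on_nonneg L2_norm_on_diff_commute[of W w])
  qed
qed

text \<open>The error is itself an expansion, whose coefficients are second-order remainders of
  \<open>exp (- h * lam n)\<close>. Keeping the step below \<open>t / 2\<close> costs at most half
  of the decay, and the other half sums the factor \<open>(lam n)\<^sup>2\<close>.\<close>

lemma heat_derivative:
  assumes t: "t > 0" and f: "f \<in> L2_on W"
  shows "((\<lambda>h. L2_norm_on W (\<lambda>x. (heat f (t + h) x - heat f t x) / h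
             - heat_dt f t x)) \<longlongrightarrow> 0) (at 0)"
proof (rule Lim_null_comparison)
  \<comment> \<open>A majorant, up to the norm of \<open>f\<close>, of the coefficients of the
    second time derivative, evaluated at time \<open>t / 2\<close>.\<close>
  define b where "b n = lam n ^ 2 * exp (- (t / 2) * lam n)" for n
  have b: "summable b"
  proof (rule summable_comparison_test'[OF summable_one_plus_lam[of "t / 2"], where N = 0])
    show "norm (b n) \<le> (1 + lam n)\<^sup>2 * exp (- (t / 2) * lam n)" for n
      using lam_nonneg[of n] by (auto simp: b_def intro!: mult_right_mono power_mono)
  qed (use t in auto)
  define C where "C = M * (L2_norm_on W f * suminf b) * sqrt (measure lborel W)"
  have "((\<lambda>h. \<bar>h\<bar> * C) \<longlongrightarrow> \<bar>0\<bar> * C) (at 0)" by (intro tendsto_intros)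
  then show "((\<lambda>h. \<bar>h\<bar> * C) \<longlongrightarrow> 0) (at 0)" by simp
  have "L2_norm_on W (\<lambda>x. (heat f (t + h) x - heat f t x) / h
             - heat_dt f t x) \<le> \<bar>h\<bar> * C" if h: "h \<noteq> 0" "\<bar>h\<bar> < t / 2" for h
  proof -
    have th: "t + h > 0" using h t by linarith
    define d where "d n = (heat_coeff f (t + h) n - heat_coeff f t n) / h + lam n * heat_coeff f t n" for n
    note s1 = summable_heat_coeff[OF t f] and s2 = summable_heat_coeff[OF th f]
    have s3: "summable (\<lambda>n. \<bar>(heat_coeff f (t + h) n - heat_coeff f t n) * inverse h\<bar>)"
    proof (rule summable_comparison_test'[where N = 0])
      show "summable (\<lambda>n. (\<bar>heat_coeff f (t + h) n\<bar> + \<bar>heat_coeff f t n\<bar>) * \<bar>inverse h\<bar>)"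
        by (intro summable_mult2 summable_add s1 s2)
    qed (auto simp: abs_mult intro!: mult_right_mono)
    have s4: "summable (\<lambda>n. \<bar>- (lam n * heat_coeff f t n)\<bar>)" using summable_lam_imp(2)[OF s1(1)] by simp
    have s5: "summable (\<lambda>n. \<bar>heat_coeff f (t + h) n - heat_coeff f t n\<bar>)"
    proof (rule summable_comparison_test'[where N = 0])
      show "summable (\<lambda>n. \<bar>heat_coeff f (t + h) n\<bar> + \<bar>heat_coeff f t n\<bar>)"
        by (intro summable_add s1 s2)
    qed auto
    have eq: "(heat f (t + h) x - heat f t x) / h
             - heat_dt f t x = expand d x" for x
      using expand_diff[OF s2(2) s1(2), of x] expand_mult[OF s5, of "inverse h" x]
        expand_diff[OF s3 s4, of x]
      by (simp add: d_def[abs_def] divide_inverse mult_ac)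
    have d_le: "\<bar>d n\<bar> \<le> \<bar>h\<bar> * (L2_norm_on W f * b n)" for n
    proof -
      have "exp (- (t + h) * lam n) = decay t n * exp (- h * lam n)"
        by (simp add: algebra_simps flip: exp_add)
      then have "d n = coeff f n * decay t n * ((exp (- h * lam n) - 1 - (- h * lam n)) / h)"
        using h by (simp add: d_def heat_coeff_def field_simps)
      then have "\<bar>d n\<bar> = \<bar>coeff f n\<bar> * decay t n * (\<bar>exp (- h * lam n) - 1 - (- h * lam n)\<bar> / \<bar>h\<bar>)"
        by (simp add: abs_mult)
      also have "\<dots> \<le> L2_norm_on W f * decay t n * ((h * lam n)\<^sup>2 * exp (t / 2 * lam n) / \<bar>h\<bar>)"
      proof (intro mult_mono divide_right_mono coeff_bound f)
        have "\<bar>exp (- h * lam n) - 1 - (- h * lam n)\<bar> \<le> (- h * lam n)\<^sup>2 * exp \<bar>- h * lam n\<bar>"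
          by (rule abs_exp_minus_1_minus_le)
        also have "\<dots> \<le> (h * lam n)\<^sup>2 * exp (t / 2 * lam n)"
          using mult_right_mono[OF less_imp_le[OF h(2)] lam_nonneg[of n]] lam_nonneg[of n]
          by (intro mult_mono) (auto simp: power_mult_distrib abs_mult)
        finally show "\<bar>exp (- h * lam n) - 1 - (- h * lam n)\<bar> \<le> (h * lam n)\<^sup>2 * exp (t / 2 * lam n)" .
      qed (auto simp: L2_norm_on_nonneg)
      also have "\<dots> = L2_norm_on W f * (lam n)\<^sup>2 * (h\<^sup>2 / \<bar>h\<bar>) * (decay t n * exp (t / 2 * lam n))"
        by (simp add: power_mult_distrib field_simps)
      also have "decay t n * exp (t / 2 * lam n) = exp (- (t / 2) * lam n)"
        by (simp add: algebra_simps flip: exp_add)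
      also have "h\<^sup>2 / \<bar>h\<bar> = \<bar>h\<bar>"
        by (metis power2_abs power2_eq_square nonzero_mult_div_cancel_left h(1) abs_eq_0)
      finally show ?thesis by (simp add: b_def mult_ac)
    qed
    have sb: "summable (\<lambda>n. \<bar>h\<bar> * (L2_norm_on W f * b n))"
      by (intro summable_mult b)
    have sd: "summable (\<lambda>n. \<bar>d n\<bar>)"
      by (rule summable_comparison_test'[OF sb, where N = 0]) (use d_le in auto)
    have "(\<Sum>n. \<bar>d n\<bar>) \<le> (\<Sum>n. \<bar>h\<bar> * (L2_norm_on W f * b n))"
      by (intro suminf_le d_le sd sb)
    also have "\<dots> = \<bar>h\<bar> * (L2_norm_on W f * suminf b)"
      using b by (simp add: suminf_mult summable_mult)
    finally have "M * (\<Sum>n. \<bar>d n\<bar>) * sqrt (measure lborel W) \<le> M * (\<bar>h\<bar> * (L2_norm_on W f * suminf b)) * sqrt (measure lborel W)"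
      using M_nonneg by (intro mult_right_mono mult_left_mono) auto
    then show ?thesis
      using expand_L2(2)[OF sd] by (simp add: eq C_def mult_ac)
  qed
  then show "\<forall>\<^sub>F h in at 0. norm (L2_norm_on W (\<lambda>x. (heat f (t + h) x - heat f t x) / h
             - heat_dt f t x)) \<le> \<bar>h\<bar> * C"
    using t by (auto simp: eventually_at dist_norm L2_norm_on_nonneg intro!: exI[of _ "t / 2"])
qed

lemma is_dirichlet_heat_kernel_kernel: "is_dirichlet_heat_kernel W kernel"
  unfolding is_dirichlet_heat_kernel_def dirichlet_heat_flow_def
proof (intro conjI allI impI ballI)
  fix t :: real assume "t > 0"
  then show "continuous_on (W \<times> W) (\<lambda>(x, y). kernel t x y)"
    using continuous_kernel continuous_on_subset by blast
next
  fix t :: real and x assume "t > 0"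
  then show "kernel t x \<in> L2_on W" by (rule kernel_L2)
next
  fix f :: "'a \<Rightarrow> real" assume f: "f \<in> L2_on W" then show "f \<in> L2_on W" .
  \<comment> \<open>The identity between kernel integral and series is available for positive times
    only; hence the detour through an eventual equality, here and for the derivative below.\<close>
  have "\<forall>\<^sub>F t in at_right 0. L2_norm_on W (\<lambda>x. heat f t x - f x) =
      L2_norm_on W (\<lambda>x. (LINT y:W|lborel. kernel t x y * f y) - f x)"
    using f by (auto simp: eventually_at_right_field kernel_integral intro!: exI[of _ 1])
  then show "((\<lambda>t. L2_norm_on W (\<lambda>x. (LINT y:W|lborel. kernel t x y * f y) - f x)) \<longlongrightarrow> 0) (at_right 0)"
    using heat_initial[OF f] by (rule Lim_transform_eventually[rotated])
  fix t :: real assume t: "t > 0"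
  show "\<exists>v. dirichlet_laplacian W (\<lambda>x. LINT y:W|lborel. kernel t x y * f y) v \<and>
     ((\<lambda>h. L2_norm_on W (\<lambda>x. ((LINT y:W|lborel. kernel (t + h) x y * f y) -
        (LINT y:W|lborel. kernel t x y * f y)) / h - v x)) \<longlongrightarrow> 0) (at 0)"
  proof (intro exI conjI)
    show "dirichlet_laplacian W (\<lambda>x. LINT y:W|lborel. kernel t x y * f y) (heat_dt f t)"
      using dirichlet_laplacian_expand[OF summable_heat_coeff(1)[OF t f]] t f by (simp add: kernel_integral)
    \<comment> \<open>For steps smaller than \<open>t\<close> in absolute value the time
      \<open>t + h\<close> stays positive.\<close>
    have "\<forall>\<^sub>F h in at 0. L2_norm_on W (\<lambda>x. (heat f (t + h) x - heat f t x) / h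
             - heat_dt f t x) =
        L2_norm_on W (\<lambda>x. ((LINT y:W|lborel. kernel (t + h) x y * f y) -
        (LINT y:W|lborel. kernel t x y * f y)) / h - heat_dt f t x)"
      using t f by (auto simp: eventually_at dist_norm kernel_integral intro!: exI[of _ t])
    then show "((\<lambda>h. L2_norm_on W (\<lambda>x. ((LINT y:W|lborel. kernel (t + h) x y * f y) -
        (LINT y:W|lborel. kernel t x y * f y)) / h - heat_dt f t x)) \<longlongrightarrow> 0) (at 0)"
      using heat_derivative[OF t f] by (rule Lim_transform_eventually[rotated])
  qed
qed

section \<open>Uniqueness of heat flows and of the kernel\<close>

lemma flow_in_L2:
  assumes "dirichlet_heat_flow W f u" "t > 0"
  shows "u t \<in> L2_on W"
  using assms unfolding dirichlet_heat_flow_def dirichlet_laplacian_def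
  by (blast dest: H10_D)

text \<open>Taking a coefficient is Lipschitz for the L^2 norm, so the derivative passes to it.
  Testing the weak equation with \<open>e n\<close>, and the eigenvalue equation with the flow,
  evaluates the coefficient of the time derivative.\<close>

lemma flow_coeff_derivative:
  assumes u: "dirichlet_heat_flow W f u" and t: "t > 0"
  shows "((\<lambda>t. coeff (u t) n) has_real_derivative - lam n * coeff (u t) n) (at t)"
proof -
  let ?q = "\<lambda>v h. (coeff (u (t + h)) n - coeff (u t) n) / h - L2_inner W v (e n)"
  obtain v where v: "dirichlet_laplacian W (u t) v"
    and lim: "((\<lambda>h. L2_norm_on W (\<lambda>x. (u (t + h) x - u t x) / h - v x)) \<longlongrightarrow> 0) (at 0)"
    using u t by (auto simp: dirichlet_heat_flow_def)
  obtain G where G: "H10_with_gradient W (u t) G"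
    and weak: "\<And>w H. H10_with_gradient W w H \<Longrightarrow>
      (LINT x:W|lborel. G x \<bullet> H x) = - (LINT x:W|lborel. v x * w x)" and vL: "v \<in> L2_on W"
    using v by (auto simp: dirichlet_laplacian_def)
  have "L2_inner W v (e n) = - L2_inner W G (g n)"
    using weak[OF H10_e[of n]] by (simp add: L2_inner_def)
  also have "\<dots> = - lam n * coeff (u t) n"
    using weak_e[OF G, of n] by (simp add: coeff_def L2_inner_commute)
  finally have ve: "L2_inner W v (e n) = - lam n * coeff (u t) n" .
  have "((\<lambda>h. ?q v h) \<longlongrightarrow> 0) (at 0)"
  proof (rule Lim_null_comparison[OF _ lim])
    have "norm (?q v h) \<le>
        L2_norm_on W (\<lambda>x. (u (t + h) x - u t x) / h - v x)" if h: "\<bar>h\<bar> < t" for h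
    proof -
      have uL: "u (t + h) \<in> L2_on W" "u t \<in> L2_on W"
        using h t by (auto intro!: flow_in_L2[OF u])
      have dL: "(\<lambda>x. inverse h * (u (t + h) x - u t x)) \<in> L2_on W"
        by (intro L2_on_mult L2_on_diff uL)
      have "L2_inner W (\<lambda>x. inverse h * (u (t + h) x - u t x) - v x) (e n) =
          ?q v h"
        using dL uL vL by (simp add: L2_inner_diff L2_inner_mult coeff_def divide_inverse mult.commute)
      then show ?thesis
        using coeff_bound[OF L2_on_diff[OF dL vL], of n] by (simp add: coeff_def divide_inverse mult.commute)
    qed
    then show "\<forall>\<^sub>F h in at 0. norm (?q v h) \<le>
        L2_norm_on W (\<lambda>x. (u (t + h) x - u t x) / h - v x)"
      using t by (auto simp: eventually_at dist_norm intro!: exI[of _ t])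
  qed
  then have "((\<lambda>h. (coeff (u (t + h)) n - coeff (u t) n) / h) \<longlongrightarrow> L2_inner W v (e n)) (at 0)"
    by (simp add: Lim_null[symmetric])
  then show ?thesis unfolding DERIV_def ve .
qed

text \<open>The integrating factor \<open>exp (t * lam n)\<close> makes the coefficient constant on
  positive times, and the initial condition identifies the constant in the limit at 0.\<close>

lemma flow_coeff:
  assumes u: "dirichlet_heat_flow W f u" and t: "t > 0"
  shows "coeff (u t) n = heat_coeff f t n"
proof -
  define b where "b t = exp (t * lam n) * coeff (u t) n" for t
  have d: "(b has_real_derivative 0) (at t)" if "t > 0" for t
    unfolding b_def
    by (rule derivative_eq_intros flow_coeff_derivative[OF u that] refl | simp)+
  have "\<exists>c. \<forall>t\<in>{0<..}. b t = c"
    using d by (intro has_field_derivative_zero_constant convex_real_interval) (auto intro: has_field_derivative_at_within)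
  then obtain c where c: "\<And>t. t > 0 \<Longrightarrow> b t = c" by auto
  have f: "f \<in> L2_on W" and lim: "((\<lambda>t. L2_norm_on W (\<lambda>x. u t x - f x)) \<longlongrightarrow> 0) (at_right 0)"
    using u by (auto simp: dirichlet_heat_flow_def)
  have "((\<lambda>t. coeff (u t) n - coeff f n) \<longlongrightarrow> 0) (at_right 0)"
  proof (rule Lim_null_comparison[OF _ lim])
    have "norm (coeff (u t) n - coeff f n) \<le> L2_norm_on W (\<lambda>x. u t x - f x)" if "t > 0" for t
      using coeff_bound[OF L2_on_diff[OF flow_in_L2[OF u that] f], of n] flow_in_L2[OF u that] f
      by (simp add: coeff_def L2_inner_diff)
    then show "\<forall>\<^sub>F t in at_right 0. norm (coeff (u t) n - coeff f n) \<le> L2_norm_on W (\<lambda>x. u t x - f x)"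
      by (auto simp: eventually_at_right_field intro!: exI[of _ 1])
  qed
  then have "((\<lambda>t. coeff (u t) n) \<longlongrightarrow> coeff f n) (at_right 0)"
    by (simp add: Lim_null[symmetric])
  then have "(b \<longlongrightarrow> exp (0 * lam n) * coeff f n) (at_right 0)"
    unfolding b_def[abs_def] by (intro tendsto_intros)
  moreover have "(b \<longlongrightarrow> c) (at_right 0)"
    by (rule tendsto_eventually) (use c in \<open>auto simp: eventually_at_right_field intro!: exI[of _ 1]\<close>)
  ultimately have "c = coeff f n"
    using tendsto_unique[of "at_right (0::real)" b] by simp
  then have "exp (t * lam n) * coeff (u t) n = coeff f n"
    using c[OF t] by (simp add: b_def)
  then show ?thesis by (simp add: heat_coeff_def exp_minus field_simps)
qed

lemma flow_unique:
  assumes u: "dirichlet_heat_flow W f u" and v: "dirichlet_heat_flow W f v" and t: "t > 0"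
  shows "AE x in lborel. x \<in> W \<longrightarrow> u t x = v t x"
proof -
  note L = flow_in_L2[OF u t] flow_in_L2[OF v t]
  have "coeff (\<lambda>x. u t x - v t x) n = 0" for n
    using flow_coeff[OF u t, of n] flow_coeff[OF v t, of n] L by (simp add: coeff_def L2_inner_diff)
  then have "AE x in lborel. x \<in> W \<longrightarrow> u t x - v t x = 0"
    by (intro L2_norm_on_eq_0_AE complete L2_on_diff L)
  then show ?thesis by simp
qed

text \<open>If \<open>p\<close> exceeded \<open>q\<close> at one point, continuity would give a gap
  \<open>\<delta>\<close> on a product of two balls. Starting the flow from the indicator of the
  second ball, the two solutions would then differ at every point of the first, which has positive
  measure. The one-sided form is enough: the roles can be exchanged.\<close>

lemma heat_kernel_le:
  assumes p: "is_dirichlet_heat_kernel W p" and q: "is_dirichlet_heat_kernel W q" and t: "t > 0"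
    and x0: "x0 \<in> W" and y0: "y0 \<in> W"
  shows "p t x0 y0 \<le> q t x0 y0"
proof (rule ccontr)
  assume "\<not> p t x0 y0 \<le> q t x0 y0"
  define d where "d x y = p t x y - q t x y" for x y
  define \<delta> where "\<delta> = d x0 y0 / 2"
  have \<delta>: "\<delta> > 0" using \<open>\<not> p t x0 y0 \<le> q t x0 y0\<close> by (simp add: \<delta>_def d_def)
  have "continuous_on (W \<times> W) (\<lambda>z. d (fst z) (snd z))"
    using p q t unfolding is_dirichlet_heat_kernel_def d_def case_prod_unfold
    by (intro continuous_on_diff) auto
  moreover have op: "open (W \<times> W)" by (simp add: open_W open_Times)
  ultimately have "open ((W \<times> W) \<inter> (\<lambda>z. d (fst z) (snd z)) -` {\<delta><..})"
    by (simp add: continuous_on_open_vimage Int_commute)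
  moreover have "(x0, y0) \<in> (W \<times> W) \<inter> (\<lambda>z. d (fst z) (snd z)) -` {\<delta><..}"
    using x0 y0 \<delta> by (simp add: \<delta>_def)
  ultimately obtain A B where AB: "open A" "open B" "x0 \<in> A" "y0 \<in> B"
    "A \<times> B \<subseteq> (W \<times> W) \<inter> (\<lambda>z. d (fst z) (snd z)) -` {\<delta><..}"
    by (rule open_prod_elim) auto
  obtain r where r: "r > 0" "ball x0 r \<subseteq> A"
    using AB by (meson openE)
  obtain s where s: "s > 0" "ball y0 s \<subseteq> B"
    using AB by (meson openE)
  have d_gt: "x \<in> W" "y \<in> W" "d x y > \<delta>" if "x \<in> ball x0 r" "y \<in> ball y0 s" for x y
  proof -
    have "(x, y) \<in> A \<times> B" using that r s by auto
    with AB(5) show "x \<in> W" "y \<in> W" "d x y > \<delta>" by auto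
  qed
  have sub: "ball y0 s \<subseteq> W" using d_gt(2)[of x0] r(1) by auto
  define f where "f = (indicator (ball y0 s) :: 'a \<Rightarrow> real)"
  have f: "f \<in> L2_on W"
  proof (rule L2_on_bounded(1)[OF W_borel finite_W])
    show "set_borel_measurable lborel W f"
      unfolding set_borel_measurable_def f_def by (intro borel_measurable_scaleR borel_measurable_indicator) auto
    show "norm (f x) \<le> 1" for x by (simp add: f_def)
  qed
  have "AE x in lborel. x \<in> W \<longrightarrow>
      (LINT y:W|lborel. p t x y * f y) = (LINT y:W|lborel. q t x y * f y)"
    using p q f t by (intro flow_unique[of f]) (auto simp: is_dirichlet_heat_kernel_def)
  moreover have "(LINT y:W|lborel. p t x y * f y) \<noteq> (LINT y:W|lborel. q t x y * f y)"
    if x: "x \<in> ball x0 r" for x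
  proof -
    have xO: "x \<in> W" using d_gt(1)[OF x, of y0] s by simp
    have pq: "p t x \<in> L2_on W" "q t x \<in> L2_on W"
      using p q t xO by (auto simp: is_dirichlet_heat_kernel_def)
    have ip: "set_integrable lborel W (\<lambda>y. p t x y * f y)" and iq: "set_integrable lborel W (\<lambda>y. q t x y * f y)"
      using L2_on_inner_integrable[OF pq(1) f] L2_on_inner_integrable[OF pq(2) f] by auto
    have "0 < \<delta> * measure lborel (ball y0 s)"
      using \<delta> content_ball_pos[OF s(1), of y0] by simp
    also have "\<dots> = (LINT y|lborel. \<delta> * indicator (ball y0 s) y)"
      by simp
    also have "\<dots> \<le> (LINT y|lborel. indicator W y *\<^sub>R (p t x y * f y - q t x y * f y))"
    proof (rule integral_mono)
      show "integrable lborel (\<lambda>y. \<delta> * indicator (ball y0 s) y)"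
        by (intro integrable_mult_right integrable_real_indicator) (use emeasure_bounded_finite[of "ball y0 s"] in auto)
      show "integrable lborel (\<lambda>y. indicator W y *\<^sub>R (p t x y * f y - q t x y * f y))"
        using set_integral_diff(1)[OF ip iq] by (simp add: set_integrable_def)
      show "\<delta> * indicator (ball y0 s) y \<le> indicator W y *\<^sub>R (p t x y * f y - q t x y * f y)" for y
        using d_gt(3)[OF x, of y] sub by (auto simp: f_def indicator_def d_def)
    qed
    also have "\<dots> = (LINT y:W|lborel. p t x y * f y) - (LINT y:W|lborel. q t x y * f y)"
      using set_integral_diff(2)[OF ip iq] by (simp add: set_lebesgue_integral_def)
    finally show ?thesis by simp
  qed
  ultimately have "AE x in lborel. x \<notin> ball x0 r"
    by (elim AE_mp) (use d_gt(1)[of _ y0] s(1) in \<open>auto intro!: AE_I2\<close>)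
  then have "emeasure lborel (ball x0 r) = 0"
    using AE_iff_null_sets[of "ball x0 r" lborel] by (auto simp del: mem_ball)
  then have "measure lborel (ball x0 r) = 0" by (simp add: measure_def)
  with content_ball_pos[OF r(1), of x0] show False by simp
qed

section \<open>The heat trace\<close>

lemma e_mult_bound: "\<bar>e n x * e n x\<bar> \<le> M * M"
  unfolding abs_mult using e_bound[of n x] M_nonneg by (intro mult_mono) auto

text \<open>On the diagonal the series converges uniformly, and integration is the inner product
  with the constant 1, so L^2 continuity allows termwise integration. Each term contributes its
  decay factor because the eigenfunctions are normalised.\<close>

lemma dirichlet_partition_function_eq:
  assumes t: "t > 0"
  shows "(\<lambda>n. decay t n) sums dirichlet_partition_function W t"
proof -
  let ?p = "dirichlet_heat_kernel W"
  have p: "is_dirichlet_heat_kernel W ?p"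
    unfolding dirichlet_heat_kernel_def by (rule someI[of _ kernel]) (rule is_dirichlet_heat_kernel_kernel)
  \<comment> \<open>The chosen kernel is pinned down only inside \<open>W\<close>, which is all that
    the trace integral sees.\<close>
  have eq: "?p t x x = kernel t x x" if "x \<in> W" for x
    using that t by (intro antisym heat_kernel_le p is_dirichlet_heat_kernel_kernel)
  have one: "(\<lambda>_. 1 :: real) \<in> L2_on W"
    by (rule L2_on_bounded(1)[OF W_borel finite_W, of _ 1]) (auto intro!: set_borel_continuous)
  have ul: "uniform_limit UNIV (\<lambda>N x. \<Sum>n<N. decay t n * e n x * e n x)
     (\<lambda>x. \<Sum>n. decay t n * e n x * e n x) sequentially"
  proof (rule Weierstrass_m_test)
    show "summable (\<lambda>n. decay t n * (M * M))"
      using t by (intro summable_mult2 summable_exp)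
    show "norm (decay t n * e n x * e n x) \<le> decay t n * (M * M)" for n x
      using e_mult_bound[of n x] by (simp add: abs_mult mult.assoc mult_left_mono)
  qed
  have diag: "(\<lambda>x. \<Sum>n. decay t n * e n x * e n x) = (\<lambda>x. kernel t x x)"
    by (simp add: kernel_def expand_def)
  have cont_diag: "continuous_on UNIV (\<lambda>x. kernel t x x)"
    using continuous_on_compose2[OF continuous_kernel[OF t], of UNIV "\<lambda>x. (x, x)"]
    by (simp add: continuous_on_Pair continuous_on_id)
  have eeL: "(\<lambda>x. decay t n * e n x * e n x) \<in> L2_on W" for n
    using e_mult_bound[of n]
    by (intro L2_on_bounded(1)[OF W_borel finite_W, of _ "decay t n * (M * M)"]
        set_borel_continuous W_borel continuous_intros continuous_e)
      (auto simp: abs_mult mult.assoc intro!: mult_left_mono)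
  have diagL: "(\<lambda>x. kernel t x x) \<in> L2_on W"
  proof (rule L2_on_bounded(1)[OF W_borel finite_W])
    show "norm (kernel t x x) \<le> M * (M * (\<Sum>n. decay t n))" for x
    proof -
      have "\<bar>kernel t x x\<bar> \<le> M * (\<Sum>n. \<bar>decay t n * e n x\<bar>)"
        unfolding kernel_def by (intro expand_bound summable_kernel_coeff t)
      also have "(\<Sum>n. \<bar>decay t n * e n x\<bar>) \<le> (\<Sum>n. M * decay t n)"
        using e_bound[of _ x]
        by (intro suminf_le summable_kernel_coeff t summable_mult summable_exp) (auto simp: abs_mult mult.commute)
      also have "\<dots> = M * (\<Sum>n. decay t n)"
        by (intro suminf_mult summable_exp t)
      finally show ?thesis using M_nonneg by (simp add: mult_left_mono)
    qed
  qed (intro set_borel_continuous W_borel cont_diag)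
  have "(\<lambda>N. L2_norm_on W (\<lambda>x. (\<Sum>n<N. decay t n * e n x * e n x) - kernel t x x)) \<longlonglongrightarrow> 0"
    by (intro uniform_limit_imp_L2_tendsto W_borel finite_W set_borel_continuous continuous_intros
        cont_diag continuous_e uniform_limit_on_subset[OF ul[unfolded diag]]) auto
  then have "(\<lambda>N. L2_inner W (\<lambda>x. \<Sum>n<N. decay t n * e n x * e n x) (\<lambda>_. 1)) \<longlonglongrightarrow>
      L2_inner W (\<lambda>x. kernel t x x) (\<lambda>_. 1)"
    by (intro tendsto_L2_inner L2_on_sum eeL one diagL)
  moreover have "L2_inner W (\<lambda>x. \<Sum>n<N. decay t n * e n x * e n x) (\<lambda>_. 1) = (\<Sum>n<N. decay t n)" for N
  proof -
    have "L2_inner W (\<lambda>x. decay t n * e n x * e n x) (\<lambda>_. 1) = decay t n * L2_inner W (e n) (e n)" for n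
      by (simp add: L2_inner_def mult.assoc)
    then show ?thesis using L2_inner_sum[of "{..<N}" "\<lambda>n x. decay t n * e n x * e n x", OF eeL one] by (simp add: orthonormal)
  qed
  moreover have "L2_inner W (\<lambda>x. kernel t x x) (\<lambda>_. 1) = dirichlet_partition_function W t"
    unfolding dirichlet_partition_function_def L2_inner_def set_lebesgue_integral_def
    by (intro Bochner_Integration.integral_cong) (auto simp: indicator_def eq)
  ultimately show ?thesis by (simp add: sums_def)
qed

end

section \<open>Density of $C_c$ in $L^2$\<close>

definition Cc_on :: "'a::euclidean_space set \<Rightarrow> ('a \<Rightarrow> real) \<Rightarrow> bool" where
  "Cc_on W \<phi> \<longleftrightarrow>
     continuous_on UNIV \<phi> \<and> (\<exists>K. compact K \<and> K \<subseteq> W \<and> (\<forall>x. x \<notin> K \<longrightarrow> \<phi> x = 0))"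

lemma Cc_on_linear:
  assumes "Cc_on W \<phi>" "Cc_on W \<psi>"
  shows "Cc_on W (\<lambda>x. \<phi> x + c * \<psi> x)"
proof -
  obtain K L where "compact K" "K \<subseteq> W" "\<And>x. x \<notin> K \<Longrightarrow> \<phi> x = 0"
    and "compact L" "L \<subseteq> W" "\<And>x. x \<notin> L \<Longrightarrow> \<psi> x = 0"
    using assms by (auto simp: Cc_on_def)
  then have "\<exists>K. compact K \<and> K \<subseteq> W \<and> (\<forall>x. x \<notin> K \<longrightarrow> \<phi> x + c * \<psi> x = 0)"
    by (intro exI[of _ "K \<union> L"]) auto
  then show ?thesis
    using assms unfolding Cc_on_def by (auto intro!: continuous_intros)
qed

lemma Cc_on_zero: "Cc_on W (\<lambda>x. 0)"
  by (auto simp: Cc_on_def intro!: exI[of _ "{}"])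

lemma Cc_on_bounded:
  assumes "Cc_on W \<phi>"
  obtains B where "0 \<le> B" "\<And>x. \<bar>\<phi> x\<bar> \<le> B"
proof -
  obtain K where K: "compact K" "\<And>x. x \<notin> K \<Longrightarrow> \<phi> x = 0" and c: "continuous_on UNIV \<phi>"
    using assms by (auto simp: Cc_on_def)
  have "bounded (\<phi> ` K)"
    using c K(1) by (intro compact_imp_bounded compact_continuous_image) (auto intro: continuous_on_subset)
  then obtain B where "0 < B" "\<And>x. x \<in> K \<Longrightarrow> norm (\<phi> x) \<le> B"
    by (auto simp: bounded_pos)
  with K(2) that[of B] show thesis by (metis abs_0 less_imp_le real_norm_def)
qed

lemma Cc_on_L2:
  assumes "open W" "bounded W" "Cc_on W \<phi>"
  shows "\<phi> \<in> L2_on W"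
proof -
  obtain B where B: "\<And>x. \<bar>\<phi> x\<bar> \<le> B" using Cc_on_bounded[OF assms(3)] by blast
  show ?thesis
    using assms emeasure_bounded_finite[OF assms(2)] B
    by (intro L2_on_bounded(1)[where B = B] set_borel_continuous)
      (auto simp: Cc_on_def)
qed

text \<open>Inner and outer regularity each spend half of \<open>r\<close>. Boundedness of
  \<open>A\<close> turns the inner closed set into a compact one.\<close>

lemma lborel_regular:
  fixes A :: "'a::euclidean_space set"
  assumes A: "A \<in> sets borel" "bounded A" and r: "r > 0"
  obtains K U where "compact K" "open U" "K \<subseteq> A" "A \<subseteq> U" "emeasure lborel (U - K) < ennreal r"
proof -
  have leb: "A \<in> sets lebesgue" using A(1) by simp
  obtain K where K: "closed K" "K \<subseteq> A" "A - K \<in> lmeasurable" "emeasure lebesgue (A - K) < ennreal (r / 2)"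
    using sets_lebesgue_inner_closed[OF leb, of "r / 2"] r by auto
  obtain U where U: "open U" "A \<subseteq> U" "U - A \<in> lmeasurable" "emeasure lebesgue (U - A) < ennreal (r / 2)"
    using sets_lebesgue_outer_open[OF leb, of "r / 2"] r by auto
  have KU: "U - K \<in> sets borel" "U - A \<in> sets borel" "A - K \<in> sets borel" using K(1) U(1) A(1) by auto
  have "emeasure lborel (U - K) \<le> emeasure lborel ((U - A) \<union> (A - K))"
    using KU by (intro emeasure_mono) auto
  also have "\<dots> \<le> emeasure lborel (U - A) + emeasure lborel (A - K)"
    using KU by (intro emeasure_subadditive) auto
  also have "\<dots> < ennreal (r / 2) + ennreal (r / 2)"
    using K(4) U(4) KU by (intro add_strict_mono) auto
  also have "\<dots> = ennreal r" using r by (simp flip: ennreal_plus)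
  finally have "emeasure lborel (U - K) < ennreal r" .
  moreover have "compact K" using K(1,2) A(2) bounded_subset compact_eq_bounded_closed by blast
  ultimately show thesis using that K U by blast
qed

definition Cc_approximable :: "'a::euclidean_space set \<Rightarrow> ('a \<Rightarrow> real) \<Rightarrow> bool" where
  "Cc_approximable W f \<longleftrightarrow>
     f \<in> L2_on W \<and> (\<forall>r>0. \<exists>\<phi>. Cc_on W \<phi> \<and> L2_norm_on W (\<lambda>x. f x - \<phi> x) < r)"

lemma Cc_approximable_linear:
  assumes W: "open W" "bounded W" and f: "Cc_approximable W f" and h: "Cc_approximable W h"
  shows "Cc_approximable W (\<lambda>x. f x + c * h x)"
  unfolding Cc_approximable_def
proof (intro conjI allI impI)
  have L: "f \<in> L2_on W" "h \<in> L2_on W" using f h by (auto simp: Cc_approximable_def)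
  then show "(\<lambda>x. f x + c * h x) \<in> L2_on W" by (intro L2_on_add L2_on_mult)
  fix r :: real assume r: "r > 0"
  then have s: "r / (1 + \<bar>c\<bar>) > 0" by (simp add: add_pos_nonneg)
  obtain \<phi> where A: "Cc_on W \<phi>" "L2_norm_on W (\<lambda>x. f x - \<phi> x) < r / (1 + \<bar>c\<bar>)"
    using f s unfolding Cc_approximable_def by blast
  obtain \<psi> where B: "Cc_on W \<psi>" "L2_norm_on W (\<lambda>x. h x - \<psi> x) < r / (1 + \<bar>c\<bar>)"
    using h s unfolding Cc_approximable_def by blast
  have "L2_norm_on W (\<lambda>x. (f x + c *\<^sub>R h x) - (\<phi> x + c *\<^sub>R \<psi> x)) < r"
    by (intro L2_norm_on_linear_diff_less A B L Cc_on_L2 W)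
  then show "\<exists>\<phi>. Cc_on W \<phi> \<and> L2_norm_on W (\<lambda>x. f x + c * h x - \<phi> x) < r"
    using Cc_on_linear[OF A(1) B(1), of c] by auto
qed

lemma Cc_approximable_zero: "Cc_approximable W (\<lambda>x. 0)"
  unfolding Cc_approximable_def
  using Cc_on_zero by (auto simp: L2_on_zero L2_norm_on_def intro!: exI[of _ "\<lambda>x. 0"])

lemma Cc_approximable_indicator:
  assumes W: "open W" "bounded W" and A: "A \<in> sets borel" "A \<subseteq> W"
  shows "Cc_approximable W (indicator A)"
  unfolding Cc_approximable_def
proof (intro conjI allI impI)
  have [measurable]: "A \<in> sets borel" "W \<in> sets borel" using W A by auto
  show AL: "(indicator A :: 'a \<Rightarrow> real) \<in> L2_on W"
    using emeasure_bounded_finite[OF W(2)]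
    by (intro L2_on_bounded(1)[where B = 1])
      (auto simp: set_borel_measurable_def indicator_def split: if_splits)
  fix r :: real assume r: "r > 0"
  \<comment> \<open>The square of the L^2 error will be bounded by the measure of
    \<open>U - K\<close>, so regularity is invoked with the square of \<open>r\<close>.\<close>
  then have r2: "r\<^sup>2 > 0" by simp
  obtain K U' where K: "compact K" "K \<subseteq> A" and U': "open U'" "A \<subseteq> U'" "emeasure lborel (U' - K) < ennreal (r\<^sup>2)"
    using lborel_regular[OF A(1) bounded_subset[OF W(2) A(2)] r2] by metis
  define U where "U = U' \<inter> W"
  have U: "open U" "A \<subseteq> U" "U \<subseteq> W" using U' W A(2) by (auto simp: U_def)
  have m: "measure lborel (U - K) < r\<^sup>2" and fin: "emeasure lborel (U - K) < \<infinity>"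
  proof -
    have "emeasure lborel (U - K) \<le> emeasure lborel (U' - K)"
      using U'(1) K(1) by (intro emeasure_mono) (auto simp: U_def compact_imp_closed)
    with U'(3) have l: "emeasure lborel (U - K) < ennreal (r\<^sup>2)" by simp
    show fin: "emeasure lborel (U - K) < \<infinity>"
      using order.strict_trans[OF l ennreal_less_top] by simp
    have "emeasure lborel (U - K) = ennreal (measure lborel (U - K))"
      using fin by (intro emeasure_eq_ennreal_measure) auto
    with l show "measure lborel (U - K) < r\<^sup>2"
      by (simp add: ennreal_less_iff)
  qed
  obtain \<theta> :: "'a \<Rightarrow> real" where \<theta>: "continuous_on UNIV \<theta>" "\<And>x. \<theta> x \<in> closed_segment 1 0"
    "\<And>x. x \<in> K \<Longrightarrow> \<theta> x = 1" "\<And>x. x \<in> - U \<Longrightarrow> \<theta> x = 0"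
    by (rule Urysohn[of K "- U" "1::real" 0]) (use K U in \<open>auto simp: compact_imp_closed\<close>)
  have \<theta>01: "0 \<le> \<theta> x" "\<theta> x \<le> 1" for x using \<theta>(2)[of x] by (auto simp: closed_segment_eq_real_ivl)
  \<comment> \<open>The set where \<open>\<theta>\<close> is nonzero may accumulate at the boundary
    of \<open>U\<close>. Cutting at level 1/2 leaves a function supported in a closed subset of
    \<open>U\<close>, with the values 1 on \<open>K\<close> and 0 off \<open>U\<close>
    unchanged.\<close>
  define \<phi> where "\<phi> x = max 0 (2 * \<theta> x - 1)" for x
  have c: "continuous_on UNIV \<phi>" unfolding \<phi>_def by (intro continuous_intros \<theta>)
  have cs: "Cc_on W \<phi>"
    unfolding Cc_on_def
  proof (intro conjI exI[of _ "{x. 1 / 2 \<le> \<theta> x}"] c allI impI)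
    have sub: "{x. 1 / 2 \<le> \<theta> x} \<subseteq> U" using \<theta>(4) by fastforce
    then show "{x. 1 / 2 \<le> \<theta> x} \<subseteq> W" using U(3) by auto
    then have "bounded {x. 1 / 2 \<le> \<theta> x}" using W(2) bounded_subset by blast
    moreover have "closed {x. 1 / 2 \<le> \<theta> x}" using \<theta>(1) by (intro closed_Collect_le) auto
    ultimately show "compact {x. 1 / 2 \<le> \<theta> x}" by (simp add: compact_eq_bounded_closed)
    show "\<phi> x = 0" if "x \<notin> {x. 1 / 2 \<le> \<theta> x}" for x using that by (simp add: \<phi>_def)
  qed
  have "(L2_norm_on W (\<lambda>x. indicator A x - \<phi> x))\<^sup>2 = (LINT x:W|lborel. (indicator A x - \<phi> x)\<^sup>2)"
    unfolding L2_norm_on_power2 L2_inner_def by (simp add: power2_eq_square)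
  also have "\<dots> \<le> (LINT x|lborel. indicator (U - K) x)"
    unfolding set_lebesgue_integral_def
  proof (rule integral_mono)
    have "(\<lambda>x. indicator A x - \<phi> x) \<in> L2_on W"
      by (intro L2_on_diff AL Cc_on_L2[OF W cs])
    then show "integrable lborel (\<lambda>x. indicator W x *\<^sub>R (indicator A x - \<phi> x)\<^sup>2)"
      by (simp add: L2_on_def set_integrable_def)
    show "integrable lborel (indicator (U - K) :: 'a \<Rightarrow> real)"
      using fin K(1) U(1) by (intro integrable_real_indicator) (auto simp: compact_imp_closed)
    have "\<bar>indicator A x - \<phi> x\<bar> \<le> indicator (U - K) x" for x
    proof -
      have "0 \<le> \<phi> x" "\<phi> x \<le> 1" using \<theta>01[of x] by (auto simp: \<phi>_def)
      moreover have "\<phi> x = 1" if "x \<in> K" using \<theta>(3)[OF that] by (simp add: \<phi>_def)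
      moreover have "\<phi> x = 0" if "x \<notin> U" using \<theta>(4)[of x] that by (simp add: \<phi>_def)
      ultimately show ?thesis using K(2) U(2) by (auto simp: indicator_def)
    qed
    then have "\<bar>indicator A x - \<phi> x\<bar>\<^sup>2 \<le> (indicator (U - K) x)\<^sup>2" for x
      by (intro power_mono) auto
    moreover have "(indicator (U - K) x :: real)\<^sup>2 = indicator (U - K) x" for x
      by (simp add: indicator_def)
    ultimately have le: "(indicator A x - \<phi> x)\<^sup>2 \<le> indicator (U - K) x" for x
      by (metis power2_abs)
    show "indicator W x *\<^sub>R (indicator A x - \<phi> x)\<^sup>2 \<le> indicator (U - K) x" for x
    proof (cases "x \<in> W")
      case True
      with le[of x] show ?thesis by simp
    qed simp
  qed
  also have "\<dots> = measure lborel (U - K)" by simp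
  also note m
  finally have "L2_norm_on W (\<lambda>x. indicator A x - \<phi> x) < r"
    by (rule power2_less_imp_less) (use r in simp)
  with cs show "\<exists>\<phi>. Cc_on W \<phi> \<and> L2_norm_on W (\<lambda>x. indicator A x - \<phi> x) < r" by blast
qed

text \<open>Simple functions bounded by twice the zero extension \<open>F\<close> converge to it
  pointwise, hence in L^2 by dominated convergence. On \<open>W\<close> each of them is a finite
  combination of indicators of Borel subsets of \<open>W\<close>.\<close>

lemma L2_dense_Cc:
  assumes W: "open W" "bounded W" and f: "f \<in> L2_on W" and r: "r > 0"
  shows "\<exists>\<phi>. Cc_on W \<phi> \<and> L2_norm_on W (\<lambda>x. f x - \<phi> x) < r"
proof -
  define F where "F x = indicator W x *\<^sub>R f x" for x
  have [measurable]: "F \<in> borel_measurable lborel" and F2: "integrable lborel (\<lambda>x. (norm (F x))\<^sup>2)"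
    using f by (auto simp: L2_on_iff F_def[abs_def])
  have [measurable]: "W \<in> sets borel" using W by simp
  obtain S where S: "\<And>i. simple_function lborel (S i)" "\<And>x. (\<lambda>i. S i x) \<longlonglongrightarrow> F x"
    "\<And>i x. \<bar>S i x\<bar> \<le> 2 * \<bar>F x\<bar>"
    using borel_measurable_implies_sequence_metric[of F lborel 0] by (auto simp: dist_norm)
  have Sm [measurable]: "S i \<in> borel_measurable lborel" for i
    using S(1) borel_measurable_simple_function by blast
  have ap: "Cc_approximable W (S i)" for i
  proof -
    let ?T = "S i ` UNIV"
    have fin: "finite ?T" using S(1)[of i] by (simp add: simple_function_def)
    have "Cc_approximable W (\<lambda>x. \<Sum>y\<in>T. y * indicator (S i -` {y} \<inter> W) x)" if "finite T" for T
      using that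
    proof (induction T rule: finite_induct)
      case empty
      then show ?case by (simp add: Cc_approximable_zero)
    next
      case (insert y T)
      have "S i -` {y} \<in> sets lborel" using measurable_sets[OF Sm, of "{y}" i] by simp
      then have "Cc_approximable W (indicator (S i -` {y} \<inter> W))"
        by (intro Cc_approximable_indicator W) auto
      from Cc_approximable_linear[OF W insert.IH this, of y] show ?case
        unfolding sum.insert[OF insert.hyps] by (simp only: add.commute)
    qed
    from this[OF fin] have *: "Cc_approximable W (\<lambda>x. \<Sum>y\<in>?T. y * indicator (S i -` {y} \<inter> W) x)" .
    have eq: "(\<Sum>y\<in>?T. y * indicator (S i -` {y} \<inter> W) x) = S i x" if "x \<in> W" for x
    proof -
      have "(\<Sum>y\<in>?T. y * indicator (S i -` {y} \<inter> W) x) = (\<Sum>y\<in>?T. if y = S i x then y else 0)"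
        using that by (intro sum.cong) (auto simp: indicator_def)
      also have "\<dots> = S i x" using fin by simp
      finally show ?thesis .
    qed
    have "L2_norm_on W (\<lambda>x. (\<Sum>y\<in>?T. y * indicator (S i -` {y} \<inter> W) x) - \<phi> x) = L2_norm_on W (\<lambda>x. S i x - \<phi> x)" for \<phi>
      by (intro L2_norm_on_cong) (simp add: eq)
    moreover have "S i \<in> L2_on W"
      using * L2_on_cong[of W "\<lambda>x. \<Sum>y\<in>?T. y * indicator (S i -` {y} \<inter> W) x" "S i"]
      by (simp add: eq Cc_approximable_def)
    ultimately show ?thesis using * by (simp add: Cc_approximable_def)
  qed
  have "(\<lambda>i. LINT x|lborel. indicator W x *\<^sub>R (f x - S i x)\<^sup>2) \<longlonglongrightarrow> (LINT x::'a|lborel. 0)"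
  proof (rule integral_dominated_convergence[where w = "\<lambda>x. 9 * (norm (F x))\<^sup>2"])
    have eq: "indicator W x *\<^sub>R (f x - S i x)\<^sup>2 = indicator W x * (F x - S i x)\<^sup>2" for x i
      by (auto simp: F_def indicator_def)
    show "(\<lambda>x. indicator W x *\<^sub>R (f x - S i x)\<^sup>2) \<in> borel_measurable lborel" for i
      unfolding eq by measurable
    show "integrable lborel (\<lambda>x. 9 * (norm (F x))\<^sup>2)" using F2 by (intro integrable_mult_right)
    show "AE x in lborel. (\<lambda>i. indicator W x *\<^sub>R (f x - S i x)\<^sup>2) \<longlonglongrightarrow> 0"
    proof (rule AE_I2)
      fix x
      have "(\<lambda>i. indicator W x * (F x - S i x)\<^sup>2) \<longlonglongrightarrow> indicator W x * (F x - F x)\<^sup>2"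
        by (intro tendsto_intros S)
      then show "(\<lambda>i. indicator W x *\<^sub>R (f x - S i x)\<^sup>2) \<longlonglongrightarrow> 0" unfolding eq by simp
    qed
    show "AE x in lborel. norm (indicator W x *\<^sub>R (f x - S i x)\<^sup>2) \<le> 9 * (norm (F x))\<^sup>2" for i
    proof (rule AE_I2)
      fix x
      \<comment> \<open>The 3 is 1 + 2, from the triangle inequality and the bound on
        \<open>S i\<close>; its square is the 9 in the dominating function.\<close>
      have "\<bar>F x - S i x\<bar> \<le> 3 * \<bar>F x\<bar>" using S(3)[of i x] by linarith
      then have "\<bar>F x - S i x\<bar>\<^sup>2 \<le> (3 * \<bar>F x\<bar>)\<^sup>2" by (intro power_mono) auto
      then have "(F x - S i x)\<^sup>2 \<le> 9 * (norm (F x))\<^sup>2" by (simp add: power_mult_distrib)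
      then show "norm (indicator W x *\<^sub>R (f x - S i x)\<^sup>2) \<le> 9 * (norm (F x))\<^sup>2"
        unfolding eq by (auto simp: indicator_def)
    qed
  qed simp
  then have "(\<lambda>i. sqrt (LINT x|lborel. indicator W x *\<^sub>R (f x - S i x)\<^sup>2)) \<longlonglongrightarrow> sqrt 0"
    by (intro tendsto_real_sqrt) simp
  then have "(\<lambda>i. L2_norm_on W (\<lambda>x. f x - S i x)) \<longlonglongrightarrow> 0"
    by (simp add: L2_norm_on_def set_lebesgue_integral_def)
  then have "\<forall>\<^sub>F i in sequentially. L2_norm_on W (\<lambda>x. f x - S i x) < r / 2"
    using r by (intro order_tendstoD) auto
  then obtain i where i: "L2_norm_on W (\<lambda>x. f x - S i x) < r / 2"
    by (metis (mono_tags, lifting) eventually_sequentially order_refl)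
  obtain \<phi> where \<phi>: "Cc_on W \<phi>" "L2_norm_on W (\<lambda>x. S i x - \<phi> x) < r / 2"
    using ap[of i] r by (auto simp: Cc_approximable_def dest!: spec[of _ "r / 2"])
  have "L2_norm_on W (\<lambda>x. f x - \<phi> x) \<le> L2_norm_on W (\<lambda>x. f x - S i x) + L2_norm_on W (\<lambda>x. S i x - \<phi> x)"
    using ap[of i] by (intro L2_norm_on_triangle_diff f Cc_on_L2[OF W \<phi>(1)]) (simp add: Cc_approximable_def)
  with i \<phi> show ?thesis by (intro exI[of _ \<phi>]) auto
qed

section \<open>Integration by parts and truncation\<close>

lemma integrable_compact_support:
  fixes F :: "'a::euclidean_space \<Rightarrow> real"
  assumes c: "continuous_on UNIV F" and K: "compact K" "\<And>x. x \<notin> K \<Longrightarrow> F x = 0"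
  shows "integrable lborel F"
proof -
  have "integrable lborel (\<lambda>x. indicator K x *\<^sub>R F x)"
    by (rule borel_integrable_compact[OF K(1) continuous_on_subset[OF c]]) simp
  moreover have "(\<lambda>x. indicator K x *\<^sub>R F x) = F"
    using K(2) by (auto simp: indicator_def fun_eq_iff)
  ultimately show ?thesis by simp
qed

text \<open>By translation invariance the difference quotients of \<open>F\<close> in a fixed direction have integral 0.\<close>

lemma integral_directional_derivative_eq_0:
  fixes F D :: "'a::euclidean_space \<Rightarrow> real"
  assumes cF: "continuous_on UNIV F" and cD: "continuous_on UNIV D"
    and K: "compact K" "\<And>x. x \<notin> K \<Longrightarrow> F x = 0" "\<And>x. x \<notin> K \<Longrightarrow> D x = 0"
    and d: "\<And>x. ((\<lambda>h. F (x + h *\<^sub>R b)) has_real_derivative D x) (at 0)"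
  shows "(LINT x|lborel. D x) = 0"
proof -
  \<comment> \<open>Since the hypothesis holds at every base point, moving the base point along
    \<open>b\<close> gives the derivative at every parameter, as the mean value theorem
    requires.\<close>
  have d': "((\<lambda>h. F (x + h *\<^sub>R b)) has_real_derivative D (x + s *\<^sub>R b)) (at s)" for x s
  proof -
    have "((\<lambda>h. F ((x + s *\<^sub>R b) + h *\<^sub>R b)) has_real_derivative D (x + s *\<^sub>R b)) (at 0)" by (rule d)
    then have "((\<lambda>h. F (x + (h + s) *\<^sub>R b)) has_real_derivative D (x + s *\<^sub>R b)) (at 0)"
      by (simp add: algebra_simps)
    then show ?thesis using DERIV_shift[of "\<lambda>h. F (x + h *\<^sub>R b)" _ 0 s] by simp
  qed
  have "bounded (D ` K)"
    using cD K(1) by (intro compact_imp_bounded compact_continuous_image) (auto intro: continuous_on_subset)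
  then obtain B where B0: "0 < B" and "\<And>x. x \<in> K \<Longrightarrow> norm (D x) \<le> B"
    by (auto simp: bounded_pos)
  then have B: "\<bar>D x\<bar> \<le> B" for x using K(3)[of x] by (cases "x \<in> K") auto
  obtain R where R: "\<And>x. x \<in> K \<Longrightarrow> norm x \<le> R"
    using compact_imp_bounded[OF K(1)] by (auto simp: bounded_iff)
  define h where "h k = 1 / real (Suc k)" for k
  have h: "0 < h k" "h k \<le> 1" for k by (auto simp: h_def)
  define q where "q k x = (F (x + h k *\<^sub>R b) - F x) / h k" for k x
  have iF: "integrable lborel F" by (rule integrable_compact_support[OF cF K(1,2)])
  have [measurable]: "F \<in> borel_measurable borel" "D \<in> borel_measurable borel"
    using cF cD by (auto intro: borel_measurable_continuous_onI)
  have shift: "has_bochner_integral lborel (\<lambda>x. F (x + c)) (LINT x|lborel. F x)" for c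
  proof -
    have "integrable (distr lborel borel ((+) c)) F" "(LINT x|distr lborel borel ((+) c). F x) = (LINT x|lborel. F x)"
      using iF by (simp_all add: lborel_distr_plus)
    then show ?thesis
      by (simp add: integrable_distr_eq integral_distr has_bochner_integral_iff add.commute)
  qed
  have q0: "(LINT x|lborel. q k x) = 0" for k
    using shift[of "h k *\<^sub>R b"] iF unfolding q_def has_bochner_integral_iff by simp
  have "(\<lambda>k. LINT x|lborel. q k x) \<longlonglongrightarrow> (LINT x|lborel. D x)"
  \<comment> \<open>With steps at most 1, a shift moves points by at most \<open>norm b\<close>;
    outside the enlarged ball both values in the quotient vanish, and inside it the mean value
    theorem bounds the quotient by \<open>B\<close>.\<close>
  proof (rule integral_dominated_convergence[where w = "\<lambda>x. B * indicator (cball (0::'a) (R + norm b)) x"])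
    show "q k \<in> borel_measurable lborel" for k unfolding q_def by measurable
    show "integrable lborel (\<lambda>x. B * indicator (cball (0::'a) (R + norm b)) x)"
      using emeasure_bounded_finite[of "cball (0::'a) (R + norm b)"]
      by (intro integrable_mult_right integrable_real_indicator) auto
    show "AE x in lborel. (\<lambda>k. q k x) \<longlonglongrightarrow> D x"
    proof (rule AE_I2)
      fix x
      have "((\<lambda>s. (F (x + s *\<^sub>R b) - F x) / s) \<longlongrightarrow> D x) (at 0)"
        using d[of x] by (simp add: DERIV_def)
      moreover have "filterlim h (at 0) sequentially"
      proof -
        have "h \<longlonglongrightarrow> 0" unfolding h_def using LIMSEQ_inverse_real_of_nat by (simp add: inverse_eq_divide)
        moreover have "h k \<noteq> 0" for k using h(1)[of k] by simp
        ultimately show ?thesis by (simp add: filterlim_at)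
      qed
      ultimately show "(\<lambda>k. q k x) \<longlonglongrightarrow> D x" unfolding q_def by (rule filterlim_compose)
    qed
    show "AE x in lborel. norm (q k x) \<le> B * indicator (cball (0::'a) (R + norm b)) x" for k
    proof (rule AE_I2)
      fix x
      show "norm (q k x) \<le> B * indicator (cball (0::'a) (R + norm b)) x"
      proof (cases "x \<in> cball 0 (R + norm b)")
        case True
        obtain z where "0 < z" "z < h k" "F (x + h k *\<^sub>R b) - F (x + 0 *\<^sub>R b) = (h k - 0) * D (x + z *\<^sub>R b)"
          using MVT2[of 0 "h k" "\<lambda>s. F (x + s *\<^sub>R b)" "\<lambda>s. D (x + s *\<^sub>R b)"] h(1)[of k] d' by blast
        then have "q k x = D (x + z *\<^sub>R b)" using h(1)[of k] by (simp add: q_def)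
        with B True show ?thesis by simp
      next
        case False
        then have nx: "norm x > R + norm b" by simp
        have "norm x \<le> norm (x + h k *\<^sub>R b) + norm (h k *\<^sub>R b)"
          using norm_triangle_ineq[of "x + h k *\<^sub>R b" "- (h k *\<^sub>R b)"] by simp
        moreover have "norm (h k *\<^sub>R b) \<le> norm b"
          using h[of k] by (simp add: mult_left_le_one_le)
        ultimately have "norm (x + h k *\<^sub>R b) > R" using nx by linarith
        moreover have "norm x > R" using nx norm_ge_zero[of b] by linarith
        ultimately have "F x = 0" "F (x + h k *\<^sub>R b) = 0"
          using R K(2) by (meson not_less)+
        then show ?thesis using False by (simp add: q_def)
      qed
    qed
  qed (use cD in simp)
  then show ?thesis by (simp add: q0 LIMSEQ_const_iff)
qed

text \<open>Lebesgue measure is the image of the product of its one-dimensional copies under the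
  coordinate map, and along that map the integrand separates.\<close>

lemma lborel_integral_prod:
  fixes f :: "'a::euclidean_space \<Rightarrow> real \<Rightarrow> real"
  assumes "\<And>b. b \<in> Basis \<Longrightarrow> integrable lborel (f b)"
  shows "(LINT x|lborel. (\<Prod>b\<in>Basis. f b (x \<bullet> b))) = (\<Prod>b\<in>Basis. LINT y|lborel. f b y)"
proof -
  interpret product_sigma_finite "\<lambda>_::'a. lborel :: real measure" by standard
  have [measurable]: "f b \<in> borel_measurable borel" if "b \<in> Basis" for b
    using borel_measurable_integrable[OF assms[OF that]] by simp
  have "(LINT x|lborel. (\<Prod>b\<in>Basis. f b (x \<bullet> b))) =
      (LINT x|(\<Pi>\<^sub>M b\<in>(Basis::'a set). lborel). (\<Prod>b\<in>Basis. f b ((\<Sum>j\<in>Basis. x j *\<^sub>R j) \<bullet> b)))"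
    by (subst lborel_eq, subst integral_distr) auto
  also have "\<dots> = (LINT x|(\<Pi>\<^sub>M b\<in>(Basis::'a set). lborel). (\<Prod>b\<in>Basis. f b (x b)))"
    by (intro Bochner_Integration.integral_cong prod.cong) auto
  also have "\<dots> = (\<Prod>b\<in>Basis. LINT y|lborel. f b y)"
    by (intro product_integral_prod assms) auto
  finally show ?thesis .
qed

text \<open>The product-to-sum formula reduces both cases to cosines. For equal indices one cosine
  degenerates to the constant 1, whose integral produces the value \<open>L / 2\<close>.\<close>

lemma integral_sin_sin:
  fixes L :: real
  assumes L: "L > 0" and n: "n \<ge> 1" and m: "m \<ge> 1"
  shows "(LINT y:{0<..<L}|lborel. sin (real n * pi / L * y) * sin (real m * pi / L * y)) = (if n = m then L / 2 else 0)"
proof -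
  let ?f = "\<lambda>y. sin (real n * pi / L * y) * sin (real m * pi / L * y)"
  define p q where "p = real n * pi / L" and "q = real m * pi / L"
  have p: "p > 0" "q > 0" using L n m by (auto simp: p_def q_def)
  have prod: "sin (p * y) * sin (q * y) = (cos ((p - q) * y) - cos ((p + q) * y)) / 2" for y
    by (simp add: sin_times_sin algebra_simps)
  \<comment> \<open>At \<open>y = L\<close> the arguments of both antiderivative sines are integer
    multiples of pi, so the boundary terms vanish.\<close>
  have sp: "sin ((p + q) * L) = 0" and sm: "sin ((p - q) * L) = 0"
  proof -
    have "(p + q) * L = of_int (int n + int m) * pi" "(p - q) * L = of_int (int n - int m) * pi"
      using L by (auto simp: p_def q_def field_simps)
    then show "sin ((p + q) * L) = 0" "sin ((p - q) * L) = 0"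
      using sin_zero_iff_int2 by blast+
  qed
  have si: "set_integrable lborel {0..L} ?f"
    by (intro borel_integrable_atLeastAtMost' continuous_intros) (use L in auto)
  have "set_integrable lborel {0<..<L} ?f"
    by (rule set_integrable_subset[OF si]) auto
  then have "(LINT y:{0<..<L}|lborel. ?f y) = integral {0<..<L} ?f"
    by (rule set_borel_integral_eq_integral(2))
  also have "\<dots> = integral {0..L} ?f"
    using integral_open_interval[of 0 L ?f] by (simp add: box_real)
  also have "\<dots> = (if n = m then L / 2 else 0)"
  proof (cases "n = m")
    case True
    then have [simp]: "q = p" by (simp add: p_def q_def)
    have "((\<lambda>y. sin (p * y) * sin (q * y)) has_integral (L / 2 - sin ((p + q) * L) / (4 * p)) - (0 / 2 - sin ((p + q) * 0) / (4 * p))) {0..L}"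
      unfolding prod using L p
      by (intro fundamental_theorem_of_calculus)
        (auto intro!: derivative_eq_intros simp: field_simps simp flip: has_real_derivative_iff_has_vector_derivative)
    then show ?thesis using True sp by (simp add: p_def q_def integral_unique)
  next
    case False
    then have ne: "p - q \<noteq> 0" using L by (simp add: p_def q_def)
    have "((\<lambda>y. sin (p * y) * sin (q * y)) has_integral
        (sin ((p - q) * L) / (2 * (p - q)) - sin ((p + q) * L) / (2 * (p + q))) -
        (sin ((p - q) * 0) / (2 * (p - q)) - sin ((p + q) * 0) / (2 * (p + q)))) {0..L}"
      unfolding prod
    proof (rule fundamental_theorem_of_calculus)
      fix y assume "y \<in> {0..L}"
      have "((\<lambda>y. sin ((p - q) * y) / (2 * (p - q)) - sin ((p + q) * y) / (2 * (p + q))) has_real_derivative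
          cos ((p - q) * y) * (p - q) / (2 * (p - q)) - cos ((p + q) * y) * (p + q) / (2 * (p + q))) (at y within {0..L})"
        using ne p by (auto intro!: derivative_eq_intros)
      moreover have "cos ((p - q) * y) * (p - q) / (2 * (p - q)) - cos ((p + q) * y) * (p + q) / (2 * (p + q)) =
          (cos ((p - q) * y) - cos ((p + q) * y)) / 2"
      proof -
        have half: "x * z / (2 * z) = x / 2" if "z \<noteq> 0" for x z :: real using that by simp
        have "p + q \<noteq> 0" using p by linarith
        from half[OF ne] half[OF this] show ?thesis by (simp only: diff_divide_distrib)
      qed
      ultimately show "((\<lambda>y. sin ((p - q) * y) / (2 * (p - q)) - sin ((p + q) * y) / (2 * (p + q))) has_vector_derivative
          (cos ((p - q) * y) - cos ((p + q) * y)) / 2) (at y within {0..L})"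
        by (simp only: has_real_derivative_iff_has_vector_derivative[symmetric])
    qed (use L in auto)
    then show ?thesis using False sp sm by (simp add: p_def q_def integral_unique)
  qed
  finally show ?thesis .
qed

text \<open>A $C^1$ truncation near 0, with derivative \<open>1 - d\<^sup>2 / s\<^sup>2\<close> for \<open>\<bar>s\<bar> > d\<close>.\<close>

definition truncate :: "real \<Rightarrow> real \<Rightarrow> real" where
  "truncate d s = sgn s * (max 0 (\<bar>s\<bar> - d))\<^sup>2 / \<bar>s\<bar>"

definition truncate_deriv :: "real \<Rightarrow> real \<Rightarrow> real" where
  "truncate_deriv d s = 1 - d\<^sup>2 / (max d \<bar>s\<bar>)\<^sup>2"

text \<open>Squaring the positive part smooths the corner: its derivative is
  \<open>2 * max 0 x\<close> even at 0. The sign cases only remove \<open>sgn\<close> and the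
  absolute value. For the size r of the argument above d, the function is r - 2 d + d^2 / r up to
  sign.\<close>

lemma truncate_has_derivative:
  assumes e: "d > 0"
  shows "(truncate d has_real_derivative truncate_deriv d s) (at s)"
proof -
  have m: "((\<lambda>x. (max 0 x)\<^sup>2) has_real_derivative 2 * max 0 x) (at x)" for x :: real
  proof (cases x "0 :: real" rule: linorder_cases)
    case less
    have "((\<lambda>x. 0) has_real_derivative 2 * max 0 x) (at x)" using less by simp
    then show ?thesis
      by (rule has_field_derivative_transform_within_open[of _ _ _ "{..<0}"]) (use less in auto)
  next
    case equal
    have "((\<lambda>h. (max 0 h)\<^sup>2 / h) \<longlongrightarrow> 0) (at (0::real))"
    proof (rule Lim_null_comparison)
      show "\<forall>\<^sub>F h in at 0. norm ((max 0 h)\<^sup>2 / h) \<le> \<bar>h :: real\<bar>"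
        by (intro always_eventually allI) (auto simp: max_def power2_eq_square abs_mult)
      show "((\<lambda>h. \<bar>h :: real\<bar>) \<longlongrightarrow> 0) (at 0)" by (intro tendsto_rabs_zero tendsto_ident_at)
    qed
    with equal show ?thesis by (simp add: DERIV_def)
  next
    case greater
    have "((\<lambda>x. x\<^sup>2) has_real_derivative 2 * max 0 x) (at x)" using greater
      by (auto intro!: derivative_eq_intros)
    then show ?thesis
      by (rule has_field_derivative_transform_within_open[of _ _ _ "{0<..}"]) (use greater in auto)
  qed
  consider "s > 0" | "s < 0" | "s = 0" by linarith
  then show ?thesis
  proof cases
    case 1
    have "((\<lambda>s. (max 0 (s - d))\<^sup>2 / s) has_real_derivative truncate_deriv d s) (at s)"
    proof -
      have "((\<lambda>s. (max 0 (s - d))\<^sup>2) has_real_derivative 2 * max 0 (s - d) * 1) (at s)"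
        by (rule DERIV_chain2[OF m]) (auto intro!: derivative_eq_intros)
      from DERIV_divide[OF this DERIV_ident] 1
      have "((\<lambda>s. (max 0 (s - d))\<^sup>2 / s) has_real_derivative
          (2 * max 0 (s - d) * 1 * s - (max 0 (s - d))\<^sup>2 * 1) / (s * s)) (at s)" by simp
      moreover have "(2 * max 0 (s - d) * 1 * s - (max 0 (s - d))\<^sup>2 * 1) / (s * s) = truncate_deriv d s"
        using 1 e by (cases "s \<le> d") (auto simp: truncate_deriv_def max_def power2_eq_square field_simps)
      ultimately show ?thesis by simp
    qed
    then show ?thesis
      by (rule has_field_derivative_transform_within_open[of _ _ _ "{0<..}"]) (use 1 in \<open>auto simp: truncate_def\<close>)
  next
    case 2
    have "((\<lambda>s. (max 0 (- s - d))\<^sup>2 / s) has_real_derivative truncate_deriv d s) (at s)"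
    proof -
      have "((\<lambda>s. (max 0 (- s - d))\<^sup>2) has_real_derivative 2 * max 0 (- s - d) * - 1) (at s)"
        by (rule DERIV_chain2[OF m]) (auto intro!: derivative_eq_intros)
      from DERIV_divide[OF this DERIV_ident] 2
      have "((\<lambda>s. (max 0 (- s - d))\<^sup>2 / s) has_real_derivative
          (2 * max 0 (- s - d) * - 1 * s - (max 0 (- s - d))\<^sup>2 * 1) / (s * s)) (at s)" by simp
      moreover have "(2 * max 0 (- s - d) * - 1 * s - (max 0 (- s - d))\<^sup>2 * 1) / (s * s) = truncate_deriv d s"
        using 2 e by (cases "- s \<le> d") (auto simp: truncate_deriv_def max_def power2_eq_square field_simps)
      ultimately show ?thesis by simp
    qed
    then show ?thesis
      by (rule has_field_derivative_transform_within_open[of _ _ _ "{..<0}"]) (use 2 in \<open>auto simp: truncate_def\<close>)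
  next
    case 3
    \<comment> \<open>The truncation is identically 0 near 0, also at 0 itself, where
      \<open>sgn 0 = 0\<close>; the quotient there does no harm.\<close>
    have "((\<lambda>s. 0) has_real_derivative truncate_deriv d s) (at s)"
      using 3 e by (simp add: truncate_deriv_def)
    then show ?thesis
      by (rule has_field_derivative_transform_within_open[of _ _ _ "{- d<..<d}"])
        (use 3 e in \<open>auto simp: truncate_def max_def\<close>)
  qed
qed

lemma continuous_truncate_deriv: "d > 0 \<Longrightarrow> continuous_on UNIV (truncate_deriv d)"
proof -
  assume e: "d > 0"
  then have "max d \<bar>s\<bar> \<noteq> 0" for s by linarith
  then show ?thesis unfolding truncate_deriv_def by (intro continuous_intros) simp
qed

text \<open>A truncated gradient is therefore never longer than the original one, which supplies the
  dominating function in the limit.\<close>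

lemma truncate_deriv_bounds:
  assumes "d > 0"
  shows "0 \<le> truncate_deriv d s" "truncate_deriv d s \<le> 1"
proof -
  have "d\<^sup>2 \<le> (max d \<bar>s\<bar>)\<^sup>2" using assms by (intro power_mono) auto
  moreover have "0 < max d \<bar>s\<bar>" using assms by linarith
  then have "0 < (max d \<bar>s\<bar>)\<^sup>2" by (rule zero_less_power)
  ultimately show "0 \<le> truncate_deriv d s" "truncate_deriv d s \<le> 1"
    by (auto simp: truncate_deriv_def)
qed

lemma truncate_eq_0: "\<bar>s\<bar> \<le> d \<Longrightarrow> truncate d s = 0" "d > 0 \<Longrightarrow> \<bar>s\<bar> \<le> d \<Longrightarrow> truncate_deriv d s = 0"
  by (auto simp: truncate_def truncate_deriv_def max_def)

lemma truncate_diff_le: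
  assumes "d > 0"
  shows "\<bar>truncate d s - s\<bar> \<le> 2 * d"
proof (cases "\<bar>s\<bar> \<le> d")
  case True
  then show ?thesis using assms by (simp add: truncate_eq_0)
next
  case False
  define r where "r = \<bar>s\<bar>"
  have r: "r > d" using False by (simp add: r_def)
  have s: "s = sgn s * r" by (simp add: r_def sgn_mult_abs)
  have "(r - d)\<^sup>2 / r - r = d * (d / r) - 2 * d"
    using r assms by (simp add: power2_eq_square field_simps)
  moreover have "0 \<le> d / r" "d / r \<le> 1" using r assms by auto
  then have "0 \<le> d * (d / r)" "d * (d / r) \<le> d * 1"
    using assms by (auto intro!: mult_left_mono simp del: times_divide_eq_right)
  ultimately have b: "\<bar>(r - d)\<^sup>2 / r - r\<bar> \<le> 2 * d" by linarith
  have "truncate d s - s = sgn s * ((r - d)\<^sup>2 / r - r)"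
    using r by (subst (2) s) (simp add: truncate_def r_def[symmetric] right_diff_distrib)
  then have "\<bar>truncate d s - s\<bar> = \<bar>sgn s\<bar> * \<bar>(r - d)\<^sup>2 / r - r\<bar>" by (simp add: abs_mult)
  also have "\<dots> \<le> 1 * \<bar>(r - d)\<^sup>2 / r - r\<bar>" by (intro mult_right_mono) (auto simp: sgn_if)
  finally show ?thesis using b by simp
qed

text \<open>
  If \<open>u\<close> is $C^1$ and vanishes on the boundary of \<open>W\<close>, truncating its small values moves the
  support into \<open>W\<close>.
\<close>

lemma H10_vanishing_boundary:
  fixes u :: "'a::euclidean_space \<Rightarrow> real"
  assumes W: "open W" "bounded W" and u: "\<And>x. GDERIV u x :> g x" and cg: "continuous_on UNIV g"
    and boundary: "\<And>x. x \<in> frontier W \<Longrightarrow> u x = 0"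
    and null: "AE x in lborel. x \<in> W \<longrightarrow> u x \<noteq> 0"
  shows "H10_with_gradient W u g"
proof -
  have cu: "continuous_on UNIV u"
    using u unfolding gderiv_def by (meson continuous_at_imp_continuous_on has_derivative_continuous)
  have [measurable]: "W \<in> sets borel" using W by simp
  have fin: "emeasure lborel W < \<infinity>" using emeasure_bounded_finite[OF W(2)] by simp
  have cpt: "compact (closure W)" using W(2) by simp
  have bnd: "\<exists>B. 0 \<le> B \<and> (\<forall>x\<in>W. norm (v x) \<le> B)" if "continuous_on UNIV v" for v :: "'a \<Rightarrow> 'b::euclidean_space"
  proof -
    have "bounded (v ` closure W)"
      using that cpt by (intro compact_imp_bounded compact_continuous_image) (auto intro: continuous_on_subset)
    then obtain B where "0 < B" "\<And>x. x \<in> closure W \<Longrightarrow> norm (v x) \<le> B" by (auto simp: bounded_pos)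
    then show ?thesis using closure_subset by (intro exI[of _ B]) auto
  qed
  obtain B where B: "0 \<le> B" "\<And>x. x \<in> W \<Longrightarrow> norm (g x) \<le> B" using bnd[OF cg] by blast
  obtain C where C: "\<And>x. x \<in> W \<Longrightarrow> norm (u x) \<le> C" using bnd[OF cu] by blast
  have uL: "u \<in> L2_on W"
    by (rule L2_on_bounded(1)[OF _ fin, of _ C]) (use cu C in \<open>auto intro!: set_borel_continuous\<close>)
  have gL: "g \<in> L2_on W"
    by (rule L2_on_bounded(1)[OF _ fin, of _ B]) (use cg B in \<open>auto intro!: set_borel_continuous\<close>)
  define d where "d k = 1 / real (Suc k)" for k
  have d: "d k > 0" for k by (simp add: d_def)
  have d_lim: "d \<longlonglongrightarrow> 0" unfolding d_def using LIMSEQ_inverse_real_of_nat by (simp add: inverse_eq_divide)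
  \<comment> \<open>Cutting at \<open>W\<close> is necessary because \<open>u\<close> may be nonzero
    beyond the closure of \<open>W\<close>, as the sines are.\<close>
  define \<phi> where "\<phi> k x = (if x \<in> W then truncate (d k) (u x) else 0)" for k x
  define \<gamma> where "\<gamma> k x = (if x \<in> W then truncate_deriv (d k) (u x) *\<^sub>R g x else 0)" for k x
  \<comment> \<open>Points of the frontier drop out because \<open>u\<close> vanishes there, so this
    compact subset of the closure already lies in \<open>W\<close>.\<close>
  define K where "K k = closure W \<inter> {x. d k \<le> \<bar>u x\<bar>}" for k
  have K: "compact (K k)" "K k \<subseteq> W" for k
  proof -
    have "closed {x. d k \<le> \<bar>u x\<bar>}" by (intro closed_Collect_le continuous_intros cu)
    then show "compact (K k)" unfolding K_def using cpt by (intro compact_Int_closed)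
    show "K k \<subseteq> W"
    proof
      fix x assume "x \<in> K k"
      then have "x \<in> closure W" "u x \<noteq> 0" using d[of k] by (auto simp: K_def)
      then show "x \<in> W" using boundary[of x] W(1) by (auto simp: frontier_def interior_open)
    qed
  qed
  have out: "\<phi> k x = 0" "\<gamma> k x = 0" if "x \<notin> K k" for k x
    using that closure_subset[of W] d[of k] by (auto simp: \<phi>_def \<gamma>_def K_def truncate_eq_0 less_imp_le not_le)
  have openK: "open (- K k)" for k using K(1) by (simp add: compact_imp_closed open_Compl)
  \<comment> \<open>Differentiability and continuity are checked on two overlapping open sets: on
    \<open>W\<close> through the chain rule, off \<open>K k\<close> because everything is 0.\<close>
  have cover: "UNIV = W \<union> - K k" for k using K(2)[of k] by auto
  have C1c: "C1c_with_gradient W (\<phi> k) (\<gamma> k)" for k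
    unfolding C1c_with_gradient_def
  proof (intro conjI allI)
    show "GDERIV (\<phi> k) x :> \<gamma> k x" for x
    proof (cases "x \<in> W")
      case True
      have "((\<lambda>x. truncate (d k) (u x)) has_derivative (\<lambda>h. (h \<bullet> g x) * truncate_deriv (d k) (u x))) (at x)"
        using has_derivative_compose[OF u[of x, unfolded gderiv_def]
            truncate_has_derivative[OF d, of k "u x", unfolded has_field_derivative_def]]
        by (simp add: mult.commute)
      then have "(\<phi> k has_derivative (\<lambda>h. (h \<bullet> g x) * truncate_deriv (d k) (u x))) (at x)"
        by (rule has_derivative_transform_within_open[OF _ W(1) True]) (simp add: \<phi>_def)
      then show ?thesis using True by (simp add: gderiv_def \<gamma>_def mult.commute)
    next
      case False
      then have x: "x \<in> - K k" using K(2) by auto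
      have "((\<lambda>x. 0) has_derivative (\<lambda>h. 0)) (at x)" by simp
      then have "(\<phi> k has_derivative (\<lambda>h. 0)) (at x)"
        by (rule has_derivative_transform_within_open[OF _ openK x]) (simp add: out)
      then show ?thesis using False by (simp add: gderiv_def \<gamma>_def)
    qed
    have "continuous_on W (\<lambda>x. truncate_deriv (d k) (u x) *\<^sub>R g x)"
      by (intro continuous_intros continuous_on_compose2[OF continuous_truncate_deriv[OF d]]
          continuous_on_subset[OF cu] continuous_on_subset[OF cg]) auto
    then have "continuous_on W (\<gamma> k)" by (rule continuous_on_eq) (simp add: \<gamma>_def)
    moreover have "continuous_on (- K k) (\<gamma> k)"
      by (rule continuous_on_eq[OF continuous_on_const[of _ 0]]) (simp add: out)
    ultimately have "continuous_on (W \<union> - K k) (\<gamma> k)"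
      using W(1) openK by (intro continuous_on_open_Un)
    then show "continuous_on UNIV (\<gamma> k)" by (subst cover[of k])
    show "\<exists>K. compact K \<and> K \<subseteq> W \<and> (\<forall>x. x \<notin> K \<longrightarrow> \<phi> k x = 0)"
      using K out by (intro exI[of _ "K k"]) auto
  qed
  have \<gamma>L: "\<gamma> k \<in> L2_on W" for k using C1c_L2[OF W(1) C1c] by simp
  have "(\<lambda>k. L2_norm_on W (\<lambda>x. \<phi> k x - u x)) \<longlonglongrightarrow> 0"
  proof (rule Lim_null_comparison)
    have "L2_norm_on W (\<lambda>x. \<phi> k x - u x) \<le> 2 * d k * sqrt (measure lborel W)" for k
      using d[of k] truncate_diff_le[OF d, of k] cu C1c_continuous[OF C1c]
      by (intro L2_on_bounded(2)[OF _ fin] set_borel_continuous continuous_intros) (auto simp: \<phi>_def)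
    then show "\<forall>\<^sub>F k in sequentially. norm (L2_norm_on W (\<lambda>x. \<phi> k x - u x)) \<le> 2 * d k * sqrt (measure lborel W)"
      by (simp add: L2_norm_on_nonneg)
    have "(\<lambda>k. 2 * d k * sqrt (measure lborel W)) \<longlonglongrightarrow> 2 * 0 * sqrt (measure lborel W)"
      by (intro tendsto_intros d_lim)
    then show "(\<lambda>k. 2 * d k * sqrt (measure lborel W)) \<longlonglongrightarrow> 0" by simp
  qed
  moreover have "(\<lambda>k. L2_norm_on W (\<lambda>x. \<gamma> k x - g x)) \<longlonglongrightarrow> 0"
  proof -
    have "(\<lambda>k. LINT x|lborel. indicator W x *\<^sub>R (norm (\<gamma> k x - g x))\<^sup>2) \<longlonglongrightarrow> (LINT x::'a|lborel. 0)"
    proof (rule integral_dominated_convergence[where w = "\<lambda>x. B\<^sup>2 * indicator W x"])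
      show "(\<lambda>x. indicator W x *\<^sub>R (norm (\<gamma> k x - g x))\<^sup>2) \<in> borel_measurable lborel" for k
        using L2_on_diff[OF \<gamma>L gL, of k] by (auto simp: L2_on_def set_integrable_def)
      show "integrable lborel (\<lambda>x. B\<^sup>2 * indicator W x)"
        using fin by (intro integrable_mult_right integrable_real_indicator) auto
      have eq: "norm (\<gamma> k x - g x) = (1 - truncate_deriv (d k) (u x)) * norm (g x)" if "x \<in> W" for k x
      proof -
        have "\<gamma> k x - g x = - ((1 - truncate_deriv (d k) (u x)) *\<^sub>R g x)"
          using that by (simp add: \<gamma>_def algebra_simps)
        then show ?thesis using truncate_deriv_bounds[OF d, of k "u x"] by simp
      qed
      show "AE x in lborel. norm (indicator W x *\<^sub>R (norm (\<gamma> k x - g x))\<^sup>2) \<le> B\<^sup>2 * indicator W x" for k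
      proof (rule AE_I2)
        fix x
        have "norm (\<gamma> k x - g x) \<le> 1 * B" if "x \<in> W"
          unfolding eq[OF that] using truncate_deriv_bounds[OF d, of k "u x"] B(2)[OF that]
          by (intro mult_mono) auto
        then show "norm (indicator W x *\<^sub>R (norm (\<gamma> k x - g x))\<^sup>2) \<le> B\<^sup>2 * indicator W x"
          by (auto simp: indicator_def intro!: power_mono)
      qed
      \<comment> \<open>At a zero of \<open>u\<close> the truncated gradient is 0 for every
        \<open>k\<close> and need not approach \<open>g\<close>; this is where the zeros in
        \<open>W\<close> must form a null set.\<close>
      show "AE x in lborel. (\<lambda>k. indicator W x *\<^sub>R (norm (\<gamma> k x - g x))\<^sup>2) \<longlonglongrightarrow> 0"
        using null
      proof (rule AE_mp, intro AE_I2 impI)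
        fix x assume nz: "x \<in> W \<longrightarrow> u x \<noteq> 0"
        show "(\<lambda>k. indicator W x *\<^sub>R (norm (\<gamma> k x - g x))\<^sup>2) \<longlonglongrightarrow> 0"
        proof (cases "x \<in> W")
          case True
          with nz have nz: "\<bar>u x\<bar> > 0" by simp
          have "(\<lambda>k. (d k)\<^sup>2 / (max (d k) \<bar>u x\<bar>)\<^sup>2) \<longlonglongrightarrow> 0\<^sup>2 / (max 0 \<bar>u x\<bar>)\<^sup>2"
            using nz by (intro tendsto_intros d_lim) auto
          then have "(\<lambda>k. 1 - truncate_deriv (d k) (u x)) \<longlonglongrightarrow> 0" by (simp add: truncate_deriv_def)
          then have "(\<lambda>k. ((1 - truncate_deriv (d k) (u x)) * norm (g x))\<^sup>2) \<longlonglongrightarrow> (0 * norm (g x))\<^sup>2"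
            by (intro tendsto_intros)
          then show ?thesis using True by (simp add: eq)
        qed simp
      qed
    qed simp
    then have "(\<lambda>k. sqrt (LINT x|lborel. indicator W x *\<^sub>R (norm (\<gamma> k x - g x))\<^sup>2)) \<longlonglongrightarrow> sqrt 0"
      by (intro tendsto_real_sqrt) simp
    then show ?thesis by (simp add: L2_norm_on_def set_lebesgue_integral_def)
  qed
  ultimately show ?thesis
    unfolding H10_with_gradient_def using uL gL C1c by blast
qed

section \<open>Euler-Maclaurin summation of the Gaussian\<close>

text \<open>Four integrations by parts against \<open>w\<close>, which is the Bernoulli polynomial
  B_4 (x - a) shifted by 1/30. At the endpoints \<open>w\<close> and \<open>w1\<close> vanish,
  \<open>w2\<close> is 2 twice and \<open>w3\<close> is -12 and 12, which after division by 24
  leaves exactly the trapezoid and derivative terms. The constant 384 is 24 * 16, as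
  \<open>w\<close> is at most 1/16.\<close>

lemma euler_maclaurin_unit:
  fixes f f1 f2 f3 f4 :: "real \<Rightarrow> real"
  assumes d: "\<And>x. (f has_real_derivative f1 x) (at x)" "\<And>x. (f1 has_real_derivative f2 x) (at x)"
    "\<And>x. (f2 has_real_derivative f3 x) (at x)" "\<And>x. (f3 has_real_derivative f4 x) (at x)"
    and c: "continuous_on UNIV f4"
  shows "\<bar>integral {a..a + 1} f - (f a + f (a + 1)) / 2 + (f1 (a + 1) - f1 a) / 12\<bar>
    \<le> integral {a..a + 1} (\<lambda>x. \<bar>f4 x\<bar>) / 384"
proof -
  \<comment> \<open>The weight \<open>w\<close> has \<open>w'''' = 24\<close> and vanishes to second order at both endpoints.\<close>
  define w where "w x = (x - a)\<^sup>2 * (1 - (x - a))\<^sup>2" for x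
  define w1 where "w1 x = 2 * (x - a) * (1 - (x - a))\<^sup>2 - 2 * (x - a)\<^sup>2 * (1 - (x - a))" for x
  define w2 where "w2 x = 12 * (x - a)\<^sup>2 - 12 * (x - a) + 2" for x
  define w3 where "w3 x = 24 * (x - a) - 12" for x
  have w: "(w has_real_derivative w1 x) (at x)" "(w1 has_real_derivative w2 x) (at x)"
    "(w2 has_real_derivative w3 x) (at x)" "(w3 has_real_derivative 24) (at x)" for x
    unfolding w_def w1_def w2_def w3_def
    by (auto intro!: derivative_eq_intros simp: algebra_simps power2_eq_square)
  define F where "F x = (f3 x * w x - f2 x * w1 x + f1 x * w2 x - f x * w3 x) / 24" for x
  have F: "(F has_real_derivative f4 x * w x / 24 - f x) (at x)" for x
    unfolding F_def
    by (auto intro!: derivative_eq_intros d w simp: field_simps)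
  have cf: "continuous_on S f" for S
    using d(1) by (meson DERIV_continuous continuous_at_imp_continuous_on)
  have cw: "continuous_on S w" for S unfolding w_def by (intro continuous_intros)
  have c4: "continuous_on S f4" for S using c continuous_on_subset by blast
  have "((\<lambda>x. f4 x * w x / 24 - f x) has_integral F (a + 1) - F a) {a..a + 1}"
    by (rule fundamental_theorem_of_calculus)
      (auto intro: has_field_derivative_at_within F simp flip: has_real_derivative_iff_has_vector_derivative)
  moreover have "((\<lambda>x. f4 x * w x / 24 - f x) has_integral
      integral {a..a + 1} (\<lambda>x. f4 x * w x / 24) - integral {a..a + 1} f) {a..a + 1}"
    by (intro has_integral_diff integrable_integral integrable_continuous_interval continuous_intros cf cw c4) auto
  ultimately have "integral {a..a + 1} (\<lambda>x. f4 x * w x / 24) - integral {a..a + 1} f = F (a + 1) - F a"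
    by (rule has_integral_unique[rotated])
  also have "\<dots> = (f1 (a + 1) - f1 a) / 12 - (f a + f (a + 1)) / 2"
    by (simp add: F_def w_def w1_def w2_def w3_def field_simps)
  finally have "integral {a..a + 1} f - (f a + f (a + 1)) / 2 + (f1 (a + 1) - f1 a) / 12 =
      integral {a..a + 1} (\<lambda>x. f4 x * w x / 24)" by linarith
  also have "\<bar>\<dots>\<bar> \<le> integral {a..a + 1} (\<lambda>x. \<bar>f4 x\<bar> / 384)"
  proof -
    have "norm (f4 x * w x / 24) \<le> \<bar>f4 x\<bar> / 384" if "x \<in> {a..a + 1}" for x
    proof -
      have "(x - a) * (1 - (x - a)) \<le> 1 / 4"
        using zero_le_power2[of "x - a - 1 / 2"] by (simp add: power2_eq_square algebra_simps)
      moreover have "0 \<le> (x - a) * (1 - (x - a))" using that by auto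
      ultimately have "((x - a) * (1 - (x - a)))\<^sup>2 \<le> (1 / 4)\<^sup>2" by (rule power_mono)
      moreover have "w x = ((x - a) * (1 - (x - a)))\<^sup>2" by (simp add: w_def power_mult_distrib)
      ultimately have "w x \<le> 1 / 16" "0 \<le> w x" by (auto simp: power_divide)
      then have "\<bar>f4 x\<bar> * w x \<le> \<bar>f4 x\<bar> * (1 / 16)" by (intro mult_left_mono) auto
      with \<open>0 \<le> w x\<close> show ?thesis by (simp add: abs_mult mult_ac)
    qed
    then have "norm (integral {a..a + 1} (\<lambda>x. f4 x * w x / 24)) \<le> integral {a..a + 1} (\<lambda>x. \<bar>f4 x\<bar> / 384)"
      by (intro integral_norm_bound_integral integrable_continuous_interval continuous_intros cw c4) auto
    then show ?thesis by simp
  qed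
  finally show ?thesis by simp
qed

text \<open>The unit estimates add up and the derivative terms telescope. The sum runs over 1 to
  \<open>N\<close>, matching the mode numbers; the endpoint correction turns it into the trapezoidal
  sum.\<close>

lemma euler_maclaurin:
  fixes f f1 f2 f3 f4 :: "real \<Rightarrow> real"
  assumes d: "\<And>x. (f has_real_derivative f1 x) (at x)" "\<And>x. (f1 has_real_derivative f2 x) (at x)"
    "\<And>x. (f2 has_real_derivative f3 x) (at x)" "\<And>x. (f3 has_real_derivative f4 x) (at x)"
    and c: "continuous_on UNIV f4"
  shows "\<bar>integral {0..real N} f - ((\<Sum>k<N. f (real (Suc k))) + (f 0 - f (real N)) / 2) + (f1 (real N) - f1 0) / 12\<bar>
    \<le> integral {0..real N} (\<lambda>x. \<bar>f4 x\<bar>) / 384"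
proof (induction N)
  case 0
  then show ?case by simp
next
  case (Suc N)
  have cf: "continuous_on S f" for S
    using d(1) by (meson DERIV_continuous continuous_at_imp_continuous_on)
  have c4: "continuous_on S f4" for S using c continuous_on_subset by blast
  have split: "integral {0..real (Suc N)} h = integral {0..real N} h + integral {real N..real N + 1} h"
    if "continuous_on UNIV h" for h :: "real \<Rightarrow> real"
    using Henstock_Kurzweil_Integration.integral_combine[of 0 "real N" "real N + 1" h] that
    by (simp add: integrable_continuous_interval continuous_on_subset add.commute)
  let ?A = "integral {0..real N} f - ((\<Sum>k<N. f (real (Suc k))) + (f 0 - f (real N)) / 2) + (f1 (real N) - f1 0) / 12"
  let ?B = "integral {real N..real N + 1} f - (f (real N) + f (real N + 1)) / 2 + (f1 (real N + 1) - f1 (real N)) / 12"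
  have "integral {0..real (Suc N)} f - ((\<Sum>k<Suc N. f (real (Suc k))) + (f 0 - f (real (Suc N))) / 2) +
      (f1 (real (Suc N)) - f1 0) / 12 = ?A + ?B"
    by (simp only: split[OF cf] sum.lessThan_Suc) (simp add: field_simps)
  moreover have "integral {0..real (Suc N)} (\<lambda>x. \<bar>f4 x\<bar>) =
      integral {0..real N} (\<lambda>x. \<bar>f4 x\<bar>) + integral {real N..real N + 1} (\<lambda>x. \<bar>f4 x\<bar>)"
    by (intro split continuous_intros c4)
  ultimately show ?case
    using Suc.IH euler_maclaurin_unit[OF d c, of "real N"] abs_triangle_ineq[of ?A ?B]
    by (simp only: add_divide_distrib)
qed

section \<open>Gaussian integrals and the Gaussian sum\<close>

lemma gaussian_half_line:
  assumes s: "s > (0::real)"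
  shows "has_bochner_integral lborel (\<lambda>x. indicator {0..} x *\<^sub>R exp (- (s * x\<^sup>2))) (sqrt (pi / s) / 2)"
proof -
  have "has_bochner_integral lborel (\<lambda>x. indicator {0..} (0 + sqrt s * x) *\<^sub>R exp (- (0 + sqrt s * x)\<^sup>2)) ((sqrt pi / 2) /\<^sub>R \<bar>sqrt s\<bar>)"
    using s gaussian_moment_0 by (subst (asm) lborel_has_bochner_integral_real_affine_iff[of "sqrt s" _ _ 0]) auto
  moreover have "(\<lambda>x. indicator {0..} (0 + sqrt s * x) *\<^sub>R exp (- (0 + sqrt s * x)\<^sup>2)) = (\<lambda>x. indicator {0..} x *\<^sub>R exp (- (s * x\<^sup>2)))"
    using s by (auto simp: fun_eq_iff indicator_def power_mult_distrib zero_le_mult_iff)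
  ultimately show ?thesis using s by (simp add: real_sqrt_divide field_simps)
qed

lemma gaussian_interval_integral:
  assumes s: "s > (0::real)"
  shows "integral {0..b} (\<lambda>x. exp (- (s * x\<^sup>2))) = (LINT x|lborel. indicator {..b} x *\<^sub>R (indicator {0..} x *\<^sub>R exp (- (s * x\<^sup>2))))"
proof -
  have "set_integrable lborel {0..b} (\<lambda>x. exp (- (s * x\<^sup>2)))"
    by (intro borel_integrable_atLeastAtMost' continuous_intros)
  then have "integral {0..b} (\<lambda>x. exp (- (s * x\<^sup>2))) = (LINT x:{0..b}|lborel. exp (- (s * x\<^sup>2)))"
    using set_borel_integral_eq_integral(2) by metis
  also have "\<dots> = (LINT x|lborel. indicator {..b} x *\<^sub>R (indicator {0..} x *\<^sub>R exp (- (s * x\<^sup>2))))"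
    unfolding set_lebesgue_integral_def by (intro Bochner_Integration.integral_cong) (auto simp: indicator_def)
  finally show ?thesis .
qed

lemma gaussian_interval_le:
  assumes s: "s > (0::real)"
  shows "integral {0..b} (\<lambda>x. exp (- (s * x\<^sup>2))) \<le> sqrt (pi / s) / 2"
proof -
  note g = gaussian_half_line[OF s, unfolded has_bochner_integral_iff]
  have "integral {0..b} (\<lambda>x. exp (- (s * x\<^sup>2))) \<le> (LINT x|lborel. indicator {0..} x *\<^sub>R exp (- (s * x\<^sup>2)))"
    unfolding gaussian_interval_integral[OF s]
    by (rule integral_mono[OF integrable_mult_indicator[OF _ conjunct1[OF g]] conjunct1[OF g]])
      (auto simp: indicator_def)
  with g show ?thesis by simp
qed

lemma gaussian_interval_tendsto:
  assumes s: "s > (0::real)"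
  shows "(\<lambda>N. integral {0..real N} (\<lambda>x. exp (- (s * x\<^sup>2)))) \<longlonglongrightarrow> sqrt (pi / s) / 2"
proof -
  note g = gaussian_half_line[OF s, unfolded has_bochner_integral_iff]
  have "((\<lambda>b. integral {0..b} (\<lambda>x. exp (- (s * x\<^sup>2)))) \<longlongrightarrow> sqrt (pi / s) / 2) at_top"
    unfolding gaussian_interval_integral[OF s] conjunct2[OF g, symmetric]
    by (rule tendsto_integral_at_top[OF sets_lborel conjunct1[OF g]])
  then show ?thesis by (rule filterlim_compose) (rule filterlim_real_sequentially)
qed

lemma summable_gaussian:
  assumes s: "s > (0::real)"
  shows "summable (\<lambda>k. exp (- (s * (real (Suc k))\<^sup>2)))"
proof (rule summable_comparison_test'[where N = 0])
  show "summable (\<lambda>k. exp (- s) ^ k)" using s by (intro summable_geometric) simp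
  show "norm (exp (- (s * (real (Suc k))\<^sup>2))) \<le> exp (- s) ^ k" for k
  proof -
    have "real k \<le> (real (Suc k))\<^sup>2" by (simp add: power2_eq_square algebra_simps)
    then have "s * real k \<le> s * (real (Suc k))\<^sup>2" using s by (intro mult_left_mono) auto
    then show ?thesis by (simp add: exp_of_nat_mult[symmetric] mult.commute)
  qed
qed

text \<open>The main term is the half-line integral and the -1/2 is half of the missing term at 0.
  The derivative correction disappears because the Gaussian is even and decays. The remainder has
  order s^(3/2), with the factor 1/6 = 128 / (2 * 384).\<close>

lemma gaussian_sum_approx:
  assumes s: "s > (0::real)"
  shows "\<bar>(\<Sum>k. exp (- (s * (real (Suc k))\<^sup>2))) - (sqrt (pi / s) / 2 - 1 / 2)\<bar> \<le> s\<^sup>2 * sqrt (pi / (s / 2)) / 6"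
proof -
  define f where "f x = exp (- (s * x\<^sup>2))" for x
  \<comment> \<open>Up to sign and powers of sqrt s, the polynomial factors of \<open>f1\<close> to
    \<open>f4\<close> are the Hermite polynomials in sqrt s * x.\<close>
  define f1 where "f1 x = - (2 * s * x) * f x" for x
  define f2 where "f2 x = (4 * s^2 * x^2 - 2 * s) * f x" for x
  define f3 where "f3 x = (- 8 * s^3 * x^3 + 12 * s^2 * x) * f x" for x
  define f4 where "f4 x = (16 * s^4 * x^4 - 48 * s^3 * x^2 + 12 * s^2) * f x" for x
  have df: "(f has_real_derivative f1 x) (at x)" for x
    unfolding f_def f1_def by (auto intro!: derivative_eq_intros)
  have d: "(f1 has_real_derivative f2 x) (at x)" "(f2 has_real_derivative f3 x) (at x)"
    "(f3 has_real_derivative f4 x) (at x)" for x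
    unfolding f1_def[abs_def] f2_def[abs_def] f3_def[abs_def] f4_def[abs_def]
    by (auto intro!: derivative_eq_intros df simp: f1_def field_simps power2_eq_square power3_eq_cube power4_eq_xxxx)
  have c4: "continuous_on UNIV f4" unfolding f4_def f_def by (intro continuous_intros)
  have f4_le: "\<bar>f4 x\<bar> \<le> 128 * s\<^sup>2 * exp (- (s / 2 * x\<^sup>2))" for x
  proof -
    define y where "y = s * x\<^sup>2"
    have y: "y \<ge> 0" using s by (simp add: y_def)
    have "(y / 2)\<^sup>2 / 2 + y / 2 + 1 \<le> exp (y / 2)"
      using exp_lower_Taylor_quadratic[of "y / 2"] y by simp
    \<comment> \<open>The factor 128 matches the leading terms, as 128 * (y / 2)^2 / 2 = 16 y^2; the
      remaining 64 y + 128 absorbs the lower terms. Half of the Gaussian decay is left over.\<close>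
    then have "128 * ((y / 2)\<^sup>2 / 2 + y / 2 + 1) \<le> 128 * exp (y / 2)" by simp
    moreover have "\<bar>16 * y\<^sup>2 - 48 * y + 12\<bar> \<le> 128 * ((y / 2)\<^sup>2 / 2 + y / 2 + 1)"
      using y by (auto simp: power2_eq_square abs_le_iff)
    ultimately have "\<bar>16 * y\<^sup>2 - 48 * y + 12\<bar> * exp (- y) \<le> 128 * exp (y / 2) * exp (- y)"
      by (intro mult_right_mono) auto
    also have "\<dots> = 128 * exp (- (y / 2))" by (simp flip: exp_add)
    finally have "s\<^sup>2 * (\<bar>16 * y\<^sup>2 - 48 * y + 12\<bar> * exp (- y)) \<le> s\<^sup>2 * (128 * exp (- (y / 2)))"
      by (intro mult_left_mono) auto
    moreover have "f4 x = s\<^sup>2 * ((16 * y\<^sup>2 - 48 * y + 12) * exp (- y))"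
      by (simp add: f4_def f_def y_def algebra_simps power2_eq_square power3_eq_cube power4_eq_xxxx)
    ultimately show ?thesis by (simp add: abs_mult y_def)
  qed
  have int4: "integral {0..real N} (\<lambda>x. \<bar>f4 x\<bar>) / 384 \<le> s\<^sup>2 * sqrt (pi / (s / 2)) / 6" for N
  proof -
    have "integral {0..real N} (\<lambda>x. \<bar>f4 x\<bar>) \<le> integral {0..real N} (\<lambda>x. 128 * s\<^sup>2 * exp (- (s / 2 * x\<^sup>2)))"
      by (intro integral_le integrable_continuous_interval continuous_intros continuous_on_subset[OF c4] f4_le) auto
    also have "\<dots> = 128 * s\<^sup>2 * integral {0..real N} (\<lambda>x. exp (- (s / 2 * x\<^sup>2)))" by simp
    also have "\<dots> \<le> 128 * s\<^sup>2 * (sqrt (pi / (s / 2)) / 2)"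
      using s gaussian_interval_le[of "s / 2" "real N"] by (intro mult_left_mono) auto
    finally show ?thesis by simp
  qed
  let ?S = "\<Sum>k. exp (- (s * (real (Suc k))\<^sup>2))"
  have "(\<lambda>k. f (real (Suc k))) \<longlonglongrightarrow> 0"
    using summable_LIMSEQ_zero[OF summable_gaussian[OF s]] by (simp add: f_def)
  then have f0: "(\<lambda>N. f (real N)) \<longlonglongrightarrow> 0" by (rule LIMSEQ_imp_Suc)
  have f10: "(\<lambda>N. f1 (real N)) \<longlonglongrightarrow> 0"
  proof (rule Lim_null_comparison)
    have "(\<lambda>n. 2 * s * (of_nat n * exp (- s) ^ n)) \<longlonglongrightarrow> 2 * s * 0"
      using s by (intro tendsto_mult_left powser_times_n_limit_0) simp
    then show "(\<lambda>n. 2 * s * (of_nat n * exp (- s) ^ n)) \<longlonglongrightarrow> 0" by simp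
    have "norm (f1 (real n)) \<le> 2 * s * (of_nat n * exp (- s) ^ n)" for n
    proof -
      have "real n \<le> (real n)\<^sup>2" by (simp add: power2_eq_square flip: of_nat_mult)
      then have "s * real n \<le> s * (real n)\<^sup>2" using s by (intro mult_left_mono) auto
      then have "f (real n) \<le> exp (- s) ^ n" by (simp add: f_def exp_of_nat_mult[symmetric] mult.commute)
      then have "2 * s * real n * f (real n) \<le> 2 * s * real n * exp (- s) ^ n"
        using s by (intro mult_left_mono) auto
      moreover have "norm (f1 (real n)) = 2 * s * real n * f (real n)"
        using s by (simp add: f1_def f_def abs_mult)
      ultimately show ?thesis by (simp add: mult.assoc)
    qed
    then show "\<forall>\<^sub>F n in sequentially. norm (f1 (real n)) \<le> 2 * s * (of_nat n * exp (- s) ^ n)" by simp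
  qed
  have "(\<lambda>N. \<Sum>k<N. f (real (Suc k))) \<longlonglongrightarrow> ?S"
    using summable_LIMSEQ[OF summable_gaussian[OF s]] by (simp add: f_def)
  moreover have "(\<lambda>N. integral {0..real N} f) \<longlonglongrightarrow> sqrt (pi / s) / 2"
    using gaussian_interval_tendsto[OF s] by (simp add: f_def[abs_def])
  ultimately have "(\<lambda>N. \<bar>integral {0..real N} f - ((\<Sum>k<N. f (real (Suc k))) + (f 0 - f (real N)) / 2) + (f1 (real N) - f1 0) / 12\<bar>)
      \<longlonglongrightarrow> \<bar>sqrt (pi / s) / 2 - (?S + (f 0 - 0) / 2) + (0 - f1 0) / 12\<bar>"
    by (intro tendsto_intros f0 f10) auto
  then have "\<bar>sqrt (pi / s) / 2 - (?S + (f 0 - 0) / 2) + (0 - f1 0) / 12\<bar> \<le> s\<^sup>2 * sqrt (pi / (s / 2)) / 6"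
    by (rule LIMSEQ_le_const2) (intro exI allI impI order_trans[OF euler_maclaurin[OF df d c4] int4])
  then show ?thesis by (simp add: f_def f1_def abs_minus_commute algebra_simps)
qed

section \<open>The box\<close>

locale open_box =
  fixes l :: "'a::euclidean_space"
  assumes l_pos: "b \<in> Basis \<Longrightarrow> 0 < l \<bullet> b"
begin

section \<open>Product sine functions and their gradients\<close>

definition freq :: "('a \<Rightarrow> nat) \<Rightarrow> 'a \<Rightarrow> real" where
  "freq n b = real (n b) * pi / (l \<bullet> b)"

definition sine :: "('a \<Rightarrow> nat) \<Rightarrow> 'a \<Rightarrow> real \<Rightarrow> real" where
  "sine n b y = sqrt (2 / (l \<bullet> b)) * sin (freq n b * y)"

definition sine_deriv :: "('a \<Rightarrow> nat) \<Rightarrow> 'a \<Rightarrow> real \<Rightarrow> real" where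
  "sine_deriv n b y = sqrt (2 / (l \<bullet> b)) * (freq n b * cos (freq n b * y))"

definition eig :: "('a \<Rightarrow> nat) \<Rightarrow> 'a \<Rightarrow> real" where
  "eig n x = (\<Prod>b\<in>Basis. sine n b (x \<bullet> b))"

definition eig_partial :: "('a \<Rightarrow> nat) \<Rightarrow> 'a \<Rightarrow> 'a \<Rightarrow> real" where
  "eig_partial n b x = sine_deriv n b (x \<bullet> b) * (\<Prod>j\<in>Basis - {b}. sine n j (x \<bullet> j))"

definition eig_grad :: "('a \<Rightarrow> nat) \<Rightarrow> 'a \<Rightarrow> 'a" where
  "eig_grad n x = (\<Sum>b\<in>Basis. eig_partial n b x *\<^sub>R b)"

definition eigval :: "('a \<Rightarrow> nat) \<Rightarrow> real" where
  "eigval n = (\<Sum>b\<in>Basis. (freq n b)\<^sup>2)"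

definition eig_bound :: real where
  "eig_bound = (\<Prod>b\<in>(Basis::'a set). 1 + sqrt (2 / (l \<bullet> b)))"

abbreviation W :: "'a set" where "W \<equiv> box 0 l"

lemma open_W: "open W" and bounded_W: "bounded W"
  by (auto simp: open_box bounded_box)

lemma finite_W: "emeasure lborel W < \<infinity>"
  using emeasure_bounded_finite[OF bounded_W] by simp

lemma W_nonempty: "W \<noteq> {}"
  using l_pos by (auto simp: box_ne_empty)

lemma freq_nonneg: "b \<in> Basis \<Longrightarrow> 0 \<le> freq n b"
  using l_pos by (simp add: freq_def less_imp_le)

lemma sine_has_derivative: "(sine n b has_real_derivative sine_deriv n b y) (at y)"
  unfolding sine_def sine_deriv_def by (auto intro!: derivative_eq_intros)

lemma sine_deriv_has_derivative: "(sine_deriv n b has_real_derivative - (freq n b)\<^sup>2 * sine n b y) (at y)"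
  unfolding sine_def sine_deriv_def by (auto intro!: derivative_eq_intros simp: power2_eq_square)

lemma continuous_sine: "continuous_on S (sine n b)"
  unfolding sine_def by (intro continuous_intros)

lemma continuous_sine_deriv: "continuous_on S (sine_deriv n b)"
  unfolding sine_deriv_def by (intro continuous_intros)

lemma continuous_eig: "continuous_on UNIV (eig n)"
  unfolding eig_def by (intro continuous_intros continuous_on_compose2[OF continuous_sine]) auto

lemma continuous_eig_partial: "continuous_on UNIV (eig_partial n b)"
  unfolding eig_partial_def
  by (intro continuous_intros continuous_on_compose2[OF continuous_sine]
      continuous_on_compose2[OF continuous_sine_deriv]) auto

lemma continuous_eig_grad: "continuous_on UNIV (eig_grad n)"
  unfolding eig_grad_def by (intro continuous_intros continuous_eig_partial)

lemma GDERIV_eig: "GDERIV (eig n) x :> eig_grad n x"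
proof -
  have "((\<lambda>x. sine n b (x \<bullet> b)) has_derivative (\<lambda>h. (h \<bullet> b) * sine_deriv n b (x \<bullet> b))) (at x)" for b
  proof -
    have "((\<lambda>x. x \<bullet> b) has_derivative (\<lambda>h. h \<bullet> b)) (at x)"
      by (auto intro!: derivative_eq_intros)
    from has_derivative_compose[OF this sine_has_derivative[of n b "x \<bullet> b", unfolded has_field_derivative_def]]
    show ?thesis by (simp add: mult.commute)
  qed
  then have "((\<lambda>x. \<Prod>b\<in>Basis. sine n b (x \<bullet> b)) has_derivative
      (\<lambda>h. \<Sum>b\<in>Basis. (h \<bullet> b) * sine_deriv n b (x \<bullet> b) * (\<Prod>j\<in>Basis - {b}. sine n j (x \<bullet> j)))) (at x)"
    by (rule has_derivative_prod)
  then show ?thesis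
    unfolding gderiv_def eig_def[abs_def] eig_grad_def eig_partial_def
    by (simp add: inner_sum_right mult_ac)
qed

lemma sine_abs_le: "\<bar>sine n b y\<bar> \<le> 1 + sqrt (2 / (l \<bullet> b))" if "b \<in> Basis"
proof -
  have "\<bar>sine n b y\<bar> \<le> sqrt (2 / (l \<bullet> b)) * 1"
    unfolding sine_def abs_mult using l_pos[OF that] by (intro mult_mono) auto
  then show ?thesis by simp
qed

lemma sqrt_nonneg: "0 \<le> sqrt (2 / (l \<bullet> b))" if "b \<in> Basis"
  using l_pos[OF that] by simp

lemma eig_abs_le: "\<bar>eig n x\<bar> \<le> eig_bound"
  unfolding eig_def eig_bound_def abs_prod by (intro prod_mono) (auto intro: sine_abs_le)

lemma eig_bound_nonneg: "0 \<le> eig_bound"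
  unfolding eig_bound_def by (intro prod_nonneg) (auto intro: add_nonneg_nonneg sqrt_nonneg)

lemma eig_partial_abs_le:
  assumes b: "b \<in> Basis"
  shows "\<bar>eig_partial n b x\<bar> \<le> freq n b * eig_bound"
proof -
  have "\<bar>sine_deriv n b (x \<bullet> b)\<bar> = sqrt (2 / (l \<bullet> b)) * (freq n b * \<bar>cos (freq n b * (x \<bullet> b))\<bar>)"
    unfolding sine_deriv_def abs_mult using freq_nonneg[OF b, of n] sqrt_nonneg[OF b] by simp
  also have "\<dots> \<le> (1 + sqrt (2 / (l \<bullet> b))) * (freq n b * 1)"
    using freq_nonneg[OF b, of n] sqrt_nonneg[OF b] by (intro mult_mono mult_left_mono) auto
  finally have 1: "\<bar>sine_deriv n b (x \<bullet> b)\<bar> \<le> (1 + sqrt (2 / (l \<bullet> b))) * freq n b" by simp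
  have 2: "(\<Prod>j\<in>Basis - {b}. \<bar>sine n j (x \<bullet> j)\<bar>) \<le> (\<Prod>j\<in>Basis - {b}. 1 + sqrt (2 / (l \<bullet> j)))"
    by (intro prod_mono) (auto intro: sine_abs_le)
  have "\<bar>eig_partial n b x\<bar> \<le> ((1 + sqrt (2 / (l \<bullet> b))) * freq n b) * (\<Prod>j\<in>Basis - {b}. 1 + sqrt (2 / (l \<bullet> j)))"
    unfolding eig_partial_def abs_mult abs_prod using 1 2 freq_nonneg[OF b, of n] sqrt_nonneg[OF b]
    by (intro mult_mono) (auto intro!: prod_nonneg)
  also have "\<dots> = freq n b * eig_bound"
    unfolding eig_bound_def using b by (simp add: prod.remove[of Basis b] mult_ac)
  finally show ?thesis .
qed

lemma eigval_nonneg: "0 \<le> eigval n"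
  by (simp add: eigval_def sum_nonneg)

text \<open>A gradient grows with the frequency, while \<open>g_bound\<close> asks for growth in the
  eigenvalue; (freq - 1)^2 >= 0 converts one into the other. The dimension counts the coordinate
  directions.\<close>

lemma norm_eig_grad_le: "norm (eig_grad n x) \<le> eig_bound * real DIM('a) * (1 + eigval n)"
proof -
  have "norm (eig_grad n x) \<le> (\<Sum>b\<in>Basis. norm (eig_partial n b x *\<^sub>R b))"
    unfolding eig_grad_def by (rule norm_sum)
  also have "\<dots> \<le> (\<Sum>b\<in>(Basis::'a set). eig_bound * (1 + eigval n))"
  proof (rule sum_mono)
    fix b :: 'a assume b: "b \<in> Basis"
    have "freq n b \<le> 1 + (freq n b)\<^sup>2"
      using zero_le_power2[of "freq n b - 1"] freq_nonneg[OF b, of n]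
      by (simp add: power2_eq_square algebra_simps)
    also have "(freq n b)\<^sup>2 \<le> eigval n"
      unfolding eigval_def using b by (intro member_le_sum) auto
    finally have "freq n b * eig_bound \<le> (1 + eigval n) * eig_bound"
      using eig_bound_nonneg by (intro mult_right_mono) auto
    then show "norm (eig_partial n b x *\<^sub>R b) \<le> eig_bound * (1 + eigval n)"
      using eig_partial_abs_le[OF b, of n x] b by (simp add: mult.commute)
  qed
  also have "\<dots> = eig_bound * real DIM('a) * (1 + eigval n)" by simp
  finally show ?thesis .
qed

section \<open>Boundary values and the eigenvalue equation\<close>

lemma freq_times_length: "b \<in> Basis \<Longrightarrow> freq n b * (l \<bullet> b) = real (n b) * pi"
  using l_pos[of b] by (simp add: freq_def)

lemma sine_boundary: "b \<in> Basis \<Longrightarrow> sine n b 0 = 0" "b \<in> Basis \<Longrightarrow> sine n b (l \<bullet> b) = 0"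
  by (simp_all add: sine_def freq_times_length)

lemma eig_frontier:
  assumes "x \<in> frontier W"
  shows "eig n x = 0"
proof -
  have "x \<in> cbox 0 l" "x \<notin> W"
    using assms W_nonempty by (auto simp: frontier_box)
  then obtain b where b: "b \<in> Basis" "x \<bullet> b = 0 \<or> x \<bullet> b = l \<bullet> b"
    by (auto simp: mem_box)
  then have "sine n b (x \<bullet> b) = 0" using sine_boundary by auto
  then show ?thesis unfolding eig_def using b(1) by (intro prod_zero) auto
qed

text \<open>All zeros lie on countably many coordinate hyperplanes. Positive indices matter: an
  index 0 would make the whole product vanish.\<close>

lemma AE_eig_nonzero:
  assumes n: "\<And>b. b \<in> Basis \<Longrightarrow> 1 \<le> n b"
  shows "AE x in lborel. x \<in> W \<longrightarrow> eig n x \<noteq> 0"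
proof -
  define Z where "Z b k = {x::'a. x \<bullet> b = of_int k * pi / freq n b}" for b and k :: int
  have "Z b k \<in> null_sets lborel" if b: "b \<in> Basis" for b k
  proof -
    have "negligible (Z b k)" unfolding Z_def using negligible_standard_hyperplane[OF b] by simp
    then have "Z b k \<in> null_sets lebesgue" by (simp add: negligible_iff_null_sets)
    moreover have "closed (Z b k)" unfolding Z_def by (intro closed_Collect_eq continuous_intros)
    ultimately show ?thesis by (simp add: null_sets_completion_iff)
  qed
  then have "(\<Union>k. Z b k) \<in> null_sets lborel" if "b \<in> Basis" for b
    using that by (intro null_sets_UN' countableI_type)
  then have "(\<Union>b\<in>Basis. \<Union>k. Z b k) \<in> null_sets lborel"
    by (intro null_sets_UN'[OF countable_finite[OF finite_Basis]])
  then have "AE x in lborel. x \<notin> (\<Union>b\<in>Basis. \<Union>k. Z b k)" by (rule AE_not_in)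
  then show ?thesis
  proof (rule AE_mp, intro AE_I2 impI)
    fix x assume x: "x \<notin> (\<Union>b\<in>Basis. \<Union>k. Z b k)"
    show "eig n x \<noteq> 0"
    proof
      assume "eig n x = 0"
      then obtain b where b: "b \<in> Basis" "sine n b (x \<bullet> b) = 0" by (auto simp: eig_def prod_zero_iff)
      then have "sin (freq n b * (x \<bullet> b)) = 0" using l_pos[OF b(1)] by (simp add: sine_def)
      then obtain k :: int where "freq n b * (x \<bullet> b) = of_int k * pi" using sin_zero_iff_int2 by blast
      moreover have "freq n b > 0" using n[OF b(1)] l_pos[OF b(1)] by (simp add: freq_def)
      ultimately have "x \<in> Z b k" by (simp add: Z_def field_simps)
      with x b show False by auto
    qed
  qed
qed

lemma H10_eig:
  assumes "\<And>b. b \<in> Basis \<Longrightarrow> 1 \<le> n b"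
  shows "H10_with_gradient W (eig n) (eig_grad n)"
  by (intro H10_vanishing_boundary open_W bounded_W GDERIV_eig continuous_eig_grad
      eig_frontier AE_eig_nonzero assms)

text \<open>Green's formula, one coordinate at a time. Boundary terms are absent because
  \<open>\<phi>\<close> has compact support, so only the identity between the second derivative of a
  sine and the sine itself is used.\<close>

lemma weak_eig_C1c:
  assumes \<phi>: "C1c_with_gradient W \<phi> g"
  shows "L2_inner W (eig_grad n) g = eigval n * L2_inner W (eig n) \<phi>"
proof -
  obtain K where K: "compact K" "K \<subseteq> W" "\<And>x. x \<notin> K \<Longrightarrow> \<phi> x = 0" "\<And>x. x \<notin> K \<Longrightarrow> g x = 0"
    using C1c_support[OF \<phi>] by blast
  have c\<phi>: "continuous_on UNIV \<phi>" by (rule C1c_continuous[OF \<phi>])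
  have cg: "continuous_on UNIV g" using \<phi> by (simp add: C1c_with_gradient_def)
  have i1: "integrable lborel (\<lambda>x. (b \<bullet> g x) * eig_partial n b x)" for b
    by (rule integrable_compact_support[OF _ K(1)])
      (auto intro!: continuous_intros cg continuous_eig_partial simp: K(4))
  have i2: "integrable lborel (\<lambda>x. \<phi> x * eig n x)"
    by (rule integrable_compact_support[OF _ K(1)])
      (auto intro!: continuous_intros c\<phi> continuous_eig simp: K(3))
  have part: "(LINT x|lborel. (b \<bullet> g x) * eig_partial n b x) = (freq n b)\<^sup>2 * (LINT x|lborel. \<phi> x * eig n x)"
    if b: "b \<in> Basis" for b
  proof -
    \<comment> \<open>This is the derivative of \<open>\<phi> x * eig_partial n b x\<close> in
      direction \<open>b\<close>; its vanishing integral is the integration by parts.\<close>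
    define D where "D x = (b \<bullet> g x) * eig_partial n b x - (freq n b)\<^sup>2 * (\<phi> x * eig n x)" for x
    have "(LINT x|lborel. D x) = 0"
    proof (rule integral_directional_derivative_eq_0[where F = "\<lambda>x. \<phi> x * eig_partial n b x" and b = b, OF _ _ K(1)])
      show "continuous_on UNIV (\<lambda>x. \<phi> x * eig_partial n b x)"
        by (intro continuous_intros c\<phi> continuous_eig_partial)
      show "continuous_on UNIV D" unfolding D_def
        by (intro continuous_intros c\<phi> cg continuous_eig_partial continuous_eig)
      show "\<phi> x * eig_partial n b x = 0" "D x = 0" if "x \<notin> K" for x
        using K(3,4)[OF that] by (auto simp: D_def)
      fix x
      have "((\<lambda>h. x + h *\<^sub>R b) has_derivative (\<lambda>h. h *\<^sub>R b)) (at 0)"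
        by (auto intro!: derivative_eq_intros)
      moreover have "(\<phi> has_derivative (\<lambda>h. h \<bullet> g x)) (at (x + 0 *\<^sub>R b))"
        using \<phi> by (simp add: C1c_with_gradient_def gderiv_def)
      ultimately have "((\<lambda>h. \<phi> (x + h *\<^sub>R b)) has_derivative (\<lambda>h. (h *\<^sub>R b) \<bullet> g x)) (at 0)"
        by (rule has_derivative_compose)
      then have d\<phi>: "((\<lambda>h. \<phi> (x + h *\<^sub>R b)) has_real_derivative b \<bullet> g x) (at 0)"
        by (simp add: has_field_derivative_def mult_commute_abs)
      define P where "P = (\<Prod>j\<in>Basis - {b}. sine n j (x \<bullet> j))"
      have eq: "eig_partial n b (x + h *\<^sub>R b) = sine_deriv n b (x \<bullet> b + h) * P" for h
      proof -
        have "(\<Prod>j\<in>Basis - {b}. sine n j ((x + h *\<^sub>R b) \<bullet> j)) = P"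
          unfolding P_def using b by (intro prod.cong) (auto simp: inner_add_left inner_Basis)
        then show ?thesis using b by (simp add: eig_partial_def inner_add_left)
      qed
      have "((\<lambda>h. sine_deriv n b (x \<bullet> b + h)) has_real_derivative - (freq n b)\<^sup>2 * sine n b (x \<bullet> b)) (at 0)"
        using DERIV_shift[of "sine_deriv n b" _ "0" "x \<bullet> b"] sine_deriv_has_derivative[of n b "x \<bullet> b"]
        by (simp add: add.commute)
      from DERIV_mult[OF d\<phi> DERIV_cmult_right[OF this, of P]]
      have "((\<lambda>h. \<phi> (x + h *\<^sub>R b) * (sine_deriv n b (x \<bullet> b + h) * P)) has_real_derivative
          (b \<bullet> g x) * (sine_deriv n b (x \<bullet> b) * P) + (- (freq n b)\<^sup>2 * sine n b (x \<bullet> b) * P) * \<phi> x) (at 0)"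
        by simp
      moreover have "eig n x = sine n b (x \<bullet> b) * P"
        unfolding eig_def P_def using b by (simp add: prod.remove)
      moreover have "eig_partial n b x = sine_deriv n b (x \<bullet> b) * P"
        using eq[of 0] by simp
      ultimately show "((\<lambda>h. \<phi> (x + h *\<^sub>R b) * eig_partial n b (x + h *\<^sub>R b)) has_real_derivative D x) (at 0)"
        unfolding eq D_def by (simp add: algebra_simps)
    qed
    then show ?thesis using i1 i2 by (simp add: D_def)
  qed
  have "L2_inner W (eig_grad n) g = (LINT x|lborel. (\<Sum>b\<in>Basis. (b \<bullet> g x) * eig_partial n b x))"
    unfolding L2_inner_def set_lebesgue_integral_def
  proof (intro Bochner_Integration.integral_cong refl)
    fix x
    show "indicator W x *\<^sub>R (eig_grad n x \<bullet> g x) = (\<Sum>b\<in>Basis. (b \<bullet> g x) * eig_partial n b x)"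
      using K(2) K(4)[of x] by (cases "x \<in> K") (auto simp: eig_grad_def inner_sum_left mult.commute)
  qed
  also have "\<dots> = (\<Sum>b\<in>Basis. (freq n b)\<^sup>2 * (LINT x|lborel. \<phi> x * eig n x))"
    using i1 by (simp add: part)
  also have "\<dots> = eigval n * (LINT x|lborel. \<phi> x * eig n x)"
    by (simp add: eigval_def sum_distrib_right)
  also have "(LINT x|lborel. \<phi> x * eig n x) = L2_inner W (eig n) \<phi>"
    unfolding L2_inner_def set_lebesgue_integral_def
  proof (intro Bochner_Integration.integral_cong refl)
    fix x
    show "\<phi> x * eig n x = indicator W x *\<^sub>R (eig n x \<bullet> \<phi> x)"
      using K(2) K(3)[of x] by (cases "x \<in> K") auto
  qed
  finally show ?thesis .
qed

lemma eig_L2: "eig n \<in> L2_on W" "eig_grad n \<in> L2_on W"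
proof -
  show "eig n \<in> L2_on W"
    by (rule L2_on_bounded(1)[OF _ finite_W, of _ eig_bound])
      (auto intro!: set_borel_continuous continuous_eig eig_abs_le)
  show "eig_grad n \<in> L2_on W"
    by (rule L2_on_bounded(1)[OF _ finite_W _ norm_eig_grad_le])
      (auto intro!: set_borel_continuous continuous_eig_grad)
qed

text \<open>Both sides are L^2 continuous in the pair of function and gradient, so the identity
  passes from test functions to their closure.\<close>

lemma weak_eig:
  assumes w: "H10_with_gradient W w H"
  shows "L2_inner W (eig_grad n) H = eigval n * L2_inner W (eig n) w"
proof -
  obtain \<phi> g where c: "\<And>k::nat. C1c_with_gradient W (\<phi> k) (g k)"
    and l: "(\<lambda>k. L2_norm_on W (\<lambda>x. \<phi> k x - w x)) \<longlonglongrightarrow> 0"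
      "(\<lambda>k. L2_norm_on W (\<lambda>x. g k x - H x)) \<longlonglongrightarrow> 0"
    using w unfolding H10_with_gradient_def by blast
  note L = C1c_L2[OF open_W c] H10_D[OF w]
  have "(\<lambda>k. L2_inner W (g k) (eig_grad n)) \<longlonglongrightarrow> L2_inner W H (eig_grad n)"
    by (intro tendsto_L2_inner L eig_L2 l)
  moreover have "(\<lambda>k. eigval n * L2_inner W (\<phi> k) (eig n)) \<longlonglongrightarrow> eigval n * L2_inner W w (eig n)"
    by (intro tendsto_mult_left tendsto_L2_inner L eig_L2 l)
  moreover have "L2_inner W (g k) (eig_grad n) = eigval n * L2_inner W (\<phi> k) (eig n)" for k
    using weak_eig_C1c[OF c, of n k] by (simp only: L2_inner_commute[of _ "g k"] L2_inner_commute[of _ "\<phi> k"])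
  ultimately have "L2_inner W H (eig_grad n) = eigval n * L2_inner W w (eig n)"
    by (simp only:) (rule LIMSEQ_unique)
  then show ?thesis by (simp only: L2_inner_commute[of _ "eig_grad n"] L2_inner_commute[of _ "eig n"])
qed

section \<open>Orthonormality and multi-indices\<close>

lemma orthonormal_eig:
  assumes n: "\<And>b. b \<in> Basis \<Longrightarrow> 1 \<le> n b" and m: "\<And>b. b \<in> Basis \<Longrightarrow> 1 \<le> m b"
  shows "L2_inner W (eig n) (eig m) = (if \<forall>b\<in>Basis. n b = m b then 1 else 0)"
proof -
  let ?f = "\<lambda>b y. indicator {0<..<l \<bullet> b} y *\<^sub>R (sine n b y * sine m b y)"
  have "L2_inner W (eig n) (eig m) = (LINT x|lborel. (\<Prod>b\<in>Basis. ?f b (x \<bullet> b)))"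
    unfolding L2_inner_def set_lebesgue_integral_def
  proof (intro Bochner_Integration.integral_cong refl)
    fix x
    show "indicator W x *\<^sub>R (eig n x \<bullet> eig m x) = (\<Prod>b\<in>Basis. ?f b (x \<bullet> b))"
    proof (cases "x \<in> W")
      case True
      then show ?thesis by (auto simp: eig_def mem_box prod.distrib[symmetric] intro!: prod.cong)
    next
      case False
      then obtain b where "b \<in> Basis" "x \<bullet> b \<notin> {0<..<l \<bullet> b}" by (auto simp: mem_box)
      then have "(\<Prod>b\<in>Basis. ?f b (x \<bullet> b)) = 0"
        by (intro prod_zero finite_Basis bexI[of _ b]) simp_all
      with False show ?thesis by simp
    qed
  qed
  also have "\<dots> = (\<Prod>b\<in>Basis. LINT y|lborel. ?f b y)"
  proof (rule lborel_integral_prod)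
    fix b :: 'a assume "b \<in> Basis"
    have "set_integrable lborel {0..l \<bullet> b} (\<lambda>y. sine n b y * sine m b y)"
      by (intro borel_integrable_atLeastAtMost' continuous_intros continuous_sine)
    then have "set_integrable lborel {0<..<l \<bullet> b} (\<lambda>y. sine n b y * sine m b y)"
      by (rule set_integrable_subset) auto
    then show "integrable lborel (?f b)" by (simp only: set_integrable_def)
  qed
  also have "\<dots> = (\<Prod>b\<in>Basis. if n b = m b then 1 else 0)"
  proof (rule prod.cong[OF refl])
    fix b :: 'a assume b: "b \<in> Basis"
    have "sine n b y * sine m b y = 2 / (l \<bullet> b) * (sin (real (n b) * pi / (l \<bullet> b) * y) * sin (real (m b) * pi / (l \<bullet> b) * y))" for y
    proof -
      have "(s * u) * (s * v) = (s * s) * (u * v)" for s u v :: real by simp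
      moreover have "sqrt (2 / (l \<bullet> b)) * sqrt (2 / (l \<bullet> b)) = 2 / (l \<bullet> b)"
        using l_pos[OF b] by simp
      ultimately show ?thesis unfolding sine_def freq_def by metis
    qed
    then have "(LINT y|lborel. ?f b y) =
        2 / (l \<bullet> b) * (LINT y:{0<..<l \<bullet> b}|lborel. sin (real (n b) * pi / (l \<bullet> b) * y) * sin (real (m b) * pi / (l \<bullet> b) * y))"
      unfolding set_integral_mult_right[symmetric] by (simp only: set_lebesgue_integral_def)
    also have "\<dots> = (if n b = m b then 1 else 0)"
      using l_pos[OF b] by (simp only: integral_sin_sin[OF l_pos[OF b] n[OF b] m[OF b]]) simp
    finally show "(LINT y|lborel. ?f b y) = (if n b = m b then 1 else 0)" .
  qed
  also have "\<dots> = (if \<forall>b\<in>Basis. n b = m b then 1 else 0)" by auto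
  finally show ?thesis .
qed

text \<open>Extensional functions make a multi-index determined by its values on
  \<open>Basis\<close>, so that distinct indices belong to orthogonal eigenfunctions.\<close>

definition modes :: "('a \<Rightarrow> nat) set" where
  "modes = Basis \<rightarrow>\<^sub>E {1..}"

section \<open>Density of the span of the eigenfunctions\<close>

abbreviation eig_span :: "('a \<Rightarrow> real) set" where
  "eig_span \<equiv> lin_span (eig ` modes)"

lemma modesD: "n \<in> modes \<Longrightarrow> b \<in> Basis \<Longrightarrow> 1 \<le> n b"
  by (auto simp: modes_def PiE_iff)

lemma eig_cong: "(\<And>b. b \<in> Basis \<Longrightarrow> n b = m b) \<Longrightarrow> eig n = eig m"
  by (auto simp: eig_def sine_def freq_def fun_eq_iff intro!: prod.cong)

lemma eig_in_span: "eig n \<in> eig_span"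
proof (cases "\<forall>b\<in>Basis. 1 \<le> n b")
  case True
  then have "restrict n Basis \<in> modes" by (auto simp: modes_def)
  moreover have "eig n = eig (restrict n Basis)" by (rule eig_cong) simp
  ultimately show ?thesis by (simp add: lin_span_incl)
next
  case False
  then obtain b where "b \<in> Basis" "n b = 0" by auto
  then have "eig n = (\<lambda>x. 0)"
    by (auto simp: eig_def sine_def freq_def fun_eq_iff intro!: prod_zero bexI[of _ b])
  then show ?thesis by (simp add: lin_span.zero)
qed

text \<open>The addition formula for sin in the coordinate \<open>b\<close>: the cosine shifts the
  frequency up and down by one step. The hypothesis \<open>1 \<le> n b\<close> makes the
  natural-number subtraction genuine.\<close>

lemma eig_mult_cos:
  assumes b: "b \<in> Basis" and n: "1 \<le> n b"
  shows "eig n x * cos (pi / (l \<bullet> b) * (x \<bullet> b)) =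
    1 / 2 * eig (n(b := n b + 1)) x + 1 / 2 * eig (n(b := n b - 1)) x"
proof -
  define P where "P = (\<Prod>j\<in>Basis - {b}. sine n j (x \<bullet> j))"
  define v where "v = pi / (l \<bullet> b) * (x \<bullet> b)"
  have split: "eig (n(b := k)) x = sqrt (2 / (l \<bullet> b)) * sin (real k * v) * P" for k
  proof -
    have "(\<Prod>j\<in>Basis - {b}. sine (n(b := k)) j (x \<bullet> j)) = P"
      unfolding P_def by (intro prod.cong) (auto simp: sine_def freq_def)
    moreover have "sine (n(b := k)) b (x \<bullet> b) = sqrt (2 / (l \<bullet> b)) * sin (real k * v)"
      by (simp add: sine_def freq_def v_def mult.assoc)
    ultimately show ?thesis
      unfolding eig_def using b by (simp add: prod.remove[of Basis b])
  qed
  have "2 * (sin (real (n b) * v) * cos v) = sin (real (n b + 1) * v) + sin (real (n b - 1) * v)"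
    using n by (simp add: of_nat_diff algebra_simps sin_add sin_diff)
  then have "sqrt (2 / (l \<bullet> b)) * P * (2 * (sin (real (n b) * v) * cos v)) =
      sqrt (2 / (l \<bullet> b)) * P * (sin (real (n b + 1) * v) + sin (real (n b - 1) * v))" by (simp only:)
  moreover have "eig n x = sqrt (2 / (l \<bullet> b)) * sin (real (n b) * v) * P"
    using split[of "n b"] by simp
  ultimately show ?thesis
    unfolding split v_def[symmetric] by (simp only: distrib_left) (simp add: algebra_simps)
qed

lemma span_mult_cos:
  assumes b: "b \<in> Basis" and w: "w \<in> eig_span"
  shows "(\<lambda>x. w x * cos (pi / (l \<bullet> b) * (x \<bullet> b))) \<in> eig_span"
  using w
proof (induction rule: lin_span.induct)
  case zero
  then show ?case by (simp add: lin_span.zero)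
next
  case (step w e c)
  then obtain n where n: "n \<in> modes" "e = eig n" by auto
  have "(\<lambda>x. e x * cos (pi / (l \<bullet> b) * (x \<bullet> b))) =
      (\<lambda>x. 1 / 2 * eig (n(b := n b + 1)) x + 1 / 2 * eig (n(b := n b - 1)) x)"
    using eig_mult_cos[of b n] modesD[OF n(1) b] b by (simp only: n(2))
  also have "\<dots> \<in> eig_span"
    by (rule lin_span_add) (rule lin_span_mult, rule eig_in_span)+
  finally have "(\<lambda>x. c * (e x * cos (pi / (l \<bullet> b) * (x \<bullet> b)))) \<in> eig_span"
    by (rule lin_span_mult)
  from lin_span_add[OF this step.IH] show ?case by (simp add: algebra_simps)
qed

text \<open>
  The multipliers of the span of the eigenfunctions form an algebra containing the separating
  functions \<open>cos (pi x\<^sub>b / l\<^sub>b)\<close>, so by Stone-Weierstrass they are uniformly dense; dividing by the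
  lowest eigenfunction, which is positive in \<open>W\<close>, gives density of the span.
\<close>

definition multipliers :: "('a \<Rightarrow> real) set" where
  "multipliers = {r. continuous_on (cbox 0 l) r \<and>
     (\<forall>w\<in>eig_span. (\<lambda>x. w x * r x) \<in> eig_span)}"

text \<open>Two distinct points differ in some coordinate. On the closed box the rescaled coordinate
  stays in [0, pi], where cos is injective, so the corresponding cosine separates them.\<close>

lemma function_ring_multipliers: "function_ring_on multipliers (cbox 0 l)"
proof
  show "compact (cbox 0 l)" by (rule compact_cbox)
  show "continuous_on (cbox 0 l) f" if "f \<in> multipliers" for f
    using that by (simp add: multipliers_def)
  show "(\<lambda>x. f x + g x) \<in> multipliers" if "f \<in> multipliers" "g \<in> multipliers" for f g
    using that unfolding multipliers_def
    by (auto intro!: continuous_intros lin_span_add simp: distrib_left)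
  show "(\<lambda>x. f x * g x) \<in> multipliers" if "f \<in> multipliers" "g \<in> multipliers" for f g
  proof -
    have "(\<lambda>x. w x * (f x * g x)) \<in> eig_span" if "w \<in> eig_span" for w
    proof -
      have "(\<lambda>x. (w x * f x) * g x) \<in> eig_span"
        using \<open>f \<in> multipliers\<close> \<open>g \<in> multipliers\<close> that by (auto simp: multipliers_def)
      then show ?thesis by (simp add: mult.assoc)
    qed
    with that show ?thesis unfolding multipliers_def by (auto intro!: continuous_intros)
  qed
  show "(\<lambda>_. c) \<in> multipliers" for c
    unfolding multipliers_def by (auto simp: mult.commute[of _ c] lin_span_mult)
  show "\<exists>f\<in>multipliers. f x \<noteq> f y" if x: "x \<in> cbox 0 l" and y: "y \<in> cbox 0 l" and "x \<noteq> y" for x y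
  proof -
    obtain b where b: "b \<in> Basis" "x \<bullet> b \<noteq> y \<bullet> b" using \<open>x \<noteq> y\<close> euclidean_eqI by blast
    define c where "c = (\<lambda>x. cos (pi / (l \<bullet> b) * (x \<bullet> b)))"
    have "c \<in> multipliers"
      unfolding multipliers_def mem_Collect_eq c_def
      by (intro conjI ballI continuous_intros span_mult_cos b(1)) (use l_pos[OF b(1)] in auto)
    moreover have "c x \<noteq> c y"
    proof
      assume eq: "c x = c y"
      have lb: "l \<bullet> b > 0" using l_pos b by simp
      have r: "0 \<le> pi / (l \<bullet> b) * (z \<bullet> b) \<and> pi / (l \<bullet> b) * (z \<bullet> b) \<le> pi" if "z \<in> cbox 0 l" for z
      proof -
        have "0 \<le> z \<bullet> b" "z \<bullet> b \<le> l \<bullet> b" using that b by (auto simp: mem_box)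
        then show ?thesis using lb by (simp add: field_simps)
      qed
      have "pi / (l \<bullet> b) * (x \<bullet> b) = pi / (l \<bullet> b) * (y \<bullet> b)"
        using r[OF x] r[OF y] eq[unfolded c_def] by (metis cos_inj_pi)
      with b lb show False by simp
    qed
    ultimately show ?thesis by blast
  qed
qed

lemma eig_lowest_pos:
  assumes "x \<in> W"
  shows "0 < eig (\<lambda>_. 1) x"
  unfolding eig_def
proof (rule prod_pos)
  fix b :: 'a assume b: "b \<in> Basis"
  have "0 < x \<bullet> b" "x \<bullet> b < l \<bullet> b" using assms b by (auto simp: mem_box)
  then have "0 < pi / (l \<bullet> b) * (x \<bullet> b)" "pi / (l \<bullet> b) * (x \<bullet> b) < pi" by (auto simp: field_simps)
  then have "0 < sin (pi / (l \<bullet> b) * (x \<bullet> b))" by (rule sin_gt_zero)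
  then show "0 < sine (\<lambda>_. 1) b (x \<bullet> b)" using l_pos[OF b] by (simp add: sine_def freq_def)
qed

lemma span_uniformly_dense:
  assumes \<phi>: "Cc_on W \<phi>" and r: "r > 0"
  shows "\<exists>w\<in>eig_span. \<forall>x\<in>W. \<bar>\<phi> x - w x\<bar> \<le> r"
proof -
  let ?s = "eig (\<lambda>_. 1)"
  obtain K where K: "compact K" "K \<subseteq> W" "\<And>x. x \<notin> K \<Longrightarrow> \<phi> x = 0" and c: "continuous_on UNIV \<phi>"
    using \<phi> by (auto simp: Cc_on_def)
  obtain m where m: "m > 0" "\<And>x. x \<in> K \<Longrightarrow> m \<le> ?s x"
  proof (cases "K = {}")
    case True
    then show ?thesis using that[of 1] by auto
  next
    case False
    obtain x where x: "x \<in> K" "\<And>y. y \<in> K \<Longrightarrow> ?s x \<le> ?s y"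
      using continuous_attains_inf[OF K(1) False continuous_on_subset[OF continuous_eig]] by blast
    with K(2) that[of "?s x"] eig_lowest_pos show ?thesis by auto
  qed
  \<comment> \<open>The lowest eigenfunction tends to 0 at the boundary, so the divisor is kept
    above \<open>m\<close>. On \<open>K\<close> this changes nothing, and off \<open>K\<close> the
    numerator is 0; hence multiplying back recovers \<open>\<phi>\<close> exactly.\<close>
  define \<psi> where "\<psi> x = \<phi> x / max m (?s x)" for x
  have mpos: "max m (?s x) \<noteq> 0" for x using m(1) by linarith
  have "continuous_on (cbox 0 l) \<psi>"
    unfolding \<psi>_def using mpos
    by (intro continuous_intros continuous_on_subset[OF c] continuous_on_subset[OF continuous_eig]) auto
  moreover have "r / (eig_bound + 1) > 0" using r eig_bound_nonneg by simp
  ultimately obtain p where p: "p \<in> multipliers" "\<And>x. x \<in> cbox 0 l \<Longrightarrow> \<bar>\<psi> x - p x\<bar> < r / (eig_bound + 1)"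
    using function_ring_on.Stone_Weierstrass_basic[OF function_ring_multipliers] by blast
  have "\<bar>\<phi> x - ?s x * p x\<bar> \<le> r" if x: "x \<in> W" for x
  proof -
    have "?s x * \<psi> x = \<phi> x"
    proof (cases "x \<in> K")
      case True
      then have "max m (?s x) = ?s x" using m(2) by simp
      then show ?thesis using mpos[of x] by (simp add: \<psi>_def)
    next
      case False
      then show ?thesis by (simp add: \<psi>_def K(3))
    qed
    then have "\<bar>\<phi> x - ?s x * p x\<bar> = \<bar>?s x\<bar> * \<bar>\<psi> x - p x\<bar>"
      by (simp add: right_diff_distrib flip: abs_mult)
    also have "\<dots> \<le> (eig_bound + 1) * (r / (eig_bound + 1))"
      using p(2)[of x] x box_subset_cbox[of 0 l] eig_abs_le[of "\<lambda>_. 1" x] eig_bound_nonneg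
      by (intro mult_mono) (auto intro: less_imp_le)
    also have "\<dots> = r" using eig_bound_nonneg by simp
    finally show ?thesis .
  qed
  moreover have "(\<lambda>x. ?s x * p x) \<in> eig_span"
    using p(1) eig_in_span by (auto simp: multipliers_def)
  ultimately show ?thesis by (intro bexI[of _ "\<lambda>x. ?s x * p x"]) auto
qed

lemma lin_span_eig_L2: "w \<in> eig_span \<Longrightarrow> w \<in> L2_on W \<and> continuous_on UNIV w"
  by (induction rule: lin_span.induct)
    (auto intro!: L2_on_zero L2_on_add L2_on_mult eig_L2 continuous_intros continuous_eig)

lemma span_dense:
  assumes f: "f \<in> L2_on W" and r: "r > 0"
  shows "\<exists>w\<in>eig_span. L2_norm_on W (\<lambda>x. f x - w x) < r"
proof -
  obtain \<phi> where \<phi>: "Cc_on W \<phi>" "L2_norm_on W (\<lambda>x. f x - \<phi> x) < r / 2"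
    using L2_dense_Cc[OF open_W bounded_W f, of "r / 2"] r by auto
  define m where "m = sqrt (measure lborel W) + 1"
  have m: "m > 0" "sqrt (measure lborel W) \<le> m" by (auto simp: m_def add_nonneg_pos)
  obtain w where w: "w \<in> eig_span" "\<And>x. x \<in> W \<Longrightarrow> \<bar>\<phi> x - w x\<bar> \<le> r / (2 * m)"
    using span_uniformly_dense[OF \<phi>(1), of "r / (2 * m)"] r m by auto
  have \<phi>c: "continuous_on UNIV \<phi>" using \<phi>(1) by (simp add: Cc_on_def)
  have "L2_norm_on W (\<lambda>x. \<phi> x - w x) \<le> r / (2 * m) * sqrt (measure lborel W)"
    using r m w(2) lin_span_eig_L2[OF w(1)]
    by (intro L2_on_bounded(2)[OF _ finite_W] set_borel_continuous continuous_intros \<phi>c) auto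
  also have "\<dots> \<le> r / (2 * m) * m" using r m by (intro mult_left_mono) auto
  also have "\<dots> = r / 2" using m by simp
  finally have "L2_norm_on W (\<lambda>x. \<phi> x - w x) \<le> r / 2" .
  moreover have "L2_norm_on W (\<lambda>x. f x - w x) \<le> L2_norm_on W (\<lambda>x. f x - \<phi> x) + L2_norm_on W (\<lambda>x. \<phi> x - w x)"
    using lin_span_eig_L2[OF w(1)] Cc_on_L2[OF open_W bounded_W \<phi>(1)]
    by (intro L2_norm_on_triangle_diff f) auto
  ultimately show ?thesis using w(1) \<phi>(2) by (intro bexI[of _ w]) auto
qed

section \<open>The heat trace of the box and its one-dimensional factors\<close>

definition theta :: "'a \<Rightarrow> real \<Rightarrow> real" where
  "theta b t = (\<Sum>k. exp (- (t * (pi / (l \<bullet> b))\<^sup>2 * (real (Suc k))\<^sup>2)))"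

text \<open>The exponential of a sum over coordinates factors, and absolutely summable series
  multiply into an unordered sum over multi-indices. Each factor \<open>theta b t\<close> is the
  heat trace of an interval of length \<open>l \<bullet> b\<close>: a Jacobi theta series restricted
  to positive indices.\<close>

lemma has_sum_modes:
  assumes t: "t > 0"
  shows "((\<lambda>n. exp (- t * eigval n)) has_sum (\<Prod>b\<in>Basis. theta b t)) modes"
proof -
  define f where "f b k = exp (- (t * (pi / (l \<bullet> b))\<^sup>2 * (real k)\<^sup>2))" for b :: 'a and k :: nat
  have hs: "(f b has_sum theta b t) {1..}" if b: "b \<in> Basis" for b
  proof -
    have "t * (pi / (l \<bullet> b))\<^sup>2 > 0" using t l_pos[OF b] by simp
    from summable_gaussian[OF this] have s: "summable (\<lambda>k. f b (Suc k))" by (simp only: f_def)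
    then have "((\<lambda>k. f b (Suc k)) has_sum theta b t) UNIV"
      by (intro norm_summable_imp_has_sum) (auto simp: f_def theta_def summable_sums)
    moreover have "bij_betw Suc UNIV {1..}"
      by (auto simp: bij_betw_def image_def Suc_le_eq gr0_conv_Suc)
    ultimately show ?thesis using has_sum_reindex_bij_betw by blast
  qed
  have pos: "theta b t > 0" if b: "b \<in> Basis" for b
  proof -
    have "t * (pi / (l \<bullet> b))\<^sup>2 > 0" using t l_pos[OF b] by simp
    from suminf_pos[OF summable_gaussian[OF this]] show ?thesis by (simp add: theta_def)
  qed
  have abs: "(\<lambda>k. norm (f b k)) summable_on {1..}" if "b \<in> Basis" for b
  proof -
    have "(\<lambda>k. norm (f b k)) = f b" by (simp add: f_def fun_eq_iff)
    then show ?thesis using hs[OF that] has_sum_imp_summable by metis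
  qed
  have "infsum (\<lambda>n. \<Prod>b\<in>Basis. f b (n b)) modes = (\<Prod>b\<in>Basis. infsum (f b) {1..})"
    unfolding modes_def by (intro infsum_prod_PiE_abs abs) auto
  also have "\<dots> = (\<Prod>b\<in>Basis. theta b t)"
    by (intro prod.cong refl infsumI hs)
  finally have eq: "infsum (\<lambda>n. \<Prod>b\<in>Basis. f b (n b)) modes = (\<Prod>b\<in>Basis. theta b t)" .
  \<comment> \<open>A non-summable family would have \<open>infsum\<close> equal to 0.\<close>
  have "(\<Prod>b\<in>Basis. theta b t) \<noteq> 0" using pos by (force simp: prod_zero_iff)
  then have "(\<lambda>n. \<Prod>b\<in>Basis. f b (n b)) summable_on modes"
    using eq infsum_not_exists by metis
  then have "((\<lambda>n. \<Prod>b\<in>Basis. f b (n b)) has_sum (\<Prod>b\<in>Basis. theta b t)) modes"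
    using has_sum_infsum eq by metis
  moreover have "(\<Prod>b\<in>Basis. f b (n b)) = exp (- t * eigval n)" for n
    unfolding f_def eigval_def freq_def
    by (simp add: exp_sum[symmetric] sum_negf sum_distrib_left power_mult_distrib power_divide mult_ac)
  ultimately show ?thesis by simp
qed

text \<open>The eigenbasis is indexed by \<open>nat\<close>, so an enumeration is needed; constant
  multi-indices show that there are infinitely many. The order of enumeration is harmless because
  the trace is an unordered sum.\<close>

lemma bij_betw_modes: "bij_betw (from_nat_into modes) UNIV modes"
proof (rule bij_betw_from_nat_into)
  show "countable modes" unfolding modes_def by (intro countable_PiE) auto
  have inj: "inj (\<lambda>k. \<lambda>b\<in>(Basis::'a set). Suc k)"
  proof
    fix j k assume "(\<lambda>b\<in>(Basis::'a set). Suc j) = (\<lambda>b\<in>Basis. Suc k)"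
    then have "(\<lambda>b\<in>(Basis::'a set). Suc j) (SOME b. b \<in> Basis) = (\<lambda>b\<in>(Basis::'a set). Suc k) (SOME b. b \<in> Basis)"
      by (rule fun_cong)
    then show "j = k" by (simp add: SOME_Basis)
  qed
  moreover have "range (\<lambda>k. \<lambda>b\<in>(Basis::'a set). Suc k) \<subseteq> modes"
    by (auto simp: modes_def)
  ultimately show "infinite modes"
    using finite_subset range_inj_infinite by blast
qed

lemma dirichlet_partition_function_box:
  assumes t: "t > 0"
  shows "dirichlet_partition_function W t = (\<Prod>b\<in>Basis. theta b t)"
proof -
  define N where "N = from_nat_into modes"
  have N: "N k \<in> modes" for k using bij_betw_modes by (auto simp: N_def bij_betw_def)
  have rangeN: "range N = modes" using bij_betw_modes by (simp add: N_def bij_betw_def)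
  have injN: "inj N" using bij_betw_modes by (simp add: N_def bij_betw_def)
  have sums: "(\<lambda>k. exp (- t * eigval (N k))) sums (\<Prod>b\<in>Basis. theta b t)" if "t > 0" for t
    using has_sum_modes[OF that] has_sum_reindex_bij_betw[OF bij_betw_modes, of "\<lambda>n. exp (- t * eigval n)"]
    by (intro has_sum_imp_sums) (simp add: N_def)
  \<comment> \<open>The constant comes from \<open>norm_eig_grad_le\<close>; as the dimension is at
    least 1, it also bounds the eigenfunctions.\<close>
  interpret dirichlet_eigenbasis W "\<lambda>k. eig (N k)" "\<lambda>k. eig_grad (N k)" "\<lambda>k. eigval (N k)"
    "eig_bound * real DIM('a)"
  proof
    show "\<bar>eig (N k) x\<bar> \<le> eig_bound * real DIM('a)" for k x
    proof -
      have "eig_bound * 1 \<le> eig_bound * real DIM('a)"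
        using eig_bound_nonneg DIM_positive[where 'a = 'a] by (intro mult_left_mono) auto
      with eig_abs_le[of "N k" x] show ?thesis by simp
    qed
    show "L2_inner W (eig (N j)) (eig (N k)) = (if j = k then 1 else 0)" for j k
    proof -
      have "(\<forall>b\<in>Basis. N j b = N k b) \<longleftrightarrow> j = k"
        using N[of j] N[of k] injN PiE_ext[of "N j" Basis _ "N k"] unfolding modes_def
        by (metis injD)
      then show ?thesis using orthonormal_eig[of "N j" "N k"] modesD[OF N] by simp
    qed
    show "\<exists>w\<in>lin_span (range (\<lambda>k. eig (N k))). L2_norm_on W (\<lambda>x. f x - w x) < r"
      if "f \<in> L2_on W" "r > 0" for f r
    proof -
      have "range (\<lambda>k. eig (N k)) = eig ` modes" unfolding rangeN[symmetric] by (simp add: image_image)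
      then show ?thesis using span_dense[OF that] by simp
    qed
    show "emeasure lborel W < \<infinity>" by (rule finite_W)
  qed (use sums modesD[OF N] in \<open>auto intro!: open_W continuous_eig continuous_eig_grad norm_eig_grad_le H10_eig weak_eig
      eigval_nonneg sums_summable\<close>)
  show ?thesis
    using sums_unique2[OF dirichlet_partition_function_eq[OF t] sums[OF t]] .
qed

text \<open>The Gaussian sum at s = t q, with q = (pi / (l \<bullet> b))^2, has error C t^(3/2).
  Dividing by \<open>t\<close> still leaves C sqrt t, the margin needed against the product of the
  other two factors.\<close>

lemma theta_asymptotics:
  assumes b: "b \<in> Basis"
  shows "((\<lambda>t. (theta b t - ((l \<bullet> b) / (2 * sqrt (pi * t)) - 1 / 2)) / t) \<longlongrightarrow> 0) (at_right 0)"
proof (rule Lim_null_comparison)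
  define q where "q = (pi / (l \<bullet> b))\<^sup>2"
  define C where "C = q\<^sup>2 * sqrt (2 * pi / q) / 6"
  have q: "q > 0" using l_pos[OF b] by (simp add: q_def)
  have "norm ((theta b t - ((l \<bullet> b) / (2 * sqrt (pi * t)) - 1 / 2)) / t) \<le> C * sqrt t" if t: "t > 0" for t
  proof -
    have "pi / (t * q) = ((l \<bullet> b) / sqrt (pi * t))\<^sup>2"
      using t l_pos[OF b] by (simp add: q_def power_divide power2_eq_square field_simps)
    then have "sqrt (pi / (t * q)) = (l \<bullet> b) / sqrt (pi * t)"
      using t l_pos[OF b] by simp
    then have "\<bar>theta b t - ((l \<bullet> b) / (2 * sqrt (pi * t)) - 1 / 2)\<bar> \<le> (t * q)\<^sup>2 * sqrt (pi / (t * q / 2)) / 6"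
      using gaussian_sum_approx[of "t * q"] t q by (simp add: theta_def q_def mult_ac)
    also have "sqrt (pi / (t * q / 2)) = sqrt (2 * pi / q) / sqrt t"
      by (simp add: real_sqrt_divide[symmetric] mult_ac)
    also have "(t * q)\<^sup>2 * (sqrt (2 * pi / q) / sqrt t) / 6 = t * (C * (t / sqrt t))"
      by (simp add: C_def power_mult_distrib power2_eq_square mult_ac)
    also have "t / sqrt t = sqrt t" using t by (simp add: real_div_sqrt)
    finally show ?thesis using t by (simp add: field_simps)
  qed
  then show "\<forall>\<^sub>F t in at_right 0. norm ((theta b t - ((l \<bullet> b) / (2 * sqrt (pi * t)) - 1 / 2)) / t) \<le> C * sqrt t"
    by (auto simp: eventually_at_right_field intro!: exI[of _ 1])
  have "((\<lambda>t. C * sqrt t) \<longlongrightarrow> C * sqrt 0) (at_right 0)" by (intro tendsto_intros)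
  then show "((\<lambda>t. C * sqrt t) \<longlongrightarrow> 0) (at_right 0)" by simp
qed

end

section \<open>Multiplying three one-dimensional asymptotics\<close>

lemma tendsto_prod3_diff:
  fixes X Y Z X' Y' Z' :: "real \<Rightarrow> real"
  assumes r: "((\<lambda>t. (X t - X' t) / t) \<longlongrightarrow> 0) (at_right 0)" "((\<lambda>t. (Y t - Y' t) / t) \<longlongrightarrow> 0) (at_right 0)"
      "((\<lambda>t. (Z t - Z' t) / t) \<longlongrightarrow> 0) (at_right 0)"
    and x: "((\<lambda>t. sqrt t * X' t) \<longlongrightarrow> A) (at_right 0)" and y: "((\<lambda>t. sqrt t * Y' t) \<longlongrightarrow> B) (at_right 0)"
    and z: "((\<lambda>t. sqrt t * Z' t) \<longlongrightarrow> C) (at_right 0)"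
  shows "((\<lambda>t. X t * Y t * Z t - X' t * Y' t * Z' t) \<longlongrightarrow> 0) (at_right 0)"
proof -
  \<comment> \<open>A factor inherits growth of order 1 / sqrt t from its model, because the two
    differ by o(t).\<close>
  have full: "((\<lambda>t. sqrt t * V t) \<longlongrightarrow> D) (at_right 0)"
    if "((\<lambda>t. (V t - V' t) / t) \<longlongrightarrow> 0) (at_right 0)" "((\<lambda>t. sqrt t * V' t) \<longlongrightarrow> D) (at_right 0)" for V V' D
  proof -
    have "((\<lambda>t. sqrt t * V' t + sqrt t * t * ((V t - V' t) / t)) \<longlongrightarrow> D + sqrt 0 * 0 * 0) (at_right 0)"
      by (intro tendsto_intros that)
    moreover have "\<forall>\<^sub>F t in at_right 0. sqrt t * V' t + sqrt t * t * ((V t - V' t) / t) = sqrt t * V t"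
    proof -
      have "sqrt t * V' t + sqrt t * t * ((V t - V' t) / t) = sqrt t * V t" if "t > 0" for t
      proof -
        have "sqrt t * t * ((V t - V' t) / t) = sqrt t * (V t - V' t)" using that by simp
        then show ?thesis by (simp add: right_diff_distrib)
      qed
      then show ?thesis by (auto simp: eventually_at_right_field intro!: exI[of _ 1])
    qed
    ultimately show ?thesis by (simp add: tendsto_cong)
  qed
  \<comment> \<open>The telescoping XYZ - X'Y'Z' = (X - X')YZ + X'(Y - Y')Z + X'Y'(Z - Z'). The 1 /
    t in each difference is balanced by the two square roots, so every term is o(1) times bounded
    factors.\<close>
  let ?E = "\<lambda>t. (X t - X' t) / t * (sqrt t * Y t) * (sqrt t * Z t) + (Y t - Y' t) / t * (sqrt t * X' t) * (sqrt t * Z t)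
      + (Z t - Z' t) / t * (sqrt t * X' t) * (sqrt t * Y' t)"
  note Y = full[OF r(2) y] and Z = full[OF r(3) z]
  have "((\<lambda>t. ?E t) \<longlongrightarrow> 0 * B * C + 0 * A * C + 0 * A * B) (at_right 0)"
    by (intro tendsto_intros r x y Y Z)
  moreover have "\<forall>\<^sub>F t in at_right 0. ?E t = X t * Y t * Z t - X' t * Y' t * Z' t"
  proof -
    have "?E t = X t * Y t * Z t - X' t * Y' t * Z' t" if t: "t > 0" for t
    proof -
      have p: "u / t * (sqrt t * v) * (sqrt t * w) = u * v * w" for u v w
      proof -
        have "u / t * (sqrt t * v) * (sqrt t * w) = (sqrt t * sqrt t) / t * (u * v * w)" by simp
        also have "(sqrt t * sqrt t) / t = 1" using t by simp
        finally show ?thesis by simp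
      qed
      show ?thesis unfolding p by (simp add: algebra_simps)
    qed
    then show ?thesis by (auto simp: eventually_at_right_field intro!: exI[of _ 1])
  qed
  ultimately show ?thesis by (simp add: tendsto_cong)
qed

lemma prod_Basis_3: "(\<Prod>b\<in>(Basis :: (real ^ 3) set). f b) = f (axis 1 1) * f (axis 2 1) * f (axis 3 1)"
proof -
  have B: "(Basis :: (real ^ 3) set) = range (\<lambda>i. axis i 1)" by (auto simp: Basis_vec_def)
  have inj: "inj (\<lambda>i::3. axis i (1::real))" by (auto simp: inj_def axis_eq_axis)
  have "(\<Prod>b\<in>(Basis :: (real ^ 3) set). f b) = (\<Prod>i\<in>(UNIV :: 3 set). f (axis i 1))"
    unfolding B prod.reindex[OF inj] by simp
  also have "\<dots> = f (axis 1 1) * f (axis 2 1) * f (axis 3 1)"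
    unfolding UNIV_3 by (simp add: mult.assoc)
  finally show ?thesis .
qed

theorem mainTheorem10:
  fixes a b c :: real and \<Omega> :: "(real ^ 3) set"
  assumes "a > 0" and "b > 0" and "c > 0"
    and "\<Omega> = {x. x $ 1 \<in> {0<..<a} \<and> x $ 2 \<in> {0<..<b} \<and> x $ 3 \<in> {0<..<c}}"
  shows "(\<lambda>t. dirichlet_partition_function \<Omega> t
            - (a * b * c / (4 * pi * t) powr (3 / 2)
               - 2 * (a * b + b * c + a * c) / (16 * pi * t)
               + 4 * (a + b + c) / (32 * sqrt (pi * t))
               - 1 / 8))
         \<in> o[at_right 0](\<lambda>_. 1)"
proof -
  define l where "l = (vector [a, b, c] :: real ^ 3)"
  have l [simp]: "l $ 1 = a" "l $ 2 = b" "l $ 3 = c" by (simp_all add: l_def)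
  have la [simp]: "l \<bullet> axis 1 1 = a" "l \<bullet> axis 2 1 = b" "l \<bullet> axis 3 1 = c"
    by (simp_all add: inner_axis)
  have \<Omega>: "\<Omega> = box 0 l"
    by (auto simp: assms(4) mem_box_cart forall_3)
  interpret open_box l
  proof
    fix e :: "real ^ 3" assume "e \<in> Basis"
    then obtain i where "e = axis i 1" by (auto simp: Basis_vec_def)
    moreover have "\<forall>i. l $ i > 0" using assms(1-3) by (simp add: forall_3)
    ultimately show "0 < l \<bullet> e" by (simp add: inner_axis)
  qed
  define P where "P t = a * b * c / (4 * pi * t) powr (3 / 2) - 2 * (a * b + b * c + a * c) / (16 * pi * t)
      + 4 * (a + b + c) / (32 * sqrt (pi * t)) - 1 / 8" for t
  \<comment> \<open>The one-dimensional model for edge length \<open>d\<close>. The product of the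
    three models is exactly \<open>P\<close>, so no further error arises in comparing them.\<close>
  define Q where "Q d t = d / (2 * sqrt (pi * t)) - 1 / 2" for d t :: real
  have ax: "axis i 1 \<in> (Basis :: (real ^ 3) set)" for i by (auto simp: Basis_vec_def)
  note th = theta_asymptotics[OF ax[of 1]] theta_asymptotics[OF ax[of 2]] theta_asymptotics[OF ax[of 3]]
  have lim: "((\<lambda>t. sqrt t * Q d t) \<longlongrightarrow> d / (2 * sqrt pi)) (at_right 0)" for d
  proof -
    have "((\<lambda>t. d / (2 * sqrt pi) - sqrt t / 2) \<longlongrightarrow> d / (2 * sqrt pi) - sqrt 0 / 2) (at_right 0)"
      by (intro tendsto_intros) auto
    moreover have "\<forall>\<^sub>F t in at_right 0. d / (2 * sqrt pi) - sqrt t / 2 = sqrt t * Q d t"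
      by (auto simp: eventually_at_right_field Q_def real_sqrt_mult field_simps intro!: exI[of _ 1])
    ultimately show ?thesis by (simp add: tendsto_cong)
  qed
  let ?Z = "\<lambda>t. theta (axis 1 1) t * theta (axis 2 1) t * theta (axis 3 1) t"
  have "((\<lambda>t. ?Z t
      - Q a t * Q b t * Q c t) \<longlongrightarrow> 0) (at_right 0)"
    by (rule tendsto_prod3_diff[OF _ _ _ lim[of a] lim[of b] lim[of c]]) (use th in \<open>simp_all add: Q_def\<close>)
  moreover have "\<forall>\<^sub>F t in at_right 0. ?Z t
      - Q a t * Q b t * Q c t = dirichlet_partition_function \<Omega> t - P t"
  proof -
    have "?Z t
      - Q a t * Q b t * Q c t = dirichlet_partition_function \<Omega> t - P t" if t: "t > 0" for t
    proof -
      \<comment> \<open>In this variable every term of \<open>P\<close> is rational: the fractional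
        power becomes the cube of 2 s.\<close>
      define s where "s = sqrt (pi * t)"
      have s: "s > 0" "pi * t = s\<^sup>2" using t by (auto simp: s_def)
      have "4 * pi * t = (2 * s) powr 2" using s by (simp add: power_mult_distrib)
      then have "(4 * pi * t) powr (3 / 2) = (2 * s) powr 3" by (simp only: powr_powr) simp
      also have "\<dots> = (2 * s) ^ 3" using s by simp
      finally have p: "(4 * pi * t) powr (3 / 2) = (2 * s) ^ 3" .
      have "a * b * c / (2 * s) ^ 3 - 2 * (a * b + b * c + a * c) / (16 * s\<^sup>2) + 4 * (a + b + c) / (32 * s) - 1 / 8
          = (a / (2 * s) - 1 / 2) * (b / (2 * s) - 1 / 2) * (c / (2 * s) - 1 / 2)"
        using s by (simp add: field_simps power2_eq_square power3_eq_cube)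
      then have "Q a t * Q b t * Q c t = P t"
        unfolding P_def p Q_def s_def[symmetric] mult.assoc[of 16] s(2) by (simp add: abs_of_pos[OF s(1)])
      moreover have "dirichlet_partition_function \<Omega> t =
          ?Z t"
        unfolding \<Omega> dirichlet_partition_function_box[OF t] by (rule prod_Basis_3)
      ultimately show ?thesis by simp
    qed
    then show ?thesis by (auto simp: eventually_at_right_field intro!: exI[of _ 1])
  qed
  ultimately have "((\<lambda>t. dirichlet_partition_function \<Omega> t - P t) \<longlongrightarrow> 0) (at_right 0)"
    by (rule Lim_transform_eventually)
  then show ?thesis unfolding P_def by (intro smalloI_tendsto) auto
qed

end
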